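(* Let $(M^n,g)$ be a compact Hermitian manifold of complex dimension $n$, let $k\in\{1,2,3,4\}$, and let $\alpha,\beta\in\mathbb{R}$ with $\beta\neq0$. Suppose that $\mathcal{C}^{(k)}_{\alpha,\beta}(X)=0$ for every point $p\in M$ and every nonzero $X\in T^{1,0}_pM$. If $\alpha(n+1)+2\beta=0$, then $g$ is a balanced metric.
   Context: For a Hermitian manifold $(M^n,g)$ of complex dimension $n$, let $R$ be the curvature tensor of the Chern connection; in local holomorphic coordinates $$R_{i\bar j k\bar l}=-\frac{\partial^2 g_{k\bar l}}{\partial z^i\partial\bar z^j}+g^{p\bar q}\frac{\partial g_{k\bar q}}{\partial z^i}\frac{\partial g_{p\bar l}}{\partial\bar z^j}.$$ The four Chern Ricci curvatures are $$Ric^{(1)}_{i\bar j}=g^{k\bar l}R_{i\bar jk\bar l},\quad Ric^{(2)}_{k\bar l}=g^{i\bar j}R_{i\bar jk\bar l},\quad Ric^{(3)}_{i\bar l}=g^{k\bar j}R_{i\bar jk\bar l},\quad Ric^{(4)}_{k\bar j}=g^{i\bar l}R_{i\bar jk\bar l}.$$ The holomorphic sectional curvature is $H(X)=R(X,\bar X,X,\bar X)/|X|_g^4$ for nonzero $X\in T^{1,0}M$. For $\alpha,\beta\in\mathbb{R}$ and $k\in\{1,2,3,4\}$ the $k$th-mixed curvature is $$\mathcal{C}^{(k)}_{\alpha,\beta}(X)=\frac{\alpha}{|X|_g^2}Ric^{(k)}(X,\bar X)+\beta H(X),\qquad 0\ne X\in T^{1,0}M.$$ With $\omega=\sqrt{-1}\,g_{i\bar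 j}\,dz^i\wedge d\bar z^j$ the associated form, $g$ is called balanced if $d\omega^{n-1}=0$; equivalently, the torsion $(1,0)$-form $\eta=\sum_{i,k}T^k_{ik}\,dz^i$ vanishes, where $T^k_{ij}=g^{k\bar l}(\partial_i g_{j\bar l}-\partial_j g_{i\bar l})$ is the Chern torsion. *)

theory Defs
  imports "HOL-Analysis.Analysis" "HOL-Combinatorics.Permutations"
begin

section \<open>Smooth and holomorphic maps, Wirtinger derivatives\<close>

text \<open>The predicates \<open>ck_on\<close>, \<open>smooth_on\<close> and \<open>holomorphic_map_on\<close> are meant for open sets \<open>S\<close>.\<close>

primrec ck_on :: "nat \<Rightarrow> 'a::real_normed_vector set \<Rightarrow> ('a \<Rightarrow> 'b::real_normed_vector) \<Rightarrow> bool" where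
  "ck_on 0 S f \<longleftrightarrow> continuous_on S f"
| "ck_on (Suc m) S f \<longleftrightarrow>
     (\<forall>x\<in>S. f differentiable (at x)) \<and> (\<forall>v. ck_on m S (\<lambda>x. frechet_derivative f (at x) v))"

definition smooth_on :: "'a::real_normed_vector set \<Rightarrow> ('a \<Rightarrow> 'b::real_normed_vector) \<Rightarrow> bool" where
  "smooth_on S f \<longleftrightarrow> (\<forall>m. ck_on m S f)"

definition holomorphic_map_on :: "(complex^'n) set \<Rightarrow> (complex^'n \<Rightarrow> complex^'n) \<Rightarrow> bool" where
  "holomorphic_map_on S f \<longleftrightarrow>
     (\<forall>z\<in>S. \<exists>D. (f has_derivative D) (at z) \<and> (\<forall>c v. D (c *s v) = c *s D v))"

definition d_dz :: "'n \<Rightarrow> (complex^'n \<Rightarrow> complex) \<Rightarrow> complex^'n \<Rightarrow> complex" where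
  "d_dz i f z =
     (frechet_derivative f (at z) (axis i 1) - \<i> * frechet_derivative f (at z) (axis i \<i>)) / 2"

definition d_dzbar :: "'n \<Rightarrow> (complex^'n \<Rightarrow> complex) \<Rightarrow> complex^'n \<Rightarrow> complex" where
  "d_dzbar i f z =
     (frechet_derivative f (at z) (axis i 1) + \<i> * frechet_derivative f (at z) (axis i \<i>)) / 2"


section \<open>Complex manifolds and their holomorphic tangent spaces\<close>

text \<open>A chart is a coordinate domain together with a coordinate map; the values of the map outside
  the domain are irrelevant.\<close>

type_synonym ('m, 'n) chart = "'m set \<times> ('m \<Rightarrow> complex^'n)"

definition chart_image :: "('m, 'n::finite) chart \<Rightarrow> (complex^'n) set" where
  "chart_image c = snd c ` fst c"

definition chart_inv :: "('m, 'n::finite) chart \<Rightarrow> complex^'n \<Rightarrow> 'm" where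
  "chart_inv c = inv_into (fst c) (snd c)"

definition transition :: "('m, 'n::finite) chart \<Rightarrow> ('m, 'n) chart \<Rightarrow> complex^'n \<Rightarrow> complex^'n" where
  "transition c d = snd d \<circ> chart_inv c"

definition complex_manifold :: "'m topology \<Rightarrow> ('m, 'n::finite) chart set \<Rightarrow> bool" where
  "complex_manifold M A \<longleftrightarrow>
     Hausdorff_space M \<and> second_countable M \<and>
     (\<forall>c\<in>A. openin M (fst c) \<and> open (chart_image c) \<and>
        homeomorphic_map (subtopology M (fst c)) (top_of_set (chart_image c)) (snd c)) \<and>
     (\<Union>c\<in>A. fst c) = topspace M \<and>
     (\<forall>c\<in>A. \<forall>d\<in>A. holomorphic_map_on (snd c ` (fst c \<inter> fst d)) (transition c d))"

definition charts_at :: "('m, 'n::finite) chart set \<Rightarrow> 'm \<Rightarrow> ('m, 'n) chart set" where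
  "charts_at A p = {c\<in>A. p \<in> fst c}"

text \<open>A (1,0)-vector at \<open>p\<close> is encoded by the family of its component vectors \<open>X c\<close> with respect to
  the coordinate frames of all charts \<open>c\<close> around \<open>p\<close>; the family has to obey the transformation law
  of holomorphic tangent vectors, and it is set to 0 at all other charts.\<close>

type_synonym ('m, 'n) tvec = "('m, 'n) chart \<Rightarrow> complex^'n"

definition T10 :: "('m, 'n::finite) chart set \<Rightarrow> 'm \<Rightarrow> ('m, 'n) tvec set" where
  "T10 A p =
     {X. (\<forall>c\<in>charts_at A p. \<forall>d\<in>charts_at A p.
            X d = frechet_derivative (transition c d) (at (snd c p)) (X c)) \<and>
         (\<forall>c. c \<notin> charts_at A p \<longrightarrow> X c = 0)}"

text \<open>The coordinate vector \<open>\<partial>/\<partial>z\<^sup>i\<close> of the chart \<open>c\<close> at the point \<open>p\<close>.\<close>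

definition coord_vec :: "('m, 'n::finite) chart set \<Rightarrow> ('m, 'n) chart \<Rightarrow> 'm \<Rightarrow> 'n \<Rightarrow> ('m, 'n) tvec" where
  "coord_vec A c p i = (\<lambda>d.
     if d \<in> charts_at A p then frechet_derivative (transition c d) (at (snd c p)) (axis i 1) else 0)"


section \<open>Hermitian metrics\<close>

text \<open>The sesquilinear encoding \<open>g p X Y\<close> is linear in \<open>X\<close> and conjugate linear in \<open>Y\<close>, so it is the value
  of the metric on \<open>X\<close> and the conjugate of \<open>Y\<close>. Row \<open>k\<close>, column \<open>l\<close> of the local matrix is the
  component with unbarred index \<open>k\<close> and barred index \<open>l\<close>.\<close>

type_synonym ('m, 'n) metric = "'m \<Rightarrow> ('m, 'n) tvec \<Rightarrow> ('m, 'n) tvec \<Rightarrow> complex"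

definition local_metric ::
  "('m, 'n::finite) chart set \<Rightarrow> ('m, 'n) metric \<Rightarrow> ('m, 'n) chart \<Rightarrow> complex^'n \<Rightarrow> complex^'n^'n" where
  "local_metric A g c z =
     (let p = chart_inv c z in \<chi> k l. g p (coord_vec A c p k) (coord_vec A c p l))"

definition hermitian_metric :: "'m topology \<Rightarrow> ('m, 'n::finite) chart set \<Rightarrow> ('m, 'n) metric \<Rightarrow> bool" where
  "hermitian_metric M A g \<longleftrightarrow>
     (\<forall>p\<in>topspace M.
        (\<forall>X\<in>T10 A p. \<forall>Y\<in>T10 A p. \<forall>Z\<in>T10 A p. g p (\<lambda>c. X c + Y c) Z = g p X Z + g p Y Z) \<and>
        (\<forall>X\<in>T10 A p. \<forall>Y\<in>T10 A p. \<forall>a. g p (\<lambda>c. a *s X c) Y = a * g p X Y) \<and>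
        (\<forall>X\<in>T10 A p. \<forall>Y\<in>T10 A p. g p Y X = cnj (g p X Y)) \<and>
        (\<forall>X\<in>T10 A p. X \<noteq> (\<lambda>_. 0) \<longrightarrow> Re (g p X X) > 0)) \<and>
     (\<forall>c\<in>A. \<forall>k l. smooth_on (chart_image c) (\<lambda>z. local_metric A g c z $ k $ l))"


section \<open>Chern curvature in local coordinates\<close>

text \<open>Here \<open>G\<close> is a local matrix of the metric. The inverse \<open>g\<^sup>p\<^sup>q\<close> is normalised by
  \<open>\<Sum>q. g\<^sup>p\<^sup>q g\<^sub>k\<^sub>q = \<delta>\<^sub>p\<^sub>k\<close> (the second index of each factor being barred), so it is the transpose of
  the inverse matrix.\<close>

definition g_inv :: "(complex^'n \<Rightarrow> complex^'n^'n) \<Rightarrow> complex^'n \<Rightarrow> 'n::finite \<Rightarrow> 'n \<Rightarrow> complex" where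
  "g_inv G z p q = matrix_inv (G z) $ q $ p"

definition chern_R ::
  "(complex^'n \<Rightarrow> complex^'n^'n) \<Rightarrow> complex^'n \<Rightarrow> 'n::finite \<Rightarrow> 'n \<Rightarrow> 'n \<Rightarrow> 'n \<Rightarrow> complex" where
  "chern_R G z i j k l =
     - d_dz i (d_dzbar j (\<lambda>w. G w $ k $ l)) z
     + (\<Sum>p\<in>UNIV. \<Sum>q\<in>UNIV.
          g_inv G z p q * d_dz i (\<lambda>w. G w $ k $ q) z * d_dzbar j (\<lambda>w. G w $ p $ l) z)"

definition chern_ricci ::
  "nat \<Rightarrow> (complex^'n \<Rightarrow> complex^'n^'n) \<Rightarrow> complex^'n \<Rightarrow> 'n::finite \<Rightarrow> 'n \<Rightarrow> complex" where
  "chern_ricci m G z a b =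
     (if m = 1 then \<Sum>k\<in>UNIV. \<Sum>l\<in>UNIV. g_inv G z k l * chern_R G z a b k l
      else if m = 2 then \<Sum>i\<in>UNIV. \<Sum>j\<in>UNIV. g_inv G z i j * chern_R G z i j a b
      else if m = 3 then \<Sum>k\<in>UNIV. \<Sum>j\<in>UNIV. g_inv G z k j * chern_R G z a j k b
      else if m = 4 then \<Sum>i\<in>UNIV. \<Sum>l\<in>UNIV. g_inv G z i l * chern_R G z i b a l
      else 0)"

definition ricci_form ::
  "nat \<Rightarrow> (complex^'n \<Rightarrow> complex^'n^'n) \<Rightarrow> complex^'n \<Rightarrow> complex^'n::finite \<Rightarrow> complex" where
  "ricci_form m G z x = (\<Sum>a\<in>UNIV. \<Sum>b\<in>UNIV. chern_ricci m G z a b * x$a * cnj (x$b))"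

definition norm2_g :: "(complex^'n \<Rightarrow> complex^'n^'n) \<Rightarrow> complex^'n \<Rightarrow> complex^'n::finite \<Rightarrow> real" where
  "norm2_g G z x = Re (\<Sum>i\<in>UNIV. \<Sum>j\<in>UNIV. G z $ i $ j * x$i * cnj (x$j))"

definition hol_sec_curv ::
  "(complex^'n \<Rightarrow> complex^'n^'n) \<Rightarrow> complex^'n \<Rightarrow> complex^'n::finite \<Rightarrow> complex" where
  "hol_sec_curv G z x =
     (\<Sum>i\<in>UNIV. \<Sum>j\<in>UNIV. \<Sum>k\<in>UNIV. \<Sum>l\<in>UNIV.
        chern_R G z i j k l * x$i * cnj (x$j) * x$k * cnj (x$l))
     / complex_of_real ((norm2_g G z x)^2)"

text \<open>The mixed curvature of \<open>X\<close> at \<open>p\<close>, computed in the chart \<open>c\<close> around \<open>p\<close>. It takes complex values,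
  since the third and fourth Ricci curvatures need not be Hermitian.\<close>

definition mixed_curvature ::
  "('m, 'n::finite) chart set \<Rightarrow> ('m, 'n) metric \<Rightarrow> nat \<Rightarrow> real \<Rightarrow> real \<Rightarrow> ('m, 'n) chart \<Rightarrow> 'm
     \<Rightarrow> ('m, 'n) tvec \<Rightarrow> complex" where
  "mixed_curvature A g m \<alpha> \<beta> c p X =
     (let G = local_metric A g c; z = snd c p; x = X c in
        complex_of_real (\<alpha> / norm2_g G z x) * ricci_form m G z x
        + complex_of_real \<beta> * hol_sec_curv G z x)"


section \<open>Differential forms and balanced metrics\<close>

text \<open>A complex-valued alternating \<open>q\<close>-form on the real vector space underlying \<open>complex^'n\<close> is a
  function of a sequence of vectors that uses only the entries \<open>0, \<dots>, q - 1\<close>; the degree is passed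
  separately.\<close>

type_synonym 'n alt_form = "(nat \<Rightarrow> complex^'n) \<Rightarrow> complex"

definition wedge :: "nat \<Rightarrow> nat \<Rightarrow> 'n alt_form \<Rightarrow> 'n alt_form \<Rightarrow> 'n alt_form" where
  "wedge q r a b v =
     (\<Sum>\<sigma> | \<sigma> permutes {..<q + r}.
        of_int (sign \<sigma>) * a (\<lambda>i. v (\<sigma> i)) * b (\<lambda>i. v (\<sigma> (q + i)))) / (fact q * fact r)"

primrec wedge_power2 :: "nat \<Rightarrow> 'n alt_form \<Rightarrow> 'n alt_form" where
  "wedge_power2 0 a = (\<lambda>_. 1)"
| "wedge_power2 (Suc m) a = wedge (2 * m) 2 (wedge_power2 m a) a"

text \<open>Exterior derivative of a \<open>q\<close>-form \<open>\<phi>\<close> by the invariant formula for constant vector fields; the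
  sequence inside omits \<open>v j\<close>.\<close>

definition ext_deriv ::
  "nat \<Rightarrow> (complex^'n \<Rightarrow> 'n alt_form) \<Rightarrow> complex^'n::finite \<Rightarrow> 'n alt_form" where
  "ext_deriv q \<phi> z v =
     (\<Sum>j\<le>q. (-1)^j *
        frechet_derivative (\<lambda>w. \<phi> w (\<lambda>i. if i < j then v i else v (Suc i))) (at z) (v j))"

definition dz :: "'n::finite \<Rightarrow> 'n alt_form" where
  "dz i v = v 0 $ i"

definition dzbar :: "'n::finite \<Rightarrow> 'n alt_form" where
  "dzbar i v = cnj (v 0 $ i)"

definition fundamental_form :: "(complex^'n \<Rightarrow> complex^'n^'n) \<Rightarrow> complex^'n \<Rightarrow> 'n::finite alt_form" where
  "fundamental_form G z v =
     \<i> * (\<Sum>i\<in>UNIV. \<Sum>j\<in>UNIV. G z $ i $ j * wedge 1 1 (dz i) (dzbar j) v)"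

definition balanced :: "('m, 'n::finite) chart set \<Rightarrow> ('m, 'n) metric \<Rightarrow> bool" where
  "balanced A g \<longleftrightarrow>
     (\<forall>c\<in>A. \<forall>z\<in>chart_image c. \<forall>v.
        ext_deriv (2 * (CARD('n) - 1))
          (\<lambda>w. wedge_power2 (CARD('n) - 1) (fundamental_form (local_metric A g c) w)) z v = 0)"

end

theory Submission
  imports Defs "HOL-Complex_Analysis.Cauchy_Integral_Formula" "HOL-Library.Numeral_Type"
begin

text \<open>Write \<open>s\<close> and \<open>s'\<close> for the two scalar curvatures, the full traces of \<open>R\<close> that pair the indices as
  \<open>(i,j),(k,l)\<close> and as \<open>(i,l),(k,j)\<close>. A vanishing mixed curvature is the vanishing on the diagonal of a
  tensor of bidegree \<open>(2,2)\<close>. Polarising it and taking the trace twice gives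
  \<open>\<alpha> (n + 1) t + \<beta> (s + s') = 0\<close>, where the trace \<open>t\<close> of the Ricci curvature in question is one of \<open>s\<close>
  and \<open>s'\<close>. As \<open>\<alpha> (n + 1) = - 2 \<beta>\<close>, this says \<open>s + s' = 2 t\<close>, hence \<open>s = s'\<close>
  (\<open>scalars_coincide\<close>).

  The rest of the proof shows that a compact Hermitian manifold with \<open>s = s'\<close> is balanced. Let \<open>c\<close> be the
  cofactor matrix \<open>det g\<close> times \<open>g\<^sup>-\<^sup>1\<close>. Its divergence \<open>V\<close> in the barred index is, by Jacobi's formula,
  the conjugate of the torsion form \<open>\<eta>\<close> with its index raised by \<open>c\<close>. The divergence of \<open>V\<close> is
  \<open>|V|\<^sup>2 / det g\<close> plus a multiple of \<open>s' - s\<close>; so for \<open>s = s'\<close> it is nonnegative, and it vanishes only where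
  \<open>\<eta>\<close> does (\<open>double_divergence\<close>).
  The function \<open>div V / det g\<close> is the formal adjoint of the trace of the complex Hessian, applied to the
  constant 1. Since that trace annihilates constants, the integral of \<open>div V / det g\<close> over the compact
  manifold is 0 and \<open>V\<close> vanishes (\<open>cofactor_div_vanishes\<close>).

  Integration over the manifold is done with a finite partition of unity: the trace of the Hessian and the
  Riemannian volume do not depend on the chart. The first statement needs that holomorphic maps of several
  variables are twice differentiable (\<open>holo_fun_on_derivative\<close>), the second one that the real determinant
  of a complex-linear map is \<open>|det|\<^sup>2\<close> (\<open>det_realified\<close>).

  Finally the exterior derivative of \<open>\<omega>\<^sup>n\<^sup>-\<^sup>1\<close> is an alternating sum of products of covectors in which only
  the traces of the torsion survive (\<open>ext_deriv_fundamental_power\<close>).\<close>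

section \<open>Functions of class \<open>C\<^sup>m\<close>\<close>

lemma frechet_derivative_cong_open:
  assumes "open S" "x \<in> S" "\<And>y. y \<in> S \<Longrightarrow> f y = g y"
  shows "frechet_derivative f (at x) = frechet_derivative g (at x)"
    and "f differentiable (at x) \<longleftrightarrow> g differentiable (at x)"
proof -
  have *: "(f has_derivative D) (at x) \<longleftrightarrow> (g has_derivative D) (at x)" for D
    using has_derivative_transform_within_open[OF _ assms(1,2), of f D UNIV g]
      has_derivative_transform_within_open[OF _ assms(1,2), of g D UNIV f] assms(3) by auto
  then show "frechet_derivative f (at x) = frechet_derivative g (at x)"
    by (simp add: frechet_derivative_def)
  show "f differentiable (at x) \<longleftrightarrow> g differentiable (at x)"
    using * by (simp add: differentiable_def)
qed

lemma frechet_derivative_eqI: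
  "(f has_derivative D) (at x) \<Longrightarrow> frechet_derivative f (at x) v = D v"
  using frechet_derivative_at by metis

lemma ck_cong:
  assumes "open S" "\<And>x. x \<in> S \<Longrightarrow> f x = g x" "ck_on m S f"
  shows "ck_on m S g"
  using assms
proof (induction m arbitrary: f g)
  case 0
  then show ?case using continuous_on_cong by (metis ck_on.simps(1))
next
  case (Suc m)
  have "ck_on m S (\<lambda>x. frechet_derivative g (at x) v)" for v
    by (rule Suc.IH[of "\<lambda>x. frechet_derivative f (at x) v"])
       (use Suc frechet_derivative_cong_open(1)[OF \<open>open S\<close>, of _ f g] in auto)
  then show ?case
    using Suc frechet_derivative_cong_open(2)[OF \<open>open S\<close>, of _ f g] by auto
qed

lemma ck_Suc_imp: "ck_on (Suc m) S f \<Longrightarrow> ck_on m S f"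
  by (induction m arbitrary: f)
     (auto intro!: continuous_at_imp_continuous_on differentiable_imp_continuous_within)

lemma ck_le: "ck_on m S f \<Longrightarrow> l \<le> m \<Longrightarrow> ck_on l S f"
  by (induction m arbitrary: l) (auto simp del: ck_on.simps dest: ck_Suc_imp simp: le_Suc_eq)

lemma ck_continuous: "ck_on m S f \<Longrightarrow> continuous_on S f"
  using ck_le[of m S f 0] by simp

lemma ck_differentiable: "ck_on m S f \<Longrightarrow> 0 < m \<Longrightarrow> x \<in> S \<Longrightarrow> f differentiable (at x)"
  by (cases m) auto

lemma ck_has_derivative:
  "ck_on m S f \<Longrightarrow> 0 < m \<Longrightarrow> x \<in> S \<Longrightarrow> (f has_derivative frechet_derivative f (at x)) (at x)"
  using ck_differentiable frechet_derivative_works by blast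

text \<open>Used for functions that are given by different formulas on the members of an open cover, such as
  a function extended by zero outside a compact set.\<close>

lemma ck_local:
  assumes "\<And>x. x \<in> S \<Longrightarrow> \<exists>T. open T \<and> x \<in> T \<and> ck_on m T f"
  shows "ck_on m S f"
  using assms
proof (induction m arbitrary: f)
  case 0
  have "isCont f x" if "x \<in> S" for x
    using 0[OF that] by (auto simp: continuous_on_eq_continuous_at)
  then show ?case by (simp add: continuous_at_imp_continuous_on)
next
  case (Suc m)
  have "ck_on m S (\<lambda>x. frechet_derivative f (at x) v)" for v
    by (rule Suc.IH) (use Suc.prems in fastforce)
  moreover have "f differentiable (at x)" if "x \<in> S" for x
    using Suc.prems[OF that] by auto
  ultimately show ?case by simp
qed

lemma ck_const: "ck_on m S (\<lambda>_. c)"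
  by (induction m arbitrary: c) (auto simp: frechet_derivative_const)

lemma ck_bounded_linear:
  assumes "bounded_linear T" "ck_on m S f" "open S"
  shows "ck_on m S (\<lambda>x. T (f x))"
  using assms(2)
proof (induction m arbitrary: f)
  case 0
  then show ?case using bounded_linear.continuous_on[OF assms(1)] by auto
next
  case (Suc m)
  have D: "((\<lambda>x. T (f x)) has_derivative (\<lambda>v. T (frechet_derivative f (at x) v))) (at x)"
    if "x \<in> S" for x
    using bounded_linear.has_derivative[OF assms(1) ck_has_derivative[OF Suc.prems _ that]] by simp
  have "ck_on m S (\<lambda>x. frechet_derivative (\<lambda>x. T (f x)) (at x) v)" for v
    by (rule ck_cong[OF \<open>open S\<close> _ Suc.IH[of "\<lambda>x. frechet_derivative f (at x) v"]])
       (use Suc.prems frechet_derivative_eqI[OF D] in auto)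
  then show ?case using D by (auto simp: differentiable_def)
qed

lemma ck_add:
  assumes "ck_on m S f" "ck_on m S g" "open S"
  shows "ck_on m S (\<lambda>x. f x + g x)"
  using assms(1,2)
proof (induction m arbitrary: f g)
  case 0
  then show ?case by (auto intro: continuous_on_add)
next
  case (Suc m)
  have D: "((\<lambda>x. f x + g x) has_derivative
      (\<lambda>v. frechet_derivative f (at x) v + frechet_derivative g (at x) v)) (at x)"
    if "x \<in> S" for x
    using has_derivative_add[OF ck_has_derivative[OF Suc.prems(1) _ that]
      ck_has_derivative[OF Suc.prems(2) _ that]] by simp
  have "ck_on m S (\<lambda>x. frechet_derivative (\<lambda>x. f x + g x) (at x) v)" for v
    by (rule ck_cong[OF \<open>open S\<close> _ Suc.IH[of "\<lambda>x. frechet_derivative f (at x) v"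
            "\<lambda>x. frechet_derivative g (at x) v"]])
       (use Suc.prems frechet_derivative_eqI[OF D] in auto)
  then show ?case using D by (auto simp: differentiable_def)
qed

lemma ck_sum:
  assumes "\<And>i. i \<in> I \<Longrightarrow> ck_on m S (f i)" "open S"
  shows "ck_on m S (\<lambda>x. \<Sum>i\<in>I. f i x)"
  using assms(1)
  by (induction I rule: infinite_finite_induct) (auto intro!: ck_add assms(2) ck_const)

lemma ck_bilinear:
  assumes B: "bounded_bilinear B" and "ck_on m S f" "ck_on m S g" "open S"
  shows "ck_on m S (\<lambda>x. B (f x) (g x))"
  using assms(2,3)
proof (induction m arbitrary: f g)
  case 0
  then show ?case using bounded_bilinear.continuous_on[OF B] by auto
next
  case (Suc m)
  have D: "((\<lambda>x. B (f x) (g x)) has_derivative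
      (\<lambda>v. B (f x) (frechet_derivative g (at x) v) + B (frechet_derivative f (at x) v) (g x))) (at x)"
    if "x \<in> S" for x
    using bounded_bilinear.FDERIV[OF B ck_has_derivative[OF Suc.prems(1) _ that]
      ck_has_derivative[OF Suc.prems(2) _ that]] by simp
  have "ck_on m S (\<lambda>x. frechet_derivative (\<lambda>x. B (f x) (g x)) (at x) v)" for v
    by (rule ck_cong[OF \<open>open S\<close> _ ck_add[OF
          Suc.IH[of f "\<lambda>x. frechet_derivative g (at x) v"]
          Suc.IH[of "\<lambda>x. frechet_derivative f (at x) v" g] \<open>open S\<close>]])
       (use Suc.prems ck_Suc_imp[of m S] frechet_derivative_eqI[OF D] in \<open>auto\<close>)
  then show ?case using D by (auto simp: differentiable_def)
qed

lemmas ck_mult = ck_bilinear[OF bounded_bilinear_mult]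
lemmas ck_scaleR = ck_bilinear[OF bounded_bilinear_scaleR]
lemmas ck_inner = ck_bilinear[OF bounded_bilinear_inner]
lemmas ck_cnj = ck_bounded_linear[OF bounded_linear_cnj]
lemmas ck_of_real = ck_bounded_linear[OF bounded_linear_of_real]
lemmas ck_nth = ck_bounded_linear[OF bounded_linear_vec_nth]

lemma ck_cmult: "ck_on m S f \<Longrightarrow> open S \<Longrightarrow> ck_on m S (\<lambda>x. c * f x)" for c :: complex
  by (intro ck_mult ck_const)

lemma ck_diff:
  assumes "ck_on m S f" "ck_on m S g" "open S"
  shows "ck_on m S (\<lambda>x. f x - g x)"
  using ck_add[OF assms(1) ck_bounded_linear[OF bounded_linear_minus[OF bounded_linear_ident] assms(2,3)] assms(3)]
  by simp

lemma ck_prod: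
  fixes f :: "'i \<Rightarrow> 'a::real_normed_vector \<Rightarrow> complex"
  assumes "\<And>i. i \<in> I \<Longrightarrow> ck_on m S (f i)" "open S"
  shows "ck_on m S (\<lambda>x. \<Prod>i\<in>I. f i x)"
  using assms(1)
  by (induction I rule: infinite_finite_induct) (auto intro!: ck_mult assms(2) ck_const)

lemma ck_id: "ck_on m S (\<lambda>x. x)"
  by (cases m) (auto simp: ck_const frechet_derivative_ident)

lemma ck_linear: "bounded_linear T \<Longrightarrow> open S \<Longrightarrow> ck_on m S T"
  using ck_bounded_linear[OF _ ck_id] by auto

lemma ck_inverse:
  fixes f :: "'a::real_normed_vector \<Rightarrow> complex"
  assumes "ck_on m S f" "open S" "\<And>x. x \<in> S \<Longrightarrow> f x \<noteq> 0"
  shows "ck_on m S (\<lambda>x. inverse (f x))"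
  using assms(1)
proof (induction m)
  case 0
  then show ?case by (auto intro!: continuous_on_inverse simp: assms(3))
next
  case (Suc m)
  have D: "((\<lambda>x. inverse (f x)) has_derivative
      (\<lambda>v. - (inverse (f x) * frechet_derivative f (at x) v * inverse (f x)))) (at x)"
    if "x \<in> S" for x
    using Deriv.has_derivative_inverse[OF _ ck_has_derivative[OF Suc.prems _ that]] assms(3)[OF that]
    by simp
  have "ck_on m S (\<lambda>x. frechet_derivative (\<lambda>x. inverse (f x)) (at x) v)" for v
  proof (rule ck_cong[OF \<open>open S\<close>])
    show "ck_on m S (\<lambda>x. (-1) * (inverse (f x) * frechet_derivative f (at x) v * inverse (f x)))"
      using Suc.IH ck_Suc_imp[OF Suc.prems] Suc.prems by (intro ck_cmult ck_mult \<open>open S\<close>) auto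
  qed (use frechet_derivative_eqI[OF D] in auto)
  then show ?case using D by (auto simp: differentiable_def)
qed

lemma ck_divide:
  fixes f :: "'a::real_normed_vector \<Rightarrow> complex"
  assumes "ck_on m S f" "ck_on m S g" "open S" "\<And>x. x \<in> S \<Longrightarrow> g x \<noteq> 0"
  shows "ck_on m S (\<lambda>x. f x / g x)"
  using ck_mult[OF assms(1) ck_inverse[OF assms(2-4)] assms(3)] by (simp add: field_simps)

text \<open>The chain rule writes \<open>D(f \<circ> \<phi>)(x) v\<close> as a sum over an orthonormal basis \<open>b\<close> of products of
  a component of \<open>D\<phi>(x) v\<close> with the composition of \<open>\<phi>\<close> and a partial derivative of \<open>f\<close>, so the order
  of differentiability can be raised one step at a time.\<close>

lemma ck_compose:
  fixes \<phi> :: "'a::real_normed_vector \<Rightarrow> 'b::euclidean_space" and f :: "'b \<Rightarrow> 'c::real_normed_vector"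
  assumes "ck_on m T f" "ck_on m S \<phi>" "open S" "\<phi> ` S \<subseteq> T"
  shows "ck_on m S (\<lambda>x. f (\<phi> x))"
  using assms(1,2)
proof (induction m arbitrary: f)
  case 0
  then show ?case using continuous_on_compose2[of T f S \<phi>] assms(4) by simp
next
  case (Suc m)
  have D: "((\<lambda>x. f (\<phi> x)) has_derivative
      (\<lambda>v. frechet_derivative f (at (\<phi> x)) (frechet_derivative \<phi> (at x) v))) (at x)"
    if "x \<in> S" for x
    using has_derivative_compose[OF ck_has_derivative[OF Suc.prems(2) _ that]
      ck_has_derivative[OF Suc.prems(1)]] that assms(4) by auto
  have "ck_on m S (\<lambda>x. frechet_derivative (\<lambda>x. f (\<phi> x)) (at x) v)" for v
  proof (rule ck_cong[OF \<open>open S\<close>])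
    show "ck_on m S (\<lambda>x. \<Sum>b\<in>Basis. (frechet_derivative \<phi> (at x) v \<bullet> b) *\<^sub>R
                        frechet_derivative f (at (\<phi> x)) b)"
    proof (intro ck_sum ck_scaleR ck_inner ck_const \<open>open S\<close>)
      show "ck_on m S (\<lambda>x. frechet_derivative \<phi> (at x) v)" using Suc.prems by auto
      show "ck_on m S (\<lambda>x. frechet_derivative f (at (\<phi> x)) b)" for b
        by (rule Suc.IH) (use Suc.prems ck_Suc_imp in auto)
    qed
    fix x assume x: "x \<in> S"
    have lin: "linear (frechet_derivative f (at (\<phi> x)))"
      using linear_frechet_derivative ck_differentiable[OF Suc.prems(1)] assms(4) x by blast
    show "(\<Sum>b\<in>Basis. (frechet_derivative \<phi> (at x) v \<bullet> b) *\<^sub>R frechet_derivative f (at (\<phi> x)) b)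
        = frechet_derivative (\<lambda>x. f (\<phi> x)) (at x) v"
      unfolding frechet_derivative_eqI[OF D[OF x]]
      by (subst (3) euclidean_representation[symmetric])
         (simp only: linear_sum[OF lin] linear_scale[OF lin])
  qed
  then show ?case using D by (auto simp: differentiable_def)
qed

lemma ck_vec:
  fixes f :: "'a::real_normed_vector \<Rightarrow> complex^'n"
  assumes "\<And>i. ck_on m S (\<lambda>x. f x $ i)" "open S"
  shows "ck_on m S f"
proof -
  have bl: "bounded_linear (axis i :: complex \<Rightarrow> complex^'n)" for i
    by (auto intro!: linear_conv_bounded_linear[THEN iffD1] linearI simp: axis_def vec_eq_iff)
  have "ck_on m S (\<lambda>x. \<Sum>i\<in>UNIV. axis i (f x $ i))"
    by (intro ck_sum ck_bounded_linear[OF bl] assms)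
  moreover have "(\<Sum>i\<in>UNIV. axis i (f x $ i)) = f x" for x
    by (simp add: vec_eq_iff axis_def if_distrib cong: if_cong)
  ultimately show ?thesis by simp
qed

section \<open>Holomorphic functions of several variables\<close>

text \<open>The scalar counterpart of \<open>holomorphic_map_on\<close>: only complex linearity of the real derivative is required,
  so that higher regularity has to be proved.\<close>

definition holo_fun_on :: "(complex^'n) set \<Rightarrow> (complex^'n \<Rightarrow> complex) \<Rightarrow> bool" where
  "holo_fun_on S f \<longleftrightarrow> (\<forall>z\<in>S. \<exists>D. (f has_derivative D) (at z) \<and> (\<forall>c v. D (c *s v) = c * D v))"

lemma bounded_linear_vscale_left: "bounded_linear (\<lambda>c. c *s v :: complex^'n)"
  by (auto intro!: linear_conv_bounded_linear[THEN iffD1] linearI simp: vec_eq_iff algebra_simps)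

lemma holo_fun_on_has_derivative:
  assumes "holo_fun_on S f" "z \<in> S"
  shows "(f has_derivative frechet_derivative f (at z)) (at z)"
    and "frechet_derivative f (at z) (c *s v) = c * frechet_derivative f (at z) v"
proof -
  obtain D where D: "(f has_derivative D) (at z)" "\<And>c v. D (c *s v) = c * D v"
    using assms by (auto simp: holo_fun_on_def)
  moreover have "D = frechet_derivative f (at z)" using D(1) frechet_derivative_at by blast
  ultimately show "(f has_derivative frechet_derivative f (at z)) (at z)"
    "frechet_derivative f (at z) (c *s v) = c * frechet_derivative f (at z) v" by auto
qed

lemma holo_fun_on_continuous: "holo_fun_on S f \<Longrightarrow> continuous_on S f"
  by (meson continuous_at_imp_continuous_on has_derivative_continuous holo_fun_on_has_derivative(1))

text \<open>This is Cauchy's formula for the derivative along the complex line through \<open>z\<close> in direction \<open>v\<close>. It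
  represents a derivative, about whose dependence on \<open>z\<close> nothing is known yet, as an integral of
  values of \<open>f\<close>.\<close>

lemma directional_Cauchy_formula:
  assumes f: "holo_fun_on S f" and r: "r > 0" and S: "\<And>\<zeta>. norm \<zeta> \<le> r \<Longrightarrow> z + \<zeta> *s v \<in> S"
  shows "frechet_derivative f (at z) v =
    integral (cbox 0 1) (\<lambda>t. f (z + circlepath 0 r t *s v) / circlepath 0 r t)"
proof -
  define F where "F \<zeta> = f (z + \<zeta> *s v)" for \<zeta>
  have der: "(F has_field_derivative frechet_derivative f (at (z + \<zeta> *s v)) v) (at \<zeta>)"
    if "norm \<zeta> \<le> r" for \<zeta>
  proof -
    have "((\<lambda>\<zeta>. z + \<zeta> *s v) has_derivative (\<lambda>\<zeta>. \<zeta> *s v)) (at \<zeta>)"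
      using bounded_linear_imp_has_derivative[OF bounded_linear_vscale_left]
      by (auto intro!: derivative_eq_intros)
    from has_derivative_compose[OF this holo_fun_on_has_derivative(1)[OF f S[OF that]]]
    have "(F has_derivative (\<lambda>h. frechet_derivative f (at (z + \<zeta> *s v)) (h *s v))) (at \<zeta>)"
      by (simp add: F_def [abs_def])
    moreover have "(\<lambda>h. frechet_derivative f (at (z + \<zeta> *s v)) (h *s v)) = (*) (frechet_derivative f (at (z + \<zeta> *s v)) v)"
      using holo_fun_on_has_derivative(2)[OF f S[OF that]] by (auto simp: mult.commute)
    ultimately show ?thesis
      by (simp add: has_field_derivative_def)
  qed
  have hol: "F holomorphic_on cball 0 r"
    by (intro holomorphic_onI) (use der in \<open>auto simp: field_differentiable_def intro: has_field_derivative_at_within\<close>)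
  have "contour_integral (circlepath 0 r) (\<lambda>u. F u/(u-0)^2) = (2 * pi * \<i>) * deriv F 0"
    using hol r by (intro Cauchy_contour_integral_circlepath_2)
      (auto intro: holomorphic_on_imp_continuous_on holomorphic_on_subset)
  also have "deriv F 0 = frechet_derivative f (at z) v"
    using DERIV_imp_deriv[OF der[of 0]] r by simp
  also have "contour_integral (circlepath 0 r) (\<lambda>u. F u/(u-0)^2) =
      integral {0..1} (\<lambda>t. (2 * pi * \<i>) * (F (circlepath 0 r t) / circlepath 0 r t))"
    unfolding contour_integral_integral vector_derivative_circlepath
    using r by (intro integral_cong) (simp add: circlepath power2_eq_square field_simps)
  also have "\<dots> = (2 * pi * \<i>) * integral {0..1} (\<lambda>t. F (circlepath 0 r t) / circlepath 0 r t)"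
    by (rule integral_mult_right)
  finally show ?thesis by (simp add: F_def)
qed

text \<open>Differentiation under the integral sign needs the same circle for all points near \<open>z0\<close>.\<close>

lemma uniform_circles:
  fixes z0 v :: "complex^'n"
  assumes "open S" "z0 \<in> S"
  obtains \<rho> r where "\<rho> > 0" "r > 0" "\<And>z \<zeta>. z \<in> ball z0 \<rho> \<Longrightarrow> norm \<zeta> \<le> r \<Longrightarrow> z + \<zeta> *s v \<in> S"
    "ball z0 \<rho> \<subseteq> S"
proof -
  obtain e where e: "e > 0" "ball z0 e \<subseteq> S" using assms open_contains_ball by blast
  obtain K where K: "K > 0" "\<And>c. norm (c *s v) \<le> norm c * K"
    using bounded_linear.pos_bounded[OF bounded_linear_vscale_left[of v]] by blast
  define r where "r = e / (2 * K)"
  show thesis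
  proof (rule that[of "e/2" r])
    fix z and \<zeta> :: complex assume z: "z \<in> ball z0 (e/2)" and "norm \<zeta> \<le> r"
    have "norm \<zeta> * K \<le> e / 2"
      using \<open>norm \<zeta> \<le> r\<close> K(1) mult_right_mono[of "norm \<zeta>" r K] by (simp add: r_def)
    then have n: "norm (\<zeta> *s v) \<le> e / 2" using K(2)[of \<zeta>] by linarith
    have "dist z0 (z + \<zeta> *s v) \<le> dist z0 z + norm (\<zeta> *s v)"
      using dist_triangle[of z0 "z + \<zeta> *s v" z] by (simp add: dist_norm)
    also have "\<dots> < e" using z n by simp
    finally show "z + \<zeta> *s v \<in> S" using e by auto
  qed (use e K in \<open>auto simp: r_def\<close>)
qed

text \<open>The integrand of the Cauchy formula depends continuously on \<open>z\<close>.\<close>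

lemma holo_fun_on_derivative_continuous:
  assumes f: "holo_fun_on S f" and "open S"
  shows "continuous_on S (\<lambda>z. frechet_derivative f (at z) v)"
proof -
  have "isCont (\<lambda>z. frechet_derivative f (at z) v) z0" if z0: "z0 \<in> S" for z0
  proof -
    obtain \<rho> r where r: "\<rho> > 0" "r > 0"
      and S: "\<And>z \<zeta>. z \<in> ball z0 \<rho> \<Longrightarrow> norm \<zeta> \<le> r \<Longrightarrow> z + \<zeta> *s v \<in> S"
      using uniform_circles[OF \<open>open S\<close> z0] by metis
    have cs: "continuous_on A (\<lambda>x. g x *s v)" if "continuous_on A g" for A :: "'z::topological_space set" and g
      using bounded_linear.continuous_on[OF bounded_linear_vscale_left that] .
    have "continuous_on (ball z0 \<rho>)
        (\<lambda>z. integral (cbox 0 1) (\<lambda>t. f (z + circlepath 0 r t *s v) / circlepath 0 r t))"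
      by (intro integral_continuous_on_param)
         (use r in \<open>auto simp: split_beta circlepath intro!: continuous_intros cs
            continuous_on_compose2[OF holo_fun_on_continuous[OF f]] S simp: norm_mult\<close>)
    then have "continuous_on (ball z0 \<rho>) (\<lambda>z. frechet_derivative f (at z) v)"
      by (rule continuous_on_eq) (use directional_Cauchy_formula[OF f r(2) S] in auto)
    then show ?thesis using r by (simp add: continuous_on_eq_continuous_at)
  qed
  then show ?thesis by (simp add: continuous_at_imp_continuous_on)
qed

text \<open>Since the first derivative is continuous, the Cauchy formula may be differentiated under the integral sign,
  and complex linearity of the derivative of \<open>f\<close> passes through the integral. Iterating this gives
  \<open>C\<^sup>m\<close> for every \<open>m\<close>.\<close>

lemma holo_fun_on_derivative:
  assumes f: "holo_fun_on S f" and "open S"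
  shows "holo_fun_on S (\<lambda>z. frechet_derivative f (at z) v)"
  unfolding holo_fun_on_def
proof
  fix z0 assume z0: "z0 \<in> S"
  obtain \<rho> r where r: "\<rho> > 0" "r > 0"
    and S: "\<And>z \<zeta>. z \<in> ball z0 \<rho> \<Longrightarrow> norm \<zeta> \<le> r \<Longrightarrow> z + \<zeta> *s v \<in> S"
    using uniform_circles[OF \<open>open S\<close> z0] by metis
  define \<gamma> :: "real \<Rightarrow> complex" where "\<gamma> = circlepath 0 r"
  have norm_\<gamma>: "norm (\<gamma> t) \<le> r" and \<gamma>0: "\<gamma> t \<noteq> 0" for t
    using r by (auto simp: \<gamma>_def circlepath norm_mult)
  have cont_\<gamma>: "continuous_on A \<gamma>" for A unfolding \<gamma>_def circlepath by (intro continuous_intros)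
  define fx where "fx z t = Blinfun (\<lambda>w. frechet_derivative f (at (z + \<gamma> t *s v)) w / \<gamma> t)" for z t
  have bl: "bounded_linear (\<lambda>w. frechet_derivative f (at (z + \<gamma> t *s v)) w / \<gamma> t)"
    if "z \<in> ball z0 \<rho>" for z t
    by (rule bounded_linear_compose[OF bounded_linear_divide
          has_derivative_bounded_linear[OF holo_fun_on_has_derivative(1)[OF f S[OF that norm_\<gamma>]]]])
  note fx = bounded_linear_Blinfun_apply[OF bl, folded fx_def]
  have cs: "continuous_on A (\<lambda>x. g x *s v)" if "continuous_on A g" for A :: "'z::topological_space set" and g
    using bounded_linear.continuous_on[OF bounded_linear_vscale_left that] .
  have cont_fx: "continuous_on (ball z0 \<rho> \<times> cbox 0 1) (\<lambda>(z, t). fx z t)"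
    unfolding split_beta
  proof (rule continuous_on_blinfun_componentwise)
    fix w
    have "continuous_on (ball z0 \<rho> \<times> cbox 0 (1::real))
        (\<lambda>p. frechet_derivative f (at (fst p + \<gamma> (snd p) *s v)) w / \<gamma> (snd p))"
      using S norm_\<gamma> \<gamma>0
      by (auto intro!: continuous_intros cs continuous_on_compose2[OF cont_\<gamma>[of UNIV]]
          continuous_on_compose2[OF holo_fun_on_derivative_continuous[OF f \<open>open S\<close>]])
    then show "continuous_on (ball z0 \<rho> \<times> cbox 0 (1::real)) (\<lambda>x. blinfun_apply (fx (fst x) (snd x)) w)"
      by (rule continuous_on_eq) (auto simp: fx)
  qed
  have "((\<lambda>z. integral (cbox 0 1) (\<lambda>t. f (z + \<gamma> t *s v) / \<gamma> t)) has_derivative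
      integral (cbox 0 1) (fx z0)) (at z0 within ball z0 \<rho>)"
  proof (rule leibniz_rule[OF _ _ cont_fx])
    fix z and t :: real assume z: "z \<in> ball z0 \<rho>"
    have "((\<lambda>z. z + \<gamma> t *s v) has_derivative (\<lambda>w. w)) (at z)"
      by (auto intro!: derivative_eq_intros)
    note D = has_derivative_compose[OF this holo_fun_on_has_derivative(1)[OF f S[OF z norm_\<gamma>[of t]]]]
    show "((\<lambda>z. f (z + \<gamma> t *s v) / \<gamma> t) has_derivative blinfun_apply (fx z t)) (at z within ball z0 \<rho>)"
      unfolding fx[OF z, abs_def]
      by (rule has_derivative_at_withinI[OF bounded_linear.has_derivative[OF bounded_linear_divide D]])
  next
    fix z assume z: "z \<in> ball z0 \<rho>"
    show "(\<lambda>t. f (z + \<gamma> t *s v) / \<gamma> t) integrable_on cbox 0 1"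
      using S[OF z] norm_\<gamma> \<gamma>0
      by (intro integrable_continuous)
         (auto intro!: continuous_intros cs cont_\<gamma> continuous_on_compose2[OF holo_fun_on_continuous[OF f]])
  qed (use r in auto)
  then have "((\<lambda>z. integral (cbox 0 1) (\<lambda>t. f (z + \<gamma> t *s v) / \<gamma> t)) has_derivative
      integral (cbox 0 1) (fx z0)) (at z0)"
    using r at_within_open[of z0 "ball z0 \<rho>"] by simp
  then have D: "((\<lambda>z. frechet_derivative f (at z) v) has_derivative integral (cbox 0 1) (fx z0)) (at z0)"
    by (rule has_derivative_transform_within_open[of _ _ _ _ "ball z0 \<rho>"])
       (use r directional_Cauchy_formula[OF f r(2) S] in \<open>auto simp: \<gamma>_def\<close>)
  have int: "fx z0 integrable_on cbox 0 1"
    by (intro integrable_continuous continuous_on_compose2[OF cont_fx, of _ "\<lambda>t. (z0, t)", simplified])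
       (use r in \<open>auto intro!: continuous_intros\<close>)
  have z0b: "z0 \<in> ball z0 \<rho>" using r by simp
  have "blinfun_apply (integral (cbox 0 1) (fx z0)) (c *s w) = c * blinfun_apply (integral (cbox 0 1) (fx z0)) w" for c w
    unfolding blinfun_apply_integral[OF int] fx[OF z0b]
      holo_fun_on_has_derivative(2)[OF f S[OF z0b norm_\<gamma>]]
    by (simp flip: times_divide_eq_right)
  with D show "\<exists>D. ((\<lambda>z. frechet_derivative f (at z) v) has_derivative D) (at z0) \<and> (\<forall>c v. D (c *s v) = c * D v)"
    by blast
qed

lemma holo_fun_on_ck: "holo_fun_on S f \<Longrightarrow> open S \<Longrightarrow> ck_on m S f"
proof (induction m arbitrary: f)
  case 0
  then show ?case by (simp add: holo_fun_on_continuous)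
next
  case (Suc m)
  then show ?case
    using holo_fun_on_has_derivative(1)[OF Suc.prems(1)] holo_fun_on_derivative[OF Suc.prems]
    unfolding ck_on.simps differentiable_def by blast
qed

section \<open>Wirtinger derivatives\<close>

lemma d_dz_eqI: "(f has_derivative D) (at z) \<Longrightarrow> d_dz i f z = (D (axis i 1) - \<i> * D (axis i \<i>)) / 2"
  and d_dzbar_eqI: "(f has_derivative D) (at z) \<Longrightarrow> d_dzbar i f z = (D (axis i 1) + \<i> * D (axis i \<i>)) / 2"
  by (simp_all add: d_dz_def d_dzbar_def frechet_derivative_eqI)

lemma wirtinger_cong:
  assumes "open S" "z \<in> S" "\<And>y. y \<in> S \<Longrightarrow> f y = g y"
  shows "d_dz i f z = d_dz i g z" "d_dzbar i f z = d_dzbar i g z"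
  using frechet_derivative_cong_open(1)[OF assms] by (simp_all add: d_dz_def d_dzbar_def)

lemma ck_wirtinger:
  assumes "ck_on (Suc m) S f" "open S"
  shows "ck_on m S (d_dz i f)" "ck_on m S (d_dzbar i f)"
proof -
  have *: "ck_on m S (\<lambda>z. frechet_derivative f (at z) v)" for v using assms by auto
  have "ck_on m S (\<lambda>z. (1/2) * (frechet_derivative f (at z) (axis i 1) - \<i> * frechet_derivative f (at z) (axis i \<i>)))"
    by (intro ck_cmult ck_diff * assms)
  then show "ck_on m S (d_dz i f)" by (simp add: d_dz_def [abs_def])
  have "ck_on m S (\<lambda>z. (1/2) * (frechet_derivative f (at z) (axis i 1) + \<i> * frechet_derivative f (at z) (axis i \<i>)))"
    by (intro ck_cmult ck_add * assms)
  then show "ck_on m S (d_dzbar i f)" by (simp add: d_dzbar_def [abs_def])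
qed

lemma wirtinger_const: "d_dz i (\<lambda>_. c) z = 0" "d_dzbar i (\<lambda>_. c) z = 0"
  by (simp_all add: d_dz_def d_dzbar_def)

lemma wirtinger_add:
  assumes "f differentiable (at z)" "g differentiable (at z)"
  shows "d_dz i (\<lambda>w. f w + g w) z = d_dz i f z + d_dz i g z"
    and "d_dzbar i (\<lambda>w. f w + g w) z = d_dzbar i f z + d_dzbar i g z"
  unfolding d_dz_eqI[OF has_derivative_add[OF assms[unfolded frechet_derivative_works]]]
    d_dzbar_eqI[OF has_derivative_add[OF assms[unfolded frechet_derivative_works]]]
  by (simp_all add: d_dz_def d_dzbar_def field_simps)

lemma wirtinger_diff:
  assumes "f differentiable (at z)" "g differentiable (at z)"
  shows "d_dz i (\<lambda>w. f w - g w) z = d_dz i f z - d_dz i g z"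
    and "d_dzbar i (\<lambda>w. f w - g w) z = d_dzbar i f z - d_dzbar i g z"
  unfolding d_dz_eqI[OF has_derivative_diff[OF assms[unfolded frechet_derivative_works]]]
    d_dzbar_eqI[OF has_derivative_diff[OF assms[unfolded frechet_derivative_works]]]
  by (simp_all add: d_dz_def d_dzbar_def field_simps)

lemma wirtinger_sum:
  assumes "\<And>j. j \<in> I \<Longrightarrow> f j differentiable (at z)"
  shows "d_dz i (\<lambda>w. \<Sum>j\<in>I. f j w) z = (\<Sum>j\<in>I. d_dz i (f j) z)"
    and "d_dzbar i (\<lambda>w. \<Sum>j\<in>I. f j w) z = (\<Sum>j\<in>I. d_dzbar i (f j) z)"
  using assms
  by (induction I rule: infinite_finite_induct)
     (auto simp: wirtinger_const wirtinger_add differentiable_sum)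

lemma wirtinger_mult:
  assumes "f differentiable (at z)" "g differentiable (at z)"
  shows "d_dz i (\<lambda>w. f w * g w) z = d_dz i f z * g z + f z * d_dz i g z"
    and "d_dzbar i (\<lambda>w. f w * g w) z = d_dzbar i f z * g z + f z * d_dzbar i g z"
  unfolding d_dz_eqI[OF has_derivative_mult[OF assms[unfolded frechet_derivative_works]]]
    d_dzbar_eqI[OF has_derivative_mult[OF assms[unfolded frechet_derivative_works]]]
  by (simp_all add: d_dz_def d_dzbar_def field_simps)

lemma wirtinger_cnj:
  assumes "f differentiable (at z)"
  shows "d_dz i (\<lambda>w. cnj (f w)) z = cnj (d_dzbar i f z)"
    and "d_dzbar i (\<lambda>w. cnj (f w)) z = cnj (d_dz i f z)"
proof -
  have "((\<lambda>w. cnj (f w)) has_derivative (\<lambda>v. cnj (frechet_derivative f (at z) v))) (at z)"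
    using has_derivative_cnj assms frechet_derivative_works by blast
  from d_dz_eqI[OF this] d_dzbar_eqI[OF this]
  show "d_dz i (\<lambda>w. cnj (f w)) z = cnj (d_dzbar i f z)"
    and "d_dzbar i (\<lambda>w. cnj (f w)) z = cnj (d_dz i f z)"
    by (simp_all add: d_dz_def d_dzbar_def)
qed

lemma vec_expand_real: "y = (\<Sum>k\<in>UNIV. Re (y $ k) *\<^sub>R axis k 1 + Im (y $ k) *\<^sub>R axis k \<i>)"
  for y :: "complex^'n"
proof -
  have "(\<Sum>k\<in>UNIV. Re (y $ k) *\<^sub>R axis k 1 + Im (y $ k) *\<^sub>R axis k \<i>) $ j = 
      (\<Sum>k\<in>UNIV. if k = j then y $ j else 0)" for j
    unfolding sum_component
    by (intro sum.cong) (auto simp: axis_def complex_eq_iff)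
  then show ?thesis by (simp add: vec_eq_iff)
qed

text \<open>Together with the complex linearity of the derivative of a holomorphic map, this expansion turns the real chain
  rule into the two Wirtinger chain rules.\<close>

lemma derivative_wirtinger:
  assumes "f differentiable (at z)"
  shows "frechet_derivative f (at z) y = (\<Sum>k\<in>UNIV. d_dz k f z * y $ k + d_dzbar k f z * cnj (y $ k))"
proof -
  have lin: "linear (frechet_derivative f (at z))" using assms by (rule linear_frechet_derivative)
  have "frechet_derivative f (at z) y =
      (\<Sum>k\<in>UNIV. Re (y $ k) *\<^sub>R frechet_derivative f (at z) (axis k 1) + Im (y $ k) *\<^sub>R frechet_derivative f (at z) (axis k \<i>))"
    by (subst vec_expand_real) (simp only: linear_sum[OF lin] linear_add[OF lin] linear_scale[OF lin])
  also have "\<dots> = (\<Sum>k\<in>UNIV. d_dz k f z * y $ k + d_dzbar k f z * cnj (y $ k))"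
  proof (intro sum.cong refl)
    fix k
    have "a *\<^sub>R p + b *\<^sub>R q = (p - \<i> * q) / 2 * Complex a b + (p + \<i> * q) / 2 * cnj (Complex a b)" for a b p q
      by (simp add: complex_eq_iff field_simps)
    from this[of "Re (y $ k)" _ "Im (y $ k)"]
    show "Re (y $ k) *\<^sub>R frechet_derivative f (at z) (axis k 1) + Im (y $ k) *\<^sub>R frechet_derivative f (at z) (axis k \<i>)
      = d_dz k f z * y $ k + d_dzbar k f z * cnj (y $ k)"
      by (simp add: d_dz_def d_dzbar_def)
  qed
  finally show ?thesis .
qed

lemma axis_i: "axis i \<i> = \<i> *s (axis i 1 :: complex^'n)"
  by (simp add: vec_eq_iff axis_def)

lemma holo_fun_on_d_dzbar:
  assumes "holo_fun_on S f" "z \<in> S"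
  shows "d_dzbar i f z = 0" "d_dz i f z = frechet_derivative f (at z) (axis i 1)"
  using holo_fun_on_has_derivative(2)[OF assms, of \<i> "axis i 1"]
  by (simp_all add: d_dzbar_def d_dz_def axis_i algebra_simps flip: mult.assoc)

lemma holomorphic_map_on_nth:
  assumes "holomorphic_map_on S \<phi>"
  shows "holo_fun_on S (\<lambda>z. \<phi> z $ k)"
  unfolding holo_fun_on_def
proof
  fix z assume "z \<in> S"
  then obtain D where D: "(\<phi> has_derivative D) (at z)" "\<And>c v. D (c *s v) = c *s D v"
    using assms by (auto simp: holomorphic_map_on_def)
  show "\<exists>D. ((\<lambda>z. \<phi> z $ k) has_derivative D) (at z) \<and> (\<forall>c v. D (c *s v) = c * D v)"
    using bounded_linear.has_derivative[OF bounded_linear_vec_nth D(1)] D(2)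
    by (intro exI[of _ "\<lambda>v. D v $ k"]) auto
qed

lemma holomorphic_map_on_has_derivative:
  assumes "holomorphic_map_on S \<phi>" "z \<in> S"
  shows "(\<phi> has_derivative frechet_derivative \<phi> (at z)) (at z)"
    and "frechet_derivative \<phi> (at z) (c *s v) = c *s frechet_derivative \<phi> (at z) v"
proof -
  obtain D where D: "(\<phi> has_derivative D) (at z)" "\<And>c v. D (c *s v) = c *s D v"
    using assms by (auto simp: holomorphic_map_on_def)
  moreover have "D = frechet_derivative \<phi> (at z)" using D(1) frechet_derivative_at by blast
  ultimately show "(\<phi> has_derivative frechet_derivative \<phi> (at z)) (at z)"
    "frechet_derivative \<phi> (at z) (c *s v) = c *s frechet_derivative \<phi> (at z) v" by auto
qed

lemma holomorphic_map_on_ck: "holomorphic_map_on S \<phi> \<Longrightarrow> open S \<Longrightarrow> ck_on m S \<phi>"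
  by (intro ck_vec holo_fun_on_ck holomorphic_map_on_nth)

definition hol_jacobian :: "(complex^'n \<Rightarrow> complex^'n) \<Rightarrow> complex^'n \<Rightarrow> complex^'n^'n" where
  "hol_jacobian \<phi> z = (\<chi> k i. frechet_derivative \<phi> (at z) (axis i 1) $ k)"

lemma holomorphic_map_on_jacobian:
  assumes "holomorphic_map_on S \<phi>" "z \<in> S"
  shows "frechet_derivative \<phi> (at z) v = hol_jacobian \<phi> z *v v"
proof -
  note D = holomorphic_map_on_has_derivative[OF assms]
  have "frechet_derivative \<phi> (at z) v = frechet_derivative \<phi> (at z) (\<Sum>i\<in>UNIV. v $ i *s axis i 1)"
    by (simp add: basis_expansion)
  also have "\<dots> = (\<Sum>i\<in>UNIV. v $ i *s frechet_derivative \<phi> (at z) (axis i 1))"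
    by (simp add: linear_sum[OF has_derivative_linear[OF D(1)]] D(2))
  also have "\<dots> = hol_jacobian \<phi> z *v v"
    by (simp add: vec_eq_iff hol_jacobian_def matrix_vector_mult_def mult.commute)
  finally show ?thesis .
qed

lemma jacobian_holo:
  assumes "holomorphic_map_on S \<phi>" "open S"
  shows "holo_fun_on S (\<lambda>z. hol_jacobian \<phi> z $ k $ i)"
proof -
  have eq: "frechet_derivative (\<lambda>z. \<phi> z $ k) (at z) (axis i 1) = hol_jacobian \<phi> z $ k $ i" if "z \<in> S" for z
    using frechet_derivative_eqI[OF bounded_linear.has_derivative[OF bounded_linear_vec_nth[of k]
          holomorphic_map_on_has_derivative(1)[OF assms(1) that]]]
    by (simp add: hol_jacobian_def)
  have h: "holo_fun_on S (\<lambda>z. frechet_derivative (\<lambda>z. \<phi> z $ k) (at z) (axis i 1))"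
    by (intro holo_fun_on_derivative holomorphic_map_on_nth assms)
  show ?thesis
    unfolding holo_fun_on_def
  proof
    fix z assume z: "z \<in> S"
    then obtain D where D: "((\<lambda>z. frechet_derivative (\<lambda>z. \<phi> z $ k) (at z) (axis i 1)) has_derivative D) (at z)"
      "\<And>c v. D (c *s v) = c * D v"
      using h by (auto simp: holo_fun_on_def)
    show "\<exists>D. ((\<lambda>z. hol_jacobian \<phi> z $ k $ i) has_derivative D) (at z) \<and> (\<forall>c v. D (c *s v) = c * D v)"
      using has_derivative_transform_within_open[OF D(1) \<open>open S\<close> z eq] D(2) by blast
  qed
qed

lemma wirtinger_compose:
  assumes \<phi>: "holomorphic_map_on S \<phi>" "z \<in> S" and f: "f differentiable (at (\<phi> z))"
  shows "d_dz i (\<lambda>z. f (\<phi> z)) z = (\<Sum>k\<in>UNIV. d_dz k f (\<phi> z) * hol_jacobian \<phi> z $ k $ i)"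
    and "d_dzbar i (\<lambda>z. f (\<phi> z)) z = (\<Sum>k\<in>UNIV. d_dzbar k f (\<phi> z) * cnj (hol_jacobian \<phi> z $ k $ i))"
proof -
  have D: "((\<lambda>z. f (\<phi> z)) has_derivative
      (\<lambda>v. frechet_derivative f (at (\<phi> z)) (frechet_derivative \<phi> (at z) v))) (at z)"
    using has_derivative_compose[OF holomorphic_map_on_has_derivative(1)[OF \<phi>]] f
    by (simp add: frechet_derivative_works)
  have J: "frechet_derivative \<phi> (at z) (axis i 1) $ k = hol_jacobian \<phi> z $ k $ i"
    "frechet_derivative \<phi> (at z) (axis i \<i>) $ k = \<i> * hol_jacobian \<phi> z $ k $ i" for k
    using holomorphic_map_on_has_derivative(2)[OF \<phi>, of \<i>] by (simp_all add: hol_jacobian_def axis_i)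
  show "d_dz i (\<lambda>z. f (\<phi> z)) z = (\<Sum>k\<in>UNIV. d_dz k f (\<phi> z) * hol_jacobian \<phi> z $ k $ i)"
    unfolding d_dz_eqI[OF D] derivative_wirtinger[OF f] J
    unfolding sum_distrib_left sum_subtractf[symmetric] sum_divide_distrib
    by (intro sum.cong refl) (simp add: complex_eq_iff algebra_simps)
  show "d_dzbar i (\<lambda>z. f (\<phi> z)) z = (\<Sum>k\<in>UNIV. d_dzbar k f (\<phi> z) * cnj (hol_jacobian \<phi> z $ k $ i))"
    unfolding d_dzbar_eqI[OF D] derivative_wirtinger[OF f] J
    unfolding sum_distrib_left sum.distrib[symmetric] sum_divide_distrib
    by (intro sum.cong refl) (simp add: complex_eq_iff algebra_simps)
qed

text \<open>For a mixed second derivative of a pulled back function the second derivatives of the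
  holomorphic map do not enter, because the entries of its Jacobian are holomorphic again and thus killed by \<open>d_dzbar j\<close>.\<close>

lemma mixed_derivative_compose:
  assumes \<phi>: "holomorphic_map_on S \<phi>" "open S" "z \<in> S"
    and u: "ck_on 2 T u" "open T" "\<phi> ` S \<subseteq> T"
  shows "d_dzbar j (d_dz i (\<lambda>z. u (\<phi> z))) z =
    (\<Sum>k\<in>UNIV. \<Sum>l\<in>UNIV. d_dzbar l (d_dz k u) (\<phi> z) * hol_jacobian \<phi> z $ k $ i * cnj (hol_jacobian \<phi> z $ l $ j))"
proof -
  have u2: "ck_on (Suc (Suc 0)) T u" using u(1) by (simp add: numeral_2_eq_2)
  have du: "u differentiable (at w)" if "w \<in> T" for w
    using ck_differentiable[OF u(1) _ that] by simp
  have ddu: "d_dz k u differentiable (at w)" if "w \<in> T" for w k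
    using ck_differentiable[OF ck_wirtinger(1)[OF u2 u(2)] _ that] by simp
  have \<phi>z: "\<phi> z \<in> T" using \<phi>(3) u(3) by auto
  have dJ: "(\<lambda>z. hol_jacobian \<phi> z $ k $ i) differentiable (at z)" for k
    using holo_fun_on_has_derivative(1)[OF jacobian_holo[OF \<phi>(1,2)] \<phi>(3)] by (auto simp: differentiable_def)
  have dc: "(\<lambda>z. d_dz k u (\<phi> z)) differentiable (at z)" for k
    using differentiable_chain_at[of \<phi> z "d_dz k u"] ddu[OF \<phi>z, of k] holomorphic_map_on_has_derivative(1)[OF \<phi>(1,3)]
    unfolding o_def by (metis differentiable_def)
  have "d_dzbar j (d_dz i (\<lambda>z. u (\<phi> z))) z =
      d_dzbar j (\<lambda>z. \<Sum>k\<in>UNIV. d_dz k u (\<phi> z) * hol_jacobian \<phi> z $ k $ i) z"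
    by (rule wirtinger_cong(2)[OF \<phi>(2,3)]) (use wirtinger_compose(1)[OF \<phi>(1)] du u(3) in auto)
  also have "\<dots> = (\<Sum>k\<in>UNIV. d_dzbar j (\<lambda>z. d_dz k u (\<phi> z) * hol_jacobian \<phi> z $ k $ i) z)"
    by (rule wirtinger_sum) (intro differentiable_mult dJ dc)
  also have "\<dots> = (\<Sum>k\<in>UNIV. d_dzbar j (\<lambda>z. d_dz k u (\<phi> z)) z * hol_jacobian \<phi> z $ k $ i)"
    by (simp add: wirtinger_mult[OF dc dJ] holo_fun_on_d_dzbar[OF jacobian_holo[OF \<phi>(1,2)] \<phi>(3)])
  also have "\<dots> = (\<Sum>k\<in>UNIV. \<Sum>l\<in>UNIV. d_dzbar l (d_dz k u) (\<phi> z) * hol_jacobian \<phi> z $ k $ i * cnj (hol_jacobian \<phi> z $ l $ j))"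
    by (simp add: wirtinger_compose(2)[OF \<phi>(1,3) ddu[OF \<phi>z]] sum_distrib_left sum_distrib_right mult_ac)
  finally show ?thesis .
qed

section \<open>Alternating sums\<close>

definition alternation :: "nat \<Rightarrow> ((nat \<Rightarrow> 'v) \<Rightarrow> complex) \<Rightarrow> (nat \<Rightarrow> 'v) \<Rightarrow> complex" where
  "alternation N H v = (\<Sum>\<sigma> | \<sigma> permutes {..<N}. of_int (sign \<sigma>) * H (\<lambda>i. v (\<sigma> i)))"

lemma sign_compose_permutes:
  "p permutes S \<Longrightarrow> q permutes S \<Longrightarrow> finite S \<Longrightarrow> sign (p \<circ> q) = sign p * sign q"
  by (intro sign_compose permutes_imp_permutation)

text \<open>Reindex the sum over all permutations by right multiplication with \<open>\<pi>\<close>.\<close>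

lemma alternation_permute:
  assumes \<pi>: "\<pi> permutes {..<N}"
  shows "alternation N (\<lambda>u. H (\<lambda>i. u (\<pi> i))) v = of_int (sign \<pi>) * alternation N H v"
proof -
  have "of_int (sign \<pi>) * alternation N H v =
      of_int (sign \<pi>) * (\<Sum>\<sigma> | \<sigma> permutes {..<N}. of_int (sign (\<sigma> \<circ> \<pi>)) * H (\<lambda>i. v ((\<sigma> \<circ> \<pi>) i)))"
    unfolding alternation_def
    by (subst sum_permutations_compose_right[OF \<pi>]) (rule refl)
  also have "\<dots> = (\<Sum>\<sigma> | \<sigma> permutes {..<N}. of_int (sign \<sigma>) * H (\<lambda>i. v (\<sigma> (\<pi> i))))"
    unfolding sum_distrib_left
  proof (intro sum.cong refl)
    fix \<sigma> assume "\<sigma> \<in> {\<sigma>. \<sigma> permutes {..<N}}"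
    then have "sign (\<sigma> \<circ> \<pi>) = sign \<sigma> * sign \<pi>" using sign_compose_permutes[OF _ \<pi>] by auto
    moreover have "sign \<pi> = 1 \<or> sign \<pi> = -1" by (simp add: sign_def)
    ultimately show "of_int (sign \<pi>) * (of_int (sign (\<sigma> \<circ> \<pi>)) * H (\<lambda>i. v ((\<sigma> \<circ> \<pi>) i)))
      = of_int (sign \<sigma>) * H (\<lambda>i. v (\<sigma> (\<pi> i)))" by auto
  qed
  finally show ?thesis by (simp add: alternation_def)
qed

lemma alternation_transpose:
  assumes "a < N" "b < N" "a \<noteq> b"
  shows "alternation N (\<lambda>u. H (\<lambda>i. u (Transposition.transpose a b i))) v = - alternation N H v"
  using alternation_permute[OF permutes_swap_id[of a "{..<N}" b], of H v] assms
  by (simp add: sign_swap_id)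

lemma alternation_cong: "(\<And>u. H u = K u) \<Longrightarrow> alternation N H v = alternation N K v"
  by (simp add: alternation_def)

lemma alternation_add: "alternation N (\<lambda>u. H u + K u) v = alternation N H v + alternation N K v"
  by (simp add: alternation_def sum.distrib algebra_simps)

lemma alternation_diff: "alternation N (\<lambda>u. H u - K u) v = alternation N H v - alternation N K v"
  by (simp add: alternation_def sum_subtractf algebra_simps)

lemma alternation_cmult: "alternation N (\<lambda>u. c * H u) v = c * alternation N H v"
  by (simp add: alternation_def sum_distrib_left algebra_simps)

lemma alternation_sum: "alternation N (\<lambda>u. \<Sum>i\<in>I. H i u) v = (\<Sum>i\<in>I. alternation N (H i) v)"
  unfolding alternation_def by (subst sum.swap) (simp add: sum_distrib_left)

text \<open>A transposition of the arguments changes the sign of an alternation, so both halves of an antisymmetric factor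
  contribute equally.\<close>

lemma alternation_half:
  assumes "\<And>u. H u = K u - K (\<lambda>i. u (Transposition.transpose a b i))" "a < N" "b < N" "a \<noteq> b"
  shows "alternation N H v = 2 * alternation N K v"
proof -
  have "alternation N H v = alternation N (\<lambda>u. K u - K (\<lambda>i. u (Transposition.transpose a b i))) v"
    by (rule alternation_cong) (rule assms(1))
  then show ?thesis
    unfolding alternation_diff alternation_transpose[OF assms(2-4)] by simp
qed

text \<open>One pair of arguments is treated at a time, so that a product of \<open>r + 1\<close> antisymmetric factors contributes
  \<open>2\<^sup>r\<^sup>+\<^sup>1\<close>.\<close>

lemma alternation_halves:
  fixes f f0 :: "'v \<Rightarrow> 'v \<Rightarrow> 'v \<Rightarrow> complex" and w k :: "'v \<Rightarrow> 'v \<Rightarrow> complex"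
  assumes f: "\<And>x y z. f x y z = f0 x y z - f0 x z y" and w: "\<And>x y. w x y = k x y - k y x"
  shows "alternation (2*r+3) (\<lambda>u. f (u 0) (u 1) (u 2) * (\<Prod>t<r. w (u (2*t+3)) (u (2*t+4)))) v
    = 2^(r+1) * alternation (2*r+3) (\<lambda>u. f0 (u 0) (u 1) (u 2) * (\<Prod>t<r. k (u (2*t+3)) (u (2*t+4)))) v"
proof -
  define H where "H s u = f0 (u 0) (u 1) (u 2) *
     (\<Prod>t<r. if t < s then k (u (2*t+3)) (u (2*t+4)) else w (u (2*t+3)) (u (2*t+4)))" for s and u :: "nat \<Rightarrow> 'v"
  have first: "alternation (2*r+3) (\<lambda>u. f (u 0) (u 1) (u 2) * (\<Prod>t<r. w (u (2*t+3)) (u (2*t+4)))) v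
      = 2 * alternation (2*r+3) (H 0) v"
    by (rule alternation_half[of _ _ 1 2]) (auto simp: H_def f algebra_simps Transposition.transpose_def)
  have step: "alternation (2*r+3) (H s) v = 2 * alternation (2*r+3) (H (Suc s)) v" if s: "s < r" for s
  proof (rule alternation_half[of _ _ "2 * s+3" "2 * s+4"])
    fix u :: "nat \<Rightarrow> 'v"
    define R where "R u' = f0 (u' 0) (u' 1) (u' 2) * (\<Prod>t\<in>{..<r}-{s}.
        if t < s then k (u' (2*t+3)) (u' (2*t+4)) else w (u' (2*t+3)) (u' (2*t+4)))" for u' :: "nat \<Rightarrow> 'v"
    have 1: "H s u' = R u' * w (u' (2 * s+3)) (u' (2 * s+4))" for u'
      unfolding H_def R_def using s by (subst prod.remove[of _ s]) auto
    have 2: "H (Suc s) u' = R u' * k (u' (2 * s+3)) (u' (2 * s+4))" for u'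
    proof -
      have "(\<Prod>t\<in>{..<r}-{s}. if t < Suc s then k (u' (2*t+3)) (u' (2*t+4)) else w (u' (2*t+3)) (u' (2*t+4)))
         = (\<Prod>t\<in>{..<r}-{s}. if t < s then k (u' (2*t+3)) (u' (2*t+4)) else w (u' (2*t+3)) (u' (2*t+4)))"
        by (intro prod.cong) auto
      then show ?thesis
        unfolding H_def R_def using s by (subst prod.remove[of _ s]) auto
    qed
    let ?u = "\<lambda>i. u (Transposition.transpose (2 * s+3) (2 * s+4) i)"
    have t1: "Transposition.transpose (2 * s+3) (2 * s+4) (2*t+3) = 2*t+3" "Transposition.transpose (2 * s+3) (2 * s+4) (2*t+4) = 2*t+4" if "t \<noteq> s" for t
      using that by (auto simp: Transposition.transpose_def)
    have 3: "R ?u = R u"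
    proof -
      have "(\<Prod>t\<in>{..<r}-{s}. if t < s then k (?u (2*t+3)) (?u (2*t+4)) else w (?u (2*t+3)) (?u (2*t+4))) =
        (\<Prod>t\<in>{..<r}-{s}. if t < s then k (u (2*t+3)) (u (2*t+4)) else w (u (2*t+3)) (u (2*t+4)))"
        by (intro prod.cong refl) (auto simp: t1)
      moreover have "Transposition.transpose (2 * s+3) (2 * s+4) i = i" if "i < 3" for i
        using that by (auto simp: Transposition.transpose_def)
      ultimately show ?thesis by (simp add: R_def)
    qed
    show "H s u = H (Suc s) u - H (Suc s) ?u"
      unfolding 1 2 3 by (simp add: w algebra_simps)
  qed (use s in auto)
  have "alternation (2*r+3) (H 0) v = 2 ^ s * alternation (2*r+3) (H s) v" if "s \<le> r" for s
    using that by (induction s) (auto simp: step)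
  from this[of r] have "alternation (2*r+3) (H 0) v = 2 ^ r * alternation (2*r+3) (H r) v" by simp
  moreover have "H r = (\<lambda>u. f0 (u 0) (u 1) (u 2) * (\<Prod>t<r. k (u (2*t+3)) (u (2*t+4))))"
    by (auto simp: H_def fun_eq_iff)
  ultimately show ?thesis using first by simp
qed

section \<open>Products of covectors\<close>

text \<open>Up to normalisation this is the exterior product of the covectors; as a function of the entries \<open>f s (v t)\<close> it is a
  determinant, hence zero when a covector is repeated.\<close>

definition covector_wedge :: "nat \<Rightarrow> (nat \<Rightarrow> 'v \<Rightarrow> complex) \<Rightarrow> (nat \<Rightarrow> 'v) \<Rightarrow> complex" where
  "covector_wedge N f = alternation N (\<lambda>u. \<Prod>s<N. f s (u s))"

lemma covector_wedge_cong: "(\<And>s. s < N \<Longrightarrow> f s = g s) \<Longrightarrow> covector_wedge N f = covector_wedge N g"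
  unfolding covector_wedge_def by (metis (mono_tags, lifting) lessThan_iff prod.cong)

lemma covector_wedge_transpose:
  assumes "a < N" "b < N" "a \<noteq> b"
  shows "covector_wedge N (\<lambda>s. f (Transposition.transpose a b s)) v = - covector_wedge N f v"
proof -
  have "covector_wedge N (\<lambda>s. f (Transposition.transpose a b s)) v =
      alternation N (\<lambda>u. \<Prod>s<N. f s (u (Transposition.transpose a b s))) v"
    unfolding covector_wedge_def
  proof (rule alternation_cong)
    fix u :: "nat \<Rightarrow> 'a"
    have "bij_betw (Transposition.transpose a b) {..<N} {..<N}"
      using permutes_imp_bij permutes_swap_id[of a "{..<N}" b] assms by blast
    from prod.reindex_bij_betw[OF this, of "\<lambda>s. f s (u (Transposition.transpose a b s))"]
    show "(\<Prod>s<N. f (Transposition.transpose a b s) (u s)) = (\<Prod>s<N. f s (u (Transposition.transpose a b s)))" by simp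
  qed
  also have "\<dots> = - covector_wedge N f v"
    unfolding covector_wedge_def using alternation_transpose[OF assms, of "\<lambda>u. \<Prod>s<N. f s (u s)"] by simp
  finally show ?thesis .
qed

lemma covector_wedge_repeated:
  assumes "a < N" "b < N" "a \<noteq> b" "f a = f b"
  shows "covector_wedge N f v = 0"
proof -
  have "f (Transposition.transpose a b s) = f s" for s using assms(4) by (auto simp: Transposition.transpose_def)
  then show ?thesis using covector_wedge_transpose[OF assms(1-3), of f v] by simp
qed

text \<open>The covector of position \<open>s\<close> in \<open>a\<^sub>k \<and> a\<^sub>i \<and> b\<^sub>p \<and> a\<^sub>L\<^sub>0 \<and> b\<^sub>L\<^sub>0 \<and> a\<^sub>L\<^sub>1 \<and> b\<^sub>L\<^sub>1 \<and> \<dots>\<close>.\<close>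

definition torsion_word :: "('n \<Rightarrow> 'v \<Rightarrow> complex) \<Rightarrow> ('n \<Rightarrow> 'v \<Rightarrow> complex) \<Rightarrow> 'n \<Rightarrow> 'n \<Rightarrow> 'n \<Rightarrow> (nat \<Rightarrow> 'n)
    \<Rightarrow> nat \<Rightarrow> 'v \<Rightarrow> complex" where
  "torsion_word a b k i p L s =
     (if s = 0 then a k else if s = 1 then a i else if s = 2 then b p
      else if odd s then a (L ((s - 3) div 2)) else b (L ((s - 3) div 2)))"

lemma torsion_word_simps:
  "torsion_word a b k i p L 0 = a k" "torsion_word a b k i p L (Suc 0) = a i"
  "torsion_word a b k i p L 2 = b p"
  "torsion_word a b k i p L (2*t+3) = a (L t)" "torsion_word a b k i p L (2*t+4) = b (L t)"
  by (auto simp: torsion_word_def)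

lemma prod_torsion_word:
  "(\<Prod>s<2*r+3. g s) = g 0 * g 1 * g 2 * (\<Prod>t<r. g (2*t+3) * g (2*t+4))" for g :: "nat \<Rightarrow> complex"
proof (induction r)
  case 0
  have "{..<2*0+3} = {0, 1, 2::nat}" by auto
  then show ?case by simp
next
  case (Suc r)
  have "2 * Suc r + 3 = Suc (Suc (2*r+3))" "2*r+4 = Suc (2*r+3)" by simp_all
  then have "(\<Prod>s<2 * Suc r + 3. g s) = (\<Prod>s<2*r+3. g s) * g (2*r+3) * g (2*r+4)"
    by (simp only: prod.lessThan_Suc)
  then show ?case using Suc by (simp add: mult_ac)
qed

lemma torsion_word_alternation:
  "covector_wedge (2*r+3) (torsion_word a b k i p L) =
    alternation (2*r+3) (\<lambda>u. a k (u 0) * a i (u 1) * b p (u 2) * (\<Prod>t<r. a (L t) (u (2*t+3)) * b (L t) (u (2*t+4))))"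
  unfolding covector_wedge_def prod_torsion_word by (simp add: torsion_word_simps)

lemma torsion_word_nonzero:
  assumes "covector_wedge (2*r+3) (torsion_word a b k i p L) v \<noteq> 0"
  shows "k \<noteq> i" "inj_on L {..<r}" "k \<notin> L ` {..<r}" "i \<notin> L ` {..<r}" "p \<notin> L ` {..<r}"
proof -
  let ?f = "torsion_word a b k i p L"
  have *: "?f s \<noteq> ?f s'" if "s < 2*r+3" "s' < 2*r+3" "s \<noteq> s'" for s s'
    using covector_wedge_repeated[OF that] assms by metis
  have last: "b p \<noteq> b (L t)" if "t < r" for t
    using *[of 2 "2*t+4"] that by (auto simp: torsion_word_simps)
  show "k \<noteq> i" using *[of 0 1] by (auto simp: torsion_word_simps)
  show "inj_on L {..<r}"
  proof (rule inj_onI, rule ccontr)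
    fix t t' assume "t \<in> {..<r}" "t' \<in> {..<r}" "L t = L t'" "t \<noteq> t'"
    then show False using *[of "2*t+3" "2*t'+3"] by (auto simp: torsion_word_simps)
  qed
  show "k \<notin> L ` {..<r}" "i \<notin> L ` {..<r}" "p \<notin> L ` {..<r}"
    using *[of 0 "2*t+3" for t] *[of 1 "2*t+3" for t] last
    by (auto simp: torsion_word_simps)
qed

text \<open>When the word \<open>k, i, L\<close> runs through all indices, exchanging \<open>i\<close> with another letter \<open>L t\<close>
  moves the pair \<open>a\<^sub>i \<and> b\<^sub>i\<close> past the pair \<open>a\<^sub>L\<^sub>t \<and> b\<^sub>L\<^sub>t\<close>, which costs no sign.\<close>

lemma torsion_word_exchange:
  assumes "t < r" "inj_on L {..<r}" "i \<notin> L ` {..<r}" "L t = j"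
  shows "covector_wedge (2*r+3) (torsion_word a b k j j (\<lambda>s. Transposition.transpose i j (L s))) v =
    covector_wedge (2*r+3) (torsion_word a b k i i L) v"
proof -
  let ?f = "torsion_word a b k i i L" and ?g = "torsion_word a b k j j (\<lambda>s. Transposition.transpose i j (L s))"
  have other: "Transposition.transpose i j (L s) = L s" if "s < r" "s \<noteq> t" for s
    using assms that by (auto simp: Transposition.transpose_def inj_on_def)
  have eq: "?g s = ?f (Transposition.transpose 1 (2*t+3) (Transposition.transpose 2 (2*t+4) s))" if "s < 2*r+3" for s
  proof -
    consider "s = 0" | "s = 1" | "s = 2" | q where "s = 2*q+3" "q < r" | q where "s = 2*q+4" "q < r"
    proof -
      have "s = 0 \<or> s = 1 \<or> s = 2 \<or> (\<exists>q. s = 2*q+3 \<and> q < r) \<or> (\<exists>q. s = 2*q+4 \<and> q < r)"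
        using \<open>s < 2*r+3\<close> by presburger
      then show thesis using that by blast
    qed
    then show ?thesis
    proof cases
      case (4 q)
      have "2*q+3 \<noteq> 2*t+4" by presburger
      then show ?thesis using 4 other[of q] assms
        by (cases "q = t") (auto simp: torsion_word_simps Transposition.transpose_def[of _ _ "_::nat"])
    next
      case (5 q)
      have "2*q+4 \<noteq> 2*t+3" "2*t+3 \<noteq> 2*q+4" by presburger+
      then show ?thesis using 5 other[of q] assms
        by (cases "q = t") (auto simp: torsion_word_simps Transposition.transpose_def[of _ _ "_::nat"])
    qed (use assms in \<open>auto simp: torsion_word_simps Transposition.transpose_def\<close>)
  qed
  have "covector_wedge (2*r+3) ?g v =
      covector_wedge (2*r+3) (\<lambda>s. ?f (Transposition.transpose 1 (2*t+3) (Transposition.transpose 2 (2*t+4) s))) v"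
    using covector_wedge_cong[OF eq] by simp
  also have "\<dots> = - covector_wedge (2*r+3) (\<lambda>s. ?f (Transposition.transpose 1 (2*t+3) s)) v"
    by (rule covector_wedge_transpose[of 2 _ "2*t+4" "\<lambda>s. ?f (Transposition.transpose 1 (2*t+3) s)"]) (use assms in auto)
  also have "\<dots> = covector_wedge (2*r+3) ?f v"
    using covector_wedge_transpose[of 1 "2*r+3" "2*t+3" ?f] assms by simp
  finally show ?thesis .
qed


text \<open>This is \<open>a\<^sub>k \<and> a\<^sub>i \<and> b\<^sub>p \<and> \<Theta>\<^sup>r\<close> for \<open>\<Theta> = \<Sum>\<^sub>l a\<^sub>l \<and> b\<^sub>l\<close>, up to normalisation.\<close>

definition torsion_sum :: "nat \<Rightarrow> ('n::finite \<Rightarrow> 'v \<Rightarrow> complex) \<Rightarrow> ('n \<Rightarrow> 'v \<Rightarrow> complex) \<Rightarrow> (nat \<Rightarrow> 'v)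
    \<Rightarrow> 'n \<Rightarrow> 'n \<Rightarrow> 'n \<Rightarrow> complex" where
  "torsion_sum r a b v k i p =
     (\<Sum>L\<in>{..<r} \<rightarrow>\<^sub>E UNIV. covector_wedge (2*r+3) (torsion_word a b k i p L) v)"

lemma torsion_sum_antisym: "torsion_sum r a b v k i p = - torsion_sum r a b v i k p"
proof -
  have "covector_wedge (2*r+3) (torsion_word a b k i p L) v = - covector_wedge (2*r+3) (torsion_word a b i k p L) v" for L
  proof -
    have "torsion_word a b k i p L = (\<lambda>s. torsion_word a b i k p L (Transposition.transpose 0 1 s))"
      by (auto simp: torsion_word_def fun_eq_iff Transposition.transpose_def)
    then show ?thesis using covector_wedge_transpose[of 0 "2*r+3" 1 "torsion_word a b i k p L" v] by simp
  qed
  then show ?thesis by (simp add: torsion_sum_def sum_negf)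
qed

text \<open>A nonzero word uses \<open>CARD('n)\<close> different indices \<open>k, i, L 0, \<dots>\<close>, that is all of them.\<close>

lemma torsion_word_covers:
  fixes a b :: "'n::finite \<Rightarrow> 'v \<Rightarrow> complex"
  assumes "covector_wedge (2*r+3) (torsion_word a b k i p L) v \<noteq> 0" "CARD('n) = r + 2"
  shows "insert k (insert i (L ` {..<r})) = UNIV"
proof -
  note * = torsion_word_nonzero[OF assms(1)]
  have "card (insert k (insert i (L ` {..<r}))) = r + 2"
    using * by (simp add: card_image)
  then show ?thesis using assms(2) by (intro card_subset_eq) auto
qed

lemma torsion_sum_off:
  fixes a b :: "'n::finite \<Rightarrow> 'v \<Rightarrow> complex"
  assumes "CARD('n) = r + 2" "p \<noteq> k" "p \<noteq> i"
  shows "torsion_sum r a b v k i p = 0"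
  unfolding torsion_sum_def
proof (intro sum.neutral ballI, rule ccontr)
  fix L assume "covector_wedge (2*r+3) (torsion_word a b k i p L) v \<noteq> 0"
  from torsion_word_covers[OF this assms(1)] torsion_word_nonzero(5)[OF this] assms(2,3)
  show False by blast
qed

text \<open>A nonzero word with \<open>i\<close> in front must contain \<open>j\<close> among its further letters; exchanging the two letters is a
  bijection between the words of both sums.\<close>

lemma torsion_sum_diagonal:
  fixes a b :: "'n::finite \<Rightarrow> 'v \<Rightarrow> complex"
  assumes n: "CARD('n) = r + 2" and "i \<noteq> k" "j \<noteq> k"
  shows "torsion_sum r a b v k i i = torsion_sum r a b v k j j"
proof (cases "i = j")
  case False
  let ?E = "\<lambda>i L. covector_wedge (2*r+3) (torsion_word a b k i i L) v"
  let ?\<tau> = "Transposition.transpose i j"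
  have agree: "covector_wedge (2*r+3) (torsion_word a b k j j L) v = covector_wedge (2*r+3) (torsion_word a b k j j L') v"
    if "\<And>t. t < r \<Longrightarrow> L t = L' t" for L L' j
    using that by (intro fun_cong[OF covector_wedge_cong]) (auto simp: torsion_word_def)
  have exch: "?E j (\<lambda>t. Transposition.transpose i j (L t)) = ?E i L"
    if ne: "?E i L \<noteq> 0" and ij: "i \<noteq> j" "i \<noteq> k" "j \<noteq> k" for i j L
  proof -
    from torsion_word_covers[OF ne n] obtain t where "t < r" "L t = j" using ij by force
    then show ?thesis
      using torsion_word_exchange[of t r L i j] torsion_word_nonzero[OF ne] by auto
  qed
  have eq: "?E j (\<lambda>t. ?\<tau> (L t)) = ?E i L" for L
  proof (cases "?E i L = 0")
    case True
    show ?thesis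
    proof (rule ccontr)
      assume "?E j (\<lambda>t. ?\<tau> (L t)) \<noteq> ?E i L"
      then have ne: "?E j (\<lambda>t. ?\<tau> (L t)) \<noteq> 0" using True by simp
      from exch[OF this] have "?E i (\<lambda>t. Transposition.transpose j i (?\<tau> (L t))) = ?E j (\<lambda>t. ?\<tau> (L t))"
        using False assms by auto
      then show False using ne True by (simp add: transpose_commute)
    qed
  qed (use exch False assms in auto)
  have bij: "bij_betw (\<lambda>L. \<lambda>t\<in>{..<r}. ?\<tau> (L t)) ({..<r} \<rightarrow>\<^sub>E UNIV) ({..<r} \<rightarrow>\<^sub>E UNIV)"
    by (rule bij_betwI[where g = "\<lambda>L. \<lambda>t\<in>{..<r}. ?\<tau> (L t)"]) (auto simp: fun_eq_iff PiE_def extensional_def)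
  have "torsion_sum r a b v k j j = (\<Sum>L\<in>{..<r} \<rightarrow>\<^sub>E UNIV. ?E j (\<lambda>t\<in>{..<r}. ?\<tau> (L t)))"
    unfolding torsion_sum_def by (rule sum.reindex_bij_betw[OF bij, symmetric])
  also have "\<dots> = (\<Sum>L\<in>{..<r} \<rightarrow>\<^sub>E UNIV. ?E i L)"
  proof (rule sum.cong[OF refl])
    fix L
    have "?E j (\<lambda>t\<in>{..<r}. ?\<tau> (L t)) = ?E j (\<lambda>t. ?\<tau> (L t))" by (rule agree) simp
    then show "?E j (\<lambda>t\<in>{..<r}. ?\<tau> (L t)) = ?E i L" using eq by simp
  qed
  finally show ?thesis by (simp add: torsion_sum_def)
qed simp

text \<open>Of the terms with index triple \<open>(k, i, p)\<close> only those with \<open>p = i\<close> or \<open>p = k\<close> survive, and their values \<open>\<plusminus> Y k\<close>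
  do not depend on the second index. Hence the coefficients enter only through the traces in the assumption.\<close>

lemma torsion_wedge_vanish:
  fixes a b :: "'n::finite \<Rightarrow> 'v \<Rightarrow> complex" and \<Gamma> :: "'n \<Rightarrow> 'n \<Rightarrow> 'n \<Rightarrow> complex"
  assumes n: "CARD('n) = r + 2" and tr: "\<And>k. (\<Sum>i\<in>UNIV. \<Gamma> k i i - \<Gamma> i k i) = 0"
  shows "alternation (2*r+3)
    (\<lambda>u. (\<Sum>k\<in>UNIV. \<Sum>i\<in>UNIV. \<Sum>p\<in>UNIV. \<Gamma> k i p * a k (u 0) * a i (u 1) * b p (u 2)) *
         (\<Prod>t<r. \<Sum>l\<in>UNIV. a l (u (2*t+3)) * b l (u (2*t+4)))) v = 0"
proof -
  let ?X = "torsion_sum r a b v"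
  have "alternation (2*r+3)
    (\<lambda>u. (\<Sum>k\<in>UNIV. \<Sum>i\<in>UNIV. \<Sum>p\<in>UNIV. \<Gamma> k i p * a k (u 0) * a i (u 1) * b p (u 2)) *
         (\<Prod>t<r. \<Sum>l\<in>UNIV. a l (u (2*t+3)) * b l (u (2*t+4)))) v =
    alternation (2*r+3) (\<lambda>u. \<Sum>k\<in>UNIV. \<Sum>i\<in>UNIV. \<Sum>p\<in>UNIV. \<Gamma> k i p *
       (\<Sum>L\<in>{..<r} \<rightarrow>\<^sub>E UNIV. a k (u 0) * a i (u 1) * b p (u 2) * (\<Prod>t<r. a (L t) (u (2*t+3)) * b (L t) (u (2*t+4))))) v"
    apply (rule alternation_cong)
    apply (subst prod_sum_PiE, simp, simp)
    apply (simp only: sum_distrib_right)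
    apply (intro sum.cong refl)
    apply (simp add: sum_distrib_left mult_ac)
    done
  also have "\<dots> = (\<Sum>k\<in>UNIV. \<Sum>i\<in>UNIV. \<Sum>p\<in>UNIV. \<Gamma> k i p * ?X k i p)"
    by (simp only: alternation_sum alternation_cmult torsion_sum_def torsion_word_alternation)
  also have "\<dots> = 0"
  proof -
    have zero: "?X k k p = 0" for k p using torsion_sum_antisym[of r a b v k k p] by simp
    obtain Y where Y: "\<And>k i. i \<noteq> k \<Longrightarrow> ?X k i i = Y k"
    proof -
      have "\<exists>y. \<forall>i. i \<noteq> k \<longrightarrow> ?X k i i = y" for k
        using torsion_sum_diagonal[OF n] by metis
      then show thesis using that by metis
    qed
    have Y': "?X k i k = - Y i" if "i \<noteq> k" for i k
      using torsion_sum_antisym[of r a b v k i k] Y[of k i] that by simp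
    have inner: "(\<Sum>p\<in>UNIV. \<Gamma> k i p * ?X k i p) = (if i = k then 0 else \<Gamma> k i i * Y k - \<Gamma> k i k * Y i)" for k i
    proof (cases "i = k")
      case False
      have "(\<Sum>p\<in>UNIV. \<Gamma> k i p * ?X k i p) = (\<Sum>p\<in>{k,i}. \<Gamma> k i p * ?X k i p)"
        by (rule sum.mono_neutral_right) (auto simp: torsion_sum_off[OF n])
      then show ?thesis using False Y[of i k] Y'[of i k] by simp
    qed (simp add: zero)
    have "(\<Sum>k\<in>UNIV. \<Sum>i\<in>UNIV. \<Sum>p\<in>UNIV. \<Gamma> k i p * ?X k i p) =
        (\<Sum>k\<in>UNIV. \<Sum>i\<in>UNIV. if i = k then 0 else \<Gamma> k i i * Y k) -
        (\<Sum>k\<in>UNIV. \<Sum>i\<in>UNIV. if i = k then 0 else \<Gamma> k i k * Y i)"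
      unfolding inner by (simp flip: sum_subtractf) (intro sum.cong refl, simp)
    also have "(\<Sum>k\<in>UNIV. \<Sum>i\<in>UNIV. if i = k then 0 else \<Gamma> k i k * Y i) =
        (\<Sum>k\<in>UNIV. \<Sum>i\<in>UNIV. if i = k then 0 else \<Gamma> i k i * Y k)"
      by (subst sum.swap) (intro sum.cong refl, auto)
    also have "(\<Sum>k\<in>UNIV. \<Sum>i\<in>UNIV. if i = k then 0 else \<Gamma> k i i * Y k) - \<dots> =
        (\<Sum>k\<in>UNIV. Y k * (\<Sum>i\<in>UNIV. \<Gamma> k i i - \<Gamma> i k i))"
      by (simp add: sum_distrib_left flip: sum_subtractf) (intro sum.cong refl, auto simp: algebra_simps)
    finally show ?thesis by (simp add: tr)
  qed
  finally show ?thesis .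
qed


section \<open>Powers of two-forms and their exterior derivative\<close>

text \<open>Each permutation of the first \<open>2 m\<close> places that the induction hypothesis contributes is absorbed into the outer
  alternation; there are \<open>(2 m)!\<close> of them, which cancels the normalisation of the wedge product.\<close>

lemma wedge_power2_alternation:
  fixes a :: "'n::finite alt_form"
  assumes a: "\<And>u. a u = w (u 0) (u 1)"
  shows "wedge_power2 m a v = alternation (2*m) (\<lambda>u. \<Prod>t<m. w (u (2*t)) (u (2*t+1))) v / 2^m"
proof (induction m arbitrary: v)
  case 0
  have "{\<sigma>. \<sigma> permutes {..<0::nat}} = {id}" by auto
  then show ?case by (simp add: alternation_def sign_id)
next
  case (Suc m)
  let ?N = "2*m+2"
  define K where "K u = (\<Prod>t<Suc m. w (u (2*t)) (u (2*t+1)))" for u :: "nat \<Rightarrow> complex^'n"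
  have perm: "\<tau> permutes {..<?N}" if "\<tau> permutes {..<2*m}" for \<tau>
    using that by (rule permutes_subset) auto
  have K: "(\<Prod>t<m. w (u (\<tau> (2*t))) (u (\<tau> (2*t+1)))) * a (\<lambda>i. u (2*m+i)) = K (\<lambda>i. u (\<tau> i))"
    if "\<tau> permutes {..<2*m}" for \<tau> u
    using permutes_not_in[OF that, of "2*m"] permutes_not_in[OF that, of "2*m+1"] by (simp add: K_def a)
  have "wedge_power2 (Suc m) a v =
      alternation ?N (\<lambda>u. wedge_power2 m a u * a (\<lambda>i. u (2*m+i))) v / (fact (2*m) * 2)"
    by (simp add: wedge_def alternation_def mult.assoc)
  also have "alternation ?N (\<lambda>u. wedge_power2 m a u * a (\<lambda>i. u (2*m+i))) v =
      alternation ?N (\<lambda>u. \<Sum>\<tau> | \<tau> permutes {..<2*m}. (of_int (sign \<tau>) / 2^m) * K (\<lambda>i. u (\<tau> i))) v"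
    unfolding Suc.IH
    by (rule alternation_cong)
       (simp add: alternation_def K[symmetric] sum_distrib_right sum_divide_distrib mult.assoc)
  also have "\<dots> = (\<Sum>\<tau> | \<tau> permutes {..<2*m}. (of_int (sign \<tau>) / 2^m) * (of_int (sign \<tau>) * alternation ?N K v))"
    unfolding alternation_sum alternation_cmult
    by (intro sum.cong refl) (use alternation_permute[OF perm] in auto)
  also have "\<dots> = (\<Sum>\<tau> | \<tau> permutes {..<2*m}. alternation ?N K v / 2^m)"
    by (intro sum.cong refl) (simp add: sign_def)
  also have "\<dots> = fact (2*m) * alternation ?N K v / 2^m"
    by (simp add: card_permutations)
  finally show ?case by (simp add: K_def [abs_def] field_simps)
qed

text \<open>The permutation \<open>0 \<mapsto> j\<close> that keeps the other elements in order.\<close>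

definition front_cycle :: "nat \<Rightarrow> nat \<Rightarrow> nat" where
  "front_cycle j i = (if i = 0 then j else if i \<le> j then i - 1 else i)"

lemma front_cycle_permutes: "j \<le> N \<Longrightarrow> front_cycle j permutes {..<Suc N} \<and> sign (front_cycle j) = (-1)^j"
proof (induction j)
  case 0
  have "front_cycle 0 = id" by (auto simp: front_cycle_def)
  then show ?case by (metis permutes_id sign_id power_0)
next
  case (Suc j)
  have eq: "front_cycle (Suc j) = Transposition.transpose j (Suc j) \<circ> front_cycle j"
    by (auto simp: front_cycle_def fun_eq_iff Transposition.transpose_def)
  have t: "Transposition.transpose j (Suc j) permutes {..<Suc N}"
    using Suc.prems by (intro permutes_swap_id) auto
  have fc: "front_cycle j permutes {..<Suc N}" "sign (front_cycle j) = (-1)^j" using Suc by auto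
  have "sign (front_cycle (Suc j)) = (-1)^Suc j"
    unfolding eq sign_compose_permutes[OF t fc(1) finite_lessThan] fc(2) by (simp add: sign_swap_id)
  then show ?case using permutes_compose[OF fc(1) t] unfolding eq by blast
qed

definition perm_lift :: "(nat \<Rightarrow> nat) \<Rightarrow> nat \<Rightarrow> nat" where
  "perm_lift \<tau> i = (case i of 0 \<Rightarrow> 0 | Suc i \<Rightarrow> Suc (\<tau> i))"

lemma perm_lift_permutes:
  assumes "\<tau> permutes {..<N}"
  shows "perm_lift \<tau> permutes {..<Suc N} \<and> sign (perm_lift \<tau>) = sign \<tau>"
  using assms finite_lessThan
proof (induction rule: permutes_induct)
  case id
  have "perm_lift id = id" by (auto simp: perm_lift_def fun_eq_iff split: nat.split)
  then show ?case by (metis permutes_id)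
next
  case (swap a b p)
  have eq: "perm_lift (Transposition.transpose a b \<circ> p) = Transposition.transpose (Suc a) (Suc b) \<circ> perm_lift p"
    by (auto simp: perm_lift_def fun_eq_iff Transposition.transpose_def split: nat.split)
  have t: "Transposition.transpose (Suc a) (Suc b) permutes {..<Suc N}" "Transposition.transpose a b permutes {..<N}"
    using swap by (auto intro!: permutes_swap_id)
  have IH: "perm_lift p permutes {..<Suc N}" "sign (perm_lift p) = sign p" using swap by auto
  have "sign (perm_lift (Transposition.transpose a b \<circ> p)) = sign (Transposition.transpose a b \<circ> p)"
    unfolding eq sign_compose_permutes[OF t(1) IH(1) finite_lessThan] IH(2)
      sign_compose_permutes[OF t(2) \<open>p permutes {..<N}\<close> finite_lessThan]
    by (simp add: sign_swap_id)
  then show ?case using permutes_compose[OF IH(1) t(1)] unfolding eq by blast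
qed

text \<open>The alternating sum over the position of a distinguished first argument, combined with the
  alternation over the remaining arguments, is the full alternation.\<close>

lemma alternation_expand_first:
  "(\<Sum>j\<le>N. (-1)^j * alternation N (J (v j)) (\<lambda>i. if i < j then v i else v (Suc i)))
   = alternation (Suc N) (\<lambda>u. J (u 0) (\<lambda>i. u (Suc i))) v"
proof -
  let ?P = "{..N} \<times> {\<tau>. \<tau> permutes {..<N}}"
  let ?\<Phi> = "\<lambda>(j, \<tau>). front_cycle j \<circ> perm_lift \<tau>"
  have val0: "(front_cycle j \<circ> perm_lift \<tau>) 0 = j" for j \<tau>
    by (simp add: front_cycle_def perm_lift_def)
  have valS: "(front_cycle j \<circ> perm_lift \<tau>) (Suc i) = (if \<tau> i < j then \<tau> i else Suc (\<tau> i))" for j \<tau> i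
    by (auto simp: front_cycle_def perm_lift_def)
  have inj: "inj_on ?\<Phi> ?P"
  proof (rule inj_onI)
    fix x y assume "x \<in> ?P" "y \<in> ?P" and eq: "?\<Phi> x = ?\<Phi> y"
    obtain j \<tau> j' \<tau>' where xy: "x = (j, \<tau>)" "y = (j', \<tau>')" by (cases x, cases y)
    have j: "j = j'" using fun_cong[OF eq, of 0] by (simp add: xy val0[unfolded o_def])
    have "\<tau> i = \<tau>' i" for i
      using fun_cong[OF eq, of "Suc i"] unfolding xy split_conv valS j by (auto split: if_splits)
    then show "x = y" using j xy by auto
  qed
  have sub: "?\<Phi> ` ?P \<subseteq> {\<sigma>. \<sigma> permutes {..<Suc N}}"
    using front_cycle_permutes perm_lift_permutes by (auto intro: permutes_compose)
  have "card (?\<Phi> ` ?P) = card {\<sigma>. \<sigma> permutes {..<Suc N}}"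
    by (simp add: card_image[OF inj] card_permutations card_cartesian_product)
  then have img: "?\<Phi> ` ?P = {\<sigma>. \<sigma> permutes {..<Suc N}}"
    using sub finite_permutations by (intro card_subset_eq) auto
  have "alternation (Suc N) (\<lambda>u. J (u 0) (\<lambda>i. u (Suc i))) v =
      (\<Sum>(j, \<tau>)\<in>?P. of_int (sign (front_cycle j \<circ> perm_lift \<tau>)) *
         J (v ((front_cycle j \<circ> perm_lift \<tau>) 0)) (\<lambda>i. v ((front_cycle j \<circ> perm_lift \<tau>) (Suc i))))"
    unfolding alternation_def img[symmetric] sum.reindex[OF inj] by (simp add: o_def split_beta)
  also have "\<dots> = (\<Sum>(j, \<tau>)\<in>?P. (-1)^j * (of_int (sign \<tau>) *
         J (v j) (\<lambda>i. if \<tau> i < j then v (\<tau> i) else v (Suc (\<tau> i)))))"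
  proof (rule sum.cong[OF refl], unfold split_beta)
    fix x assume "x \<in> ?P"
    then obtain j \<tau> where x: "x = (j, \<tau>)" and "j \<le> N" and \<tau>: "\<tau> permutes {..<N}" by auto
    then have fc: "front_cycle j permutes {..<Suc N}" "sign (front_cycle j) = (-1)^j"
      using front_cycle_permutes by auto
    have "sign (front_cycle j \<circ> perm_lift \<tau>) = (-1)^j * sign \<tau>"
      using sign_compose_permutes[OF fc(1), of "perm_lift \<tau>"] perm_lift_permutes[OF \<tau>] fc(2) by simp
    then show "of_int (sign (front_cycle (fst x) \<circ> perm_lift (snd x))) *
         J (v ((front_cycle (fst x) \<circ> perm_lift (snd x)) 0)) (\<lambda>i. v ((front_cycle (fst x) \<circ> perm_lift (snd x)) (Suc i)))
      = (-1)^fst x * (of_int (sign (snd x)) * J (v (fst x)) (\<lambda>i. if snd x i < fst x then v (snd x i) else v (Suc (snd x i))))"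
      unfolding x fst_conv snd_conv val0 valS by (simp add: if_distrib mult.assoc cong: if_cong)
  qed
  also have "\<dots> = (\<Sum>j\<le>N. (-1)^j * alternation N (J (v j)) (\<lambda>i. if i < j then v i else v (Suc i)))"
    by (simp add: sum.cartesian_product[symmetric] alternation_def sum_distrib_left)
  finally show ?thesis by simp
qed

text \<open>By the product rule the derivative falls on one of the \<open>r + 1\<close> factors. Moving a pair of arguments to the front is
  an even permutation, so all these terms are equal after alternation.\<close>

lemma ext_deriv_wedge_power2:
  fixes \<omega> :: "complex^'n::finite \<Rightarrow> complex^'n \<Rightarrow> complex^'n \<Rightarrow> complex"
  assumes \<phi>: "\<And>w u. \<phi> w u = \<omega> w (u 0) (u 1)"
    and D: "\<And>x y. ((\<lambda>w. \<omega> w x y) has_derivative (\<lambda>d. \<omega>' d x y)) (at z)"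
  shows "ext_deriv (2 * Suc r) (\<lambda>w. wedge_power2 (Suc r) (\<phi> w)) z v =
    (of_nat (Suc r) / 2^Suc r) * alternation (2*r+3)
      (\<lambda>u. \<omega>' (u 0) (u 1) (u 2) * (\<Prod>t<r. \<omega> z (u (2*t+3)) (u (2*t+4)))) v"
proof -
  let ?m = "Suc r"
  define J where "J d u = \<omega>' d (u 0) (u 1) * (\<Prod>t<r. \<omega> z (u (2*t+2)) (u (2*t+3)))"
    for d and u :: "nat \<Rightarrow> complex^'n"
  define H where "H t0 d u = \<omega>' d (u (2*t0)) (u (2*t0+1)) * (\<Prod>t\<in>{..<?m}-{t0}. \<omega> z (u (2*t)) (u (2*t+1)))"
    for t0 d and u :: "nat \<Rightarrow> complex^'n"
  have H0: "H 0 = J"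
  proof -
    have "(\<Prod>t\<in>{..<?m}-{0}. \<omega> z (u (2*t)) (u (2*t+1))) = (\<Prod>t<r. \<omega> z (u (2*t+2)) (u (2*t+3)))" for u
      by (rule prod.reindex_bij_witness[of _ Suc "\<lambda>t. t - 1"]) (auto simp: gr0_conv_Suc eval_nat_numeral)
    then show ?thesis by (simp add: H_def J_def fun_eq_iff)
  qed
  have Ht: "alternation (2*?m) (H t0 d) u = alternation (2*?m) (J d) u" if t0: "t0 < ?m" for t0 d u
  proof (cases "t0 = 0")
    case False
    let ?\<tau> = "Transposition.transpose 0 t0"
    define \<pi> where "\<pi> = Transposition.transpose 0 (2*t0) \<circ> Transposition.transpose 1 (2*t0+1)"
    have p: "Transposition.transpose 0 (2*t0) permutes {..<2*?m}" "Transposition.transpose 1 (2*t0+1) permutes {..<2*?m}"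
      using t0 by (auto intro!: permutes_swap_id)
    have \<pi>: "\<pi> permutes {..<2*?m}" "sign \<pi> = 1"
      unfolding \<pi>_def using permutes_compose[OF p(2,1)] sign_compose_permutes[OF p] False
      by (auto simp: sign_swap_id)
    have \<pi>2: "\<pi> (2*t) = 2 * ?\<tau> t" "\<pi> (2*t+1) = 2 * ?\<tau> t + 1" for t
      using False unfolding \<pi>_def o_def Transposition.transpose_def by (auto; presburger)+
    have "H 0 d (\<lambda>i. u (\<pi> i)) = H t0 d u" for u
    proof -
      have "(\<Prod>t\<in>{..<?m}-{0}. \<omega> z (u (2 * ?\<tau> t)) (u (2 * ?\<tau> t+1))) = (\<Prod>t\<in>{..<?m}-{t0}. \<omega> z (u (2*t)) (u (2*t+1)))"
        by (rule prod.reindex_bij_witness[of _ ?\<tau> ?\<tau>]) (use t0 in \<open>auto simp: Transposition.transpose_def\<close>)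
      then show ?thesis
        unfolding H_def \<pi>2 using \<pi>2[of 0] by simp
    qed
    then show ?thesis using alternation_permute[OF \<pi>(1), of "H 0 d" u] \<pi>(2) H0 by simp
  qed (simp add: H0)
  have der: "frechet_derivative (\<lambda>w. wedge_power2 ?m (\<phi> w) u) (at z) d =
      (of_nat ?m / 2^?m) * alternation (2*?m) (J d) u" for d u
  proof -
    have "((\<lambda>w. (\<Prod>t<?m. \<omega> w (u' (2*t)) (u' (2*t+1)))) has_derivative (\<lambda>d. \<Sum>t<?m. H t d u')) (at z)" for u'
      using has_derivative_prod[of "{..<?m}" "\<lambda>t w. \<omega> w (u' (2*t)) (u' (2*t+1))" "\<lambda>t d. \<omega>' d (u' (2*t)) (u' (2*t+1))" z UNIV] D
      by (simp add: H_def)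
    then have "((\<lambda>w. \<Sum>\<sigma> | \<sigma> permutes {..<2*?m}. of_int (sign \<sigma>) * (\<Prod>t<?m. \<omega> w (u (\<sigma> (2*t))) (u (\<sigma> (2*t+1)))))
        has_derivative (\<lambda>d. \<Sum>\<sigma> | \<sigma> permutes {..<2*?m}. of_int (sign \<sigma>) * (\<Sum>t<?m. H t d (\<lambda>i. u (\<sigma> i))))) (at z)"
      by (intro has_derivative_sum has_derivative_mult_right)
    then have "((\<lambda>w. alternation (2*?m) (\<lambda>u. \<Prod>t<?m. \<omega> w (u (2*t)) (u (2*t+1))) u)
        has_derivative (\<lambda>d. alternation (2*?m) (\<lambda>u. \<Sum>t<?m. H t d u) u)) (at z)"
      by (simp only: alternation_def)
    then have "((\<lambda>w. alternation (2*?m) (\<lambda>u. \<Prod>t<?m. \<omega> w (u (2*t)) (u (2*t+1))) u / 2^?m)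
        has_derivative (\<lambda>d. alternation (2*?m) (\<lambda>u. \<Sum>t<?m. H t d u) u / 2^?m)) (at z)"
      by (rule bounded_linear.has_derivative[OF bounded_linear_divide])
    then have "((\<lambda>w. wedge_power2 ?m (\<phi> w) u)
        has_derivative (\<lambda>d. alternation (2*?m) (\<lambda>u. \<Sum>t<?m. H t d u) u / 2^?m)) (at z)"
      unfolding wedge_power2_alternation[of "\<phi> _", OF \<phi>] .
    then have "frechet_derivative (\<lambda>w. wedge_power2 ?m (\<phi> w) u) (at z) d =
        alternation (2*?m) (\<lambda>u. \<Sum>t<?m. H t d u) u / 2^?m"
      by (subst frechet_derivative_at[symmetric]) (assumption, rule refl)
    also have "alternation (2*?m) (\<lambda>u. \<Sum>t<?m. H t d u) u = of_nat ?m * alternation (2*?m) (J d) u"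
      unfolding alternation_sum by (subst sum.cong[OF refl Ht]) (simp_all del: of_nat_Suc)
    finally show ?thesis by (simp only: times_divide_eq_left)
  qed
  have "ext_deriv (2 * ?m) (\<lambda>w. wedge_power2 ?m (\<phi> w)) z v =
      (of_nat ?m / 2^?m) * (\<Sum>j\<le>2*?m. (-1)^j * alternation (2*?m) (J (v j)) (\<lambda>i. if i < j then v i else v (Suc i)))"
    unfolding ext_deriv_def der by (simp only: sum_distrib_left mult_ac)
  also have "\<dots> = (of_nat ?m / 2^?m) * alternation (Suc (2*?m)) (\<lambda>u. J (u 0) (\<lambda>i. u (Suc i))) v"
    unfolding alternation_expand_first ..
  also have "alternation (Suc (2*?m)) (\<lambda>u. J (u 0) (\<lambda>i. u (Suc i))) v =
     alternation (2*r+3) (\<lambda>u. \<omega>' (u 0) (u 1) (u 2) * (\<Prod>t<r. \<omega> z (u (2*t+3)) (u (2*t+4)))) v"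
    by (simp add: J_def eval_nat_numeral)
  finally show ?thesis .
qed

section \<open>The exterior derivative of powers of the fundamental form\<close>

lemma matrix_inv_inverse:
  assumes "invertible A"
  shows "A ** matrix_inv A = mat 1" "matrix_inv A ** A = mat 1"
  using someI_ex[OF assms[unfolded invertible_def]] by (simp_all add: matrix_inv_def)

lemma g_inv_left:
  assumes "invertible (G z)"
  shows "(\<Sum>p\<in>UNIV. g_inv G z p q * G z $ p $ l) = (if q = l then 1 else 0)"
proof -
  have "(matrix_inv (G z) ** G z) $ q $ l = (if q = l then 1 else 0)"
    using matrix_inv_inverse(2)[OF assms] by (simp add: mat_def)
  then show ?thesis by (simp add: g_inv_def matrix_matrix_mult_def)
qed

lemma g_inv_right:
  assumes "invertible (G z)"
  shows "(\<Sum>q\<in>UNIV. g_inv G z p q * G z $ k $ q) = (if p = k then 1 else 0)"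
proof -
  have "(G z ** matrix_inv (G z)) $ k $ p = (if p = k then 1 else 0)"
    using matrix_inv_inverse(1)[OF assms] by (auto simp: mat_def)
  then show ?thesis by (simp add: g_inv_def matrix_matrix_mult_def mult.commute)
qed

lemma wedge_dz_dzbar: "wedge 1 1 (dz i) (dzbar j) u = u 0 $ i * cnj (u 1 $ j) - u 1 $ i * cnj (u 0 $ j)"
proof -
  have "{..<1+1} = {0, 1::nat}" by auto
  then have eq: "{\<sigma>. \<sigma> permutes {..<1+1::nat}} = {id, Transposition.transpose 0 1}"
    by (auto simp: permutes_doubleton_iff)
  have "(\<lambda>i. i) \<noteq> Transposition.transpose 0 (1::nat)" by (metis Transposition.transpose_apply_first zero_neq_one)
  then show ?thesis
    unfolding wedge_def eq by (simp add: dz_def dzbar_def sign_swap_id sign_id id_def)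
qed

text \<open>The torsion condition enters twice, once for the part of \<open>d\<omega>\<close> of type \<open>(2,1)\<close> and once, in
  conjugate form, for the part of type \<open>(1,2)\<close>. In each part the metric is written as \<open>\<Sum>\<^sub>l a\<^sub>l \<otimes> b\<^sub>l\<close>
  with \<open>a\<^sub>l\<close> the coordinates of the type that occurs twice.\<close>

theorem ext_deriv_fundamental_power:
  fixes G :: "complex^'n::finite \<Rightarrow> complex^'n^'n"
  assumes dG: "\<And>i j. (\<lambda>w. G w $ i $ j) differentiable (at z)" and inv: "invertible (G z)"
    and tr: "\<And>k. (\<Sum>i\<in>UNIV. \<Sum>j\<in>UNIV. g_inv G z i j *
               (d_dz k (\<lambda>w. G w $ i $ j) z - d_dz i (\<lambda>w. G w $ k $ j) z)) = 0"
    and tr_bar: "\<And>k. (\<Sum>i\<in>UNIV. \<Sum>j\<in>UNIV. g_inv G z i j *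
               (d_dzbar k (\<lambda>w. G w $ i $ j) z - d_dzbar j (\<lambda>w. G w $ i $ k) z)) = 0"
  shows "ext_deriv (2 * (CARD('n) - 1)) (\<lambda>w. wedge_power2 (CARD('n) - 1) (fundamental_form G w)) z v = 0"
proof (cases "CARD('n) = 1")
  case True
  then show ?thesis by (simp add: ext_deriv_def)
next
  case False
  have "CARD('n) > 0" by simp
  then obtain r where n: "CARD('n) = r + 2" using False
    by (metis One_nat_def Suc_1 add.commute add_2_eq_Suc' gr0_conv_Suc not0_implies_Suc)
  define h where "h w x y = (\<Sum>i\<in>UNIV. \<Sum>j\<in>UNIV. G w $ i $ j * x $ i * cnj (y $ j))" for w x y
  define P where "P x y y' = (\<Sum>i\<in>UNIV. \<Sum>j\<in>UNIV. (\<Sum>k\<in>UNIV. d_dz k (\<lambda>w. G w $ i $ j) z * x $ k) * y $ i * cnj (y' $ j))" for x y y'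
  define Q where "Q x y y' = (\<Sum>i\<in>UNIV. \<Sum>j\<in>UNIV. (\<Sum>k\<in>UNIV. d_dzbar k (\<lambda>w. G w $ i $ j) z * cnj (x $ k)) * y $ i * cnj (y' $ j))" for x y y'
  define \<omega> where "\<omega> w x y = \<i> * h w x y - \<i> * h w y x" for w x y
  define fP where "fP x y y' = \<i> * P x y y' - \<i> * P x y' y" for x y y'
  define fQ where "fQ x y y' = \<i> * Q x y y' - \<i> * Q x y' y" for x y y'
  have \<phi>: "fundamental_form G w u = \<omega> w (u 0) (u 1)" for w u
    unfolding fundamental_form_def wedge_dz_dzbar \<omega>_def h_def
    by (simp add: right_diff_distrib sum_subtractf mult.assoc)
  have hder: "((\<lambda>w. h w x y) has_derivative (\<lambda>d. P d x y + Q d x y)) (at z)" for x y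
  proof -
    have "((\<lambda>w. h w x y) has_derivative (\<lambda>d. \<Sum>i\<in>UNIV. \<Sum>j\<in>UNIV.
        frechet_derivative (\<lambda>w. G w $ i $ j) (at z) d * x $ i * cnj (y $ j))) (at z)"
      unfolding h_def
      by (intro has_derivative_sum has_derivative_mult_left) (use dG frechet_derivative_works in blast)
    then show ?thesis
      unfolding derivative_wirtinger[OF dG] P_def Q_def
      by (simp add: sum.distrib distrib_right)
  qed
  have D: "((\<lambda>w. \<omega> w x y) has_derivative (\<lambda>d. fP d x y + fQ d x y)) (at z)" for x y
  proof -
    have "((\<lambda>w. \<omega> w x y) has_derivative (\<lambda>d. \<i> * (P d x y + Q d x y) - \<i> * (P d y x + Q d y x))) (at z)"
      unfolding \<omega>_def by (intro has_derivative_diff has_derivative_mult_right hder)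
    then show ?thesis by (simp add: fP_def fQ_def algebra_simps)
  qed
  let ?alt = "\<lambda>f k. alternation (2*r+3) (\<lambda>u. f (u 0) (u 1) (u 2) * (\<Prod>t<r. k (u (2*t+3)) (u (2*t+4)))) v"
  have vP: "?alt fP (\<omega> z) = 0"
  proof -
    define a :: "'n \<Rightarrow> complex^'n \<Rightarrow> complex" where "a l x = x $ l" for l x
    define b where "b p x = (\<Sum>j\<in>UNIV. G z $ p $ j * cnj (x $ j))" for p and x :: "complex^'n"
    define \<Gamma> where "\<Gamma> k i p = (\<Sum>j\<in>UNIV. g_inv G z p j * d_dz k (\<lambda>w. G w $ i $ j) z)" for k i p
    have y: "cnj (x $ j) = (\<Sum>p\<in>UNIV. g_inv G z p j * b p x)" for x j
    proof -
      have "(\<Sum>p\<in>UNIV. g_inv G z p j * b p x) = (\<Sum>l\<in>UNIV. (\<Sum>p\<in>UNIV. g_inv G z p j * G z $ p $ l) * cnj (x $ l))"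
        unfolding b_def sum_distrib_left sum_distrib_right by (subst sum.swap) (simp add: mult.assoc)
      then show ?thesis by (simp add: g_inv_left[of G z, OF inv] if_distrib[of "\<lambda>c. c * _"] cong: if_cong)
    qed
    have hh: "h z x y = (\<Sum>l\<in>UNIV. a l x * b l y)" for x y
      by (simp add: h_def a_def b_def sum_distrib_left mult_ac)
    have PP: "P x y y' = (\<Sum>k\<in>UNIV. \<Sum>i\<in>UNIV. \<Sum>p\<in>UNIV. \<Gamma> k i p * a k x * a i y * b p y')" for x y y'
    proof -
      have "P x y y' = (\<Sum>i\<in>UNIV. \<Sum>j\<in>UNIV. \<Sum>k\<in>UNIV. \<Sum>p\<in>UNIV.
          g_inv G z p j * d_dz k (\<lambda>w. G w $ i $ j) z * a k x * a i y * b p y')"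
        unfolding P_def y[of y'] by (simp add: a_def sum_distrib_left sum_distrib_right mult_ac)
      also have "\<dots> = (\<Sum>i\<in>UNIV. \<Sum>k\<in>UNIV. \<Sum>j\<in>UNIV. \<Sum>p\<in>UNIV.
          g_inv G z p j * d_dz k (\<lambda>w. G w $ i $ j) z * a k x * a i y * b p y')"
        by (intro sum.cong refl sum.swap)
      also have "\<dots> = (\<Sum>k\<in>UNIV. \<Sum>i\<in>UNIV. \<Sum>j\<in>UNIV. \<Sum>p\<in>UNIV.
          g_inv G z p j * d_dz k (\<lambda>w. G w $ i $ j) z * a k x * a i y * b p y')"
        by (rule sum.swap)
      also have "\<dots> = (\<Sum>k\<in>UNIV. \<Sum>i\<in>UNIV. \<Sum>p\<in>UNIV. \<Sum>j\<in>UNIV.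
          g_inv G z p j * d_dz k (\<lambda>w. G w $ i $ j) z * a k x * a i y * b p y')"
        by (intro sum.cong refl sum.swap)
      finally show ?thesis by (simp add: \<Gamma>_def sum_distrib_right)
    qed
    have "(\<Sum>i\<in>UNIV. \<Gamma> k i i - \<Gamma> i k i) = 0" for k
      using tr[of k] by (simp add: \<Gamma>_def right_diff_distrib sum_subtractf)
    from torsion_wedge_vanish[OF n this, of a b v]
    have "?alt P (h z) = 0" unfolding PP hh .
    moreover have "?alt (\<lambda>x y y'. \<i> * P x y y') (\<lambda>x y. \<i> * h z x y) = \<i>^(r+1) * ?alt P (h z)"
      unfolding alternation_cmult[symmetric] by (rule alternation_cong) (simp add: prod.distrib mult_ac)
    ultimately show ?thesis
      unfolding alternation_halves[of fP "\<lambda>x y y'. \<i> * P x y y'", OF fP_def, of "\<omega> z" "\<lambda>x y. \<i> * h z x y", OF \<omega>_def]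
      by simp
  qed
  have vQ: "?alt fQ (\<omega> z) = 0"
  proof -
    define a :: "'n \<Rightarrow> complex^'n \<Rightarrow> complex" where "a l x = cnj (x $ l)" for l x
    define b where "b p x = (\<Sum>i\<in>UNIV. G z $ i $ p * x $ i)" for p and x :: "complex^'n"
    define \<Gamma> where "\<Gamma> k j p = (\<Sum>i\<in>UNIV. g_inv G z i p * d_dzbar k (\<lambda>w. G w $ i $ j) z)" for k j p
    have y: "x $ i = (\<Sum>p\<in>UNIV. g_inv G z i p * b p x)" for x i
    proof -
      have "(\<Sum>p\<in>UNIV. g_inv G z i p * b p x) = (\<Sum>l\<in>UNIV. (\<Sum>p\<in>UNIV. g_inv G z i p * G z $ l $ p) * x $ l)"
        unfolding b_def sum_distrib_left sum_distrib_right by (subst sum.swap) (simp add: mult.assoc)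
      then show ?thesis by (simp add: g_inv_right[of G z, OF inv] if_distrib[of "\<lambda>c. c * _"] cong: if_cong)
    qed
    have hh: "h z y x = (\<Sum>l\<in>UNIV. a l x * b l y)" for x y
      unfolding h_def by (subst sum.swap) (simp add: a_def b_def sum_distrib_left mult_ac)
    have QQ: "Q x y' y = (\<Sum>k\<in>UNIV. \<Sum>j\<in>UNIV. \<Sum>p\<in>UNIV. \<Gamma> k j p * a k x * a j y * b p y')" for x y y'
    proof -
      have "Q x y' y = (\<Sum>i\<in>UNIV. \<Sum>j\<in>UNIV. \<Sum>k\<in>UNIV. \<Sum>p\<in>UNIV.
          g_inv G z i p * d_dzbar k (\<lambda>w. G w $ i $ j) z * a k x * a j y * b p y')"
        unfolding Q_def y[of y'] by (simp add: a_def sum_distrib_left sum_distrib_right mult_ac)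
      also have "\<dots> = (\<Sum>i\<in>UNIV. \<Sum>k\<in>UNIV. \<Sum>j\<in>UNIV. \<Sum>p\<in>UNIV.
          g_inv G z i p * d_dzbar k (\<lambda>w. G w $ i $ j) z * a k x * a j y * b p y')"
        by (intro sum.cong refl sum.swap)
      also have "\<dots> = (\<Sum>k\<in>UNIV. \<Sum>i\<in>UNIV. \<Sum>j\<in>UNIV. \<Sum>p\<in>UNIV.
          g_inv G z i p * d_dzbar k (\<lambda>w. G w $ i $ j) z * a k x * a j y * b p y')"
        by (rule sum.swap)
      also have "\<dots> = (\<Sum>k\<in>UNIV. \<Sum>j\<in>UNIV. \<Sum>i\<in>UNIV. \<Sum>p\<in>UNIV.
          g_inv G z i p * d_dzbar k (\<lambda>w. G w $ i $ j) z * a k x * a j y * b p y')"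
        by (intro sum.cong refl sum.swap)
      also have "\<dots> = (\<Sum>k\<in>UNIV. \<Sum>j\<in>UNIV. \<Sum>p\<in>UNIV. \<Sum>i\<in>UNIV.
          g_inv G z i p * d_dzbar k (\<lambda>w. G w $ i $ j) z * a k x * a j y * b p y')"
        by (intro sum.cong refl sum.swap)
      finally show ?thesis by (simp add: \<Gamma>_def sum_distrib_right)
    qed
    have "(\<Sum>j\<in>UNIV. \<Gamma> k j j - \<Gamma> j k j) = 0" for k
      using tr_bar[of k] unfolding \<Gamma>_def
      by (subst (asm) sum.swap) (simp add: right_diff_distrib sum_subtractf)
    from torsion_wedge_vanish[OF n this, of a b v]
    have "?alt (\<lambda>x y y'. Q x y' y) (\<lambda>x y. h z y x) = 0" unfolding QQ hh .
    moreover have "?alt (\<lambda>x y y'. c * Q x y' y) (\<lambda>x y. c * h z y x)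
        = c^(r+1) * ?alt (\<lambda>x y y'. Q x y' y) (\<lambda>x y. h z y x)" for c
      unfolding alternation_cmult[symmetric] by (rule alternation_cong) (simp add: prod.distrib mult_ac del: mult_minus_left)
    moreover have "fQ x y y' = - \<i> * Q x y' y - (- \<i> * Q x y y')" "\<omega> z x y = - \<i> * h z y x - (- \<i> * h z x y)" for x y y'
      by (simp_all add: fQ_def \<omega>_def)
    note alternation_halves[of fQ "\<lambda>x y y'. - \<i> * Q x y' y", OF this(1), of "\<omega> z" "\<lambda>x y. - \<i> * h z y x", OF this(2), of r v]
    ultimately show ?thesis by (simp only: mult_zero_right)
  qed
  have "ext_deriv (2 * Suc r) (\<lambda>w. wedge_power2 (Suc r) (fundamental_form G w)) z v =
      (of_nat (Suc r) / 2^Suc r) * ?alt (\<lambda>x y y'. fP x y y' + fQ x y y') (\<omega> z)"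
    by (rule ext_deriv_wedge_power2[OF \<phi> D])
  also have "?alt (\<lambda>x y y'. fP x y y' + fQ x y y') (\<omega> z) = ?alt fP (\<omega> z) + ?alt fQ (\<omega> z)"
    unfolding alternation_add[symmetric] by (simp add: distrib_right)
  finally have "ext_deriv (2 * Suc r) (\<lambda>w. wedge_power2 (Suc r) (fundamental_form G w)) z v = 0"
    unfolding vP vQ by (simp only: add_0 mult_zero_right)
  moreover have "CARD('n) - 1 = Suc r" using n by simp
  ultimately show ?thesis by (simp only:)
qed


section \<open>Polarisation of the curvature condition\<close>

text \<open>A form of bidegree \<open>(2,2)\<close> is recovered from its values on the diagonal, up to symmetrisation.
  Inserting \<open>x + t y\<close> with \<open>t = \<pm> r, \<pm> \<i> r\<close> and averaging against \<open>t\<close> isolates the terms whose numbers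
  of factors \<open>t\<close> and conjugate \<open>t\<close> differ by one.\<close>

lemma polarisation_22:
  fixes F :: "complex^'n::finite \<Rightarrow> complex^'n \<Rightarrow> complex^'n \<Rightarrow> complex^'n \<Rightarrow> complex"
  assumes add: "\<And>x x' y z w. F (x + x') y z w = F x y z w + F x' y z w"
      "\<And>x y y' z w. F x (y + y') z w = F x y z w + F x y' z w"
    and scale: "\<And>c x y z w. F (c *s x) y z w = c * F x y z w"
      "\<And>c x y z w. F x (c *s y) z w = cnj c * F x y z w"
    and sym: "\<And>x y z w. F x y z w = F z y x w" "\<And>x y z w. F x y z w = F x w z y"
    and diag: "\<And>x. F x x x x = 0"
  shows "F x y z w = 0"
proof -
  have add': "F x y (z + z') w = F x y z w + F x y z' w" "F x y z (w + w') = F x y z w + F x y z w'" for x y z z' w w'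
    by (metis add(1) sym(1), metis add(2) sym(2))
  have scale': "F x y (c *s z) w = c * F x y z w" "F x y z (c *s w) = cnj c * F x y z w" for c x y z w
    by (metis scale(1) sym(1), metis scale(2) sym(2))
  note lin = add add' scale scale'
  have 1: "F y x x x = 0" for x y
  proof -
    have e: "0 = 2 * t * F y x x x + 2 * cnj t * F x y x x + t^2 * F y x y x + (cnj t)^2 * F x y x y
        + 4 * t * cnj t * F y y x x + 2 * t^2 * cnj t * F y y y x + 2 * t * (cnj t)^2 * F y y x y" for t
    proof -
      have "0 = F (x + t *s y) (x + t *s y) (x + t *s y) (x + t *s y)" by (simp add: diag)
      also have "\<dots> = 2 * t * F y x x x + 2 * cnj t * F x y x x + t^2 * F y x y x + (cnj t)^2 * F x y x y
        + 4 * t * cnj t * F y y x x + 2 * t^2 * cnj t * F y y y x + 2 * t * (cnj t)^2 * F y y x y"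
        unfolding lin using sym(1)[of x x y x] sym(2)[of x x x y] sym(1)[of x y y x] sym(2)[of y x x y] sym(2)[of x x y y]
          sym(1)[of x x y y] sym(2)[of y x y y] sym(1)[of x y y y] diag
        by (simp add: power2_eq_square algebra_simps)
      finally show ?thesis .
    qed
    have c: "r * F y x x x + r^3 * F y y y x = 0" if "cnj r = r" for r
    proof -
      \<comment> \<open>The expansion \<open>e\<close> at \<open>t = r, \<i> r, - r, - \<i> r\<close>, weighted with the powers of \<open>- \<i>\<close>.\<close>
      have "8 * (r * F y x x x + r^3 * F y y y x) =
          (2 * r * F y x x x + 2 * cnj r * F x y x x + r^2 * F y x y x + (cnj r)^2 * F x y x y
            + 4 * r * cnj r * F y y x x + 2 * r^2 * cnj r * F y y y x + 2 * r * (cnj r)^2 * F y y x y)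
        - \<i> * (2 * (\<i>*r) * F y x x x + 2 * cnj (\<i>*r) * F x y x x + (\<i>*r)^2 * F y x y x + (cnj (\<i>*r))^2 * F x y x y
            + 4 * (\<i>*r) * cnj (\<i>*r) * F y y x x + 2 * (\<i>*r)^2 * cnj (\<i>*r) * F y y y x + 2 * (\<i>*r) * (cnj (\<i>*r))^2 * F y y x y)
        - (2 * (-r) * F y x x x + 2 * cnj (-r) * F x y x x + (-r)^2 * F y x y x + (cnj (-r))^2 * F x y x y
            + 4 * (-r) * cnj (-r) * F y y x x + 2 * (-r)^2 * cnj (-r) * F y y y x + 2 * (-r) * (cnj (-r))^2 * F y y x y)
        + \<i> * (2 * (-\<i>*r) * F y x x x + 2 * cnj (-\<i>*r) * F x y x x + (-\<i>*r)^2 * F y x y x + (cnj (-\<i>*r))^2 * F x y x y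
            + 4 * (-\<i>*r) * cnj (-\<i>*r) * F y y x x + 2 * (-\<i>*r)^2 * cnj (-\<i>*r) * F y y y x + 2 * (-\<i>*r) * (cnj (-\<i>*r))^2 * F y y x y)"
        using that by (simp add: power2_eq_square power3_eq_cube algebra_simps)
      also have "\<dots> = 0" unfolding e[symmetric] by simp
      finally show ?thesis by (metis mult_eq_0_iff zero_neq_numeral)
    qed
    \<comment> \<open>The radii 1 and 2 separate the linear from the cubic term.\<close>
    have "6 * F y x x x = 8 * (1 * F y x x x + 1^3 * F y y y x) - (2 * F y x x x + 2^3 * F y y y x)" by simp
    also have "\<dots> = 0" using c[of 1] c[of 2] by (simp only: complex_cnj_one complex_cnj_numeral mult_zero_right diff_self)
    finally show ?thesis by simp
  qed
  have 2: "F y z x x = 0" for x y z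
  proof -
    have e: "0 = t * F y x z x + 2 * cnj t * F y z x x + 2 * t * cnj t * F y z z x + (cnj t)^2 * F y z x z" for t
    proof -
      have "0 = F y (x + t *s z) (x + t *s z) (x + t *s z)" by (simp add: 1)
      also have "\<dots> = t * F y x z x + 2 * cnj t * F y z x x + 2 * t * cnj t * F y z z x + (cnj t)^2 * F y z x z"
        unfolding lin using sym(2)[of y x x z] sym(2)[of y x z z] 1 by (simp add: power2_eq_square algebra_simps)
      finally show ?thesis .
    qed
    have "8 * F y z x x = (1 * F y x z x + 2 * cnj 1 * F y z x x + 2 * 1 * cnj 1 * F y z z x + (cnj 1)^2 * F y z x z)
      + \<i> * (\<i> * F y x z x + 2 * cnj \<i> * F y z x x + 2 * \<i> * cnj \<i> * F y z z x + (cnj \<i>)^2 * F y z x z)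
      - ((-1) * F y x z x + 2 * cnj (-1) * F y z x x + 2 * (-1) * cnj (-1) * F y z z x + (cnj (-1))^2 * F y z x z)
      - \<i> * ((-\<i>) * F y x z x + 2 * cnj (-\<i>) * F y z x x + 2 * (-\<i>) * cnj (-\<i>) * F y z z x + (cnj (-\<i>))^2 * F y z x z)"
      by (simp add: power2_eq_square algebra_simps)
    also have "\<dots> = 0" unfolding e[symmetric] by simp
    finally show ?thesis by simp
  qed
  have e: "0 = t * F x y z w + cnj t * F x y w z" for t
    using 2[of x y "w + t *s z"] 2[of x y w] 2[of x y z] unfolding lin by simp
  have "2 * F x y z w = (1 * F x y z w + cnj 1 * F x y w z) - \<i> * (\<i> * F x y z w + cnj \<i> * F x y w z)"
    by (simp add: algebra_simps)
  also have "\<dots> = 0" unfolding e[symmetric] by simp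
  finally show ?thesis by simp
qed

text \<open>The symmetrised coefficients are the values on coordinate vectors of a form to which the preceding lemma applies.\<close>

lemma polarisation_tensor:
  fixes A :: "'n::finite \<Rightarrow> 'n \<Rightarrow> 'n \<Rightarrow> 'n \<Rightarrow> complex"
  assumes "\<And>x :: complex^'n. (\<Sum>i\<in>UNIV. \<Sum>j\<in>UNIV. \<Sum>k\<in>UNIV. \<Sum>l\<in>UNIV. A i j k l * x$i * cnj (x$j) * x$k * cnj (x$l)) = 0"
  shows "A i j k l + A k j i l + A i l k j + A k l i j = 0"
proof -
  define Q where "Q x y z w = (\<Sum>i\<in>UNIV. \<Sum>j\<in>UNIV. \<Sum>k\<in>UNIV. \<Sum>l\<in>UNIV. A i j k l * x$i * cnj (y$j) * z$k * cnj (w$l))"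
    for x y z w :: "complex^'n"
  have add: "Q (x + x') y z w = Q x y z w + Q x' y z w" "Q x (y + y') z w = Q x y z w + Q x y' z w"
    "Q x y (z + z') w = Q x y z w + Q x y z' w" "Q x y z (w + w') = Q x y z w + Q x y z w'" for x x' y y' z z' w w'
    by (simp_all add: Q_def algebra_simps sum.distrib)
  have scale: "Q (c *s x) y z w = c * Q x y z w" "Q x (c *s y) z w = cnj c * Q x y z w"
    "Q x y (c *s z) w = c * Q x y z w" "Q x y z (c *s w) = cnj c * Q x y z w" for c x y z w
    by (simp_all add: Q_def sum_distrib_left mult_ac)
  have Q: "Q x x x x = 0" for x using assms by (simp add: Q_def)
  have "Q x y z w + Q z y x w + Q x w z y + Q z w x y = 0" for x y z w
    by (rule polarisation_22[of "\<lambda>x y z w. Q x y z w + Q z y x w + Q x w z y + Q z w x y"])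
       (simp_all add: add scale Q algebra_simps)
  moreover have axis: "Q (axis i 1) (axis j 1) (axis k 1) (axis l 1) = A i j k l" for i j k l
  proof -
    have d: "(\<Sum>i\<in>UNIV. f i * (if i = a then 1 else 0)) = f a" for a and f :: "'n \<Rightarrow> complex"
      by (simp add: if_distrib cong: if_cong)
    have "Q (axis i 1) (axis j 1) (axis k 1) (axis l 1) =
      (\<Sum>i'\<in>UNIV. (\<Sum>j'\<in>UNIV. (\<Sum>k'\<in>UNIV. (\<Sum>l'\<in>UNIV. A i' j' k' l' * (if l' = l then 1 else 0))
         * (if k' = k then 1 else 0)) * (if j' = j then 1 else 0)) * (if i' = i then 1 else 0))"
      unfolding Q_def sum_distrib_right by (intro sum.cong refl) (simp add: axis_def)
    then show ?thesis unfolding d .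
  qed
  ultimately show ?thesis by (metis axis)
qed


section \<open>The two scalar curvatures coincide\<close>

definition chern_scalar :: "(complex^'n \<Rightarrow> complex^'n^'n) \<Rightarrow> complex^'n::finite \<Rightarrow> complex" where
  "chern_scalar G z = (\<Sum>i\<in>UNIV. \<Sum>j\<in>UNIV. \<Sum>k\<in>UNIV. \<Sum>l\<in>UNIV. g_inv G z i j * g_inv G z k l * chern_R G z i j k l)"

text \<open>The trace of \<open>R\<close> that pairs each holomorphic index with the barred index of the other pair. It is the trace of the
  third and of the fourth Ricci curvature, whereas \<open>chern_scalar\<close> is that of the first two.\<close>

definition chern_scalar' :: "(complex^'n \<Rightarrow> complex^'n^'n) \<Rightarrow> complex^'n::finite \<Rightarrow> complex" where
  "chern_scalar' G z = (\<Sum>i\<in>UNIV. \<Sum>j\<in>UNIV. \<Sum>k\<in>UNIV. \<Sum>l\<in>UNIV. g_inv G z i j * g_inv G z k l * chern_R G z i l k j)"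

lemma sum4_rotate: "(\<Sum>i\<in>UNIV. \<Sum>j\<in>UNIV. \<Sum>k\<in>UNIV. \<Sum>l\<in>UNIV. f i j k l) = (\<Sum>k\<in>UNIV. \<Sum>l\<in>UNIV. \<Sum>i\<in>UNIV. \<Sum>j\<in>UNIV. f i j k l)"
  for f :: "'a::finite \<Rightarrow> 'b::finite \<Rightarrow> 'c::finite \<Rightarrow> 'd::finite \<Rightarrow> complex"
proof -
  have "(\<Sum>i\<in>UNIV. \<Sum>j\<in>UNIV. \<Sum>k\<in>UNIV. \<Sum>l\<in>UNIV. f i j k l) = (\<Sum>i\<in>UNIV. \<Sum>k\<in>UNIV. \<Sum>j\<in>UNIV. \<Sum>l\<in>UNIV. f i j k l)"
    by (intro sum.cong refl sum.swap)
  also have "\<dots> = (\<Sum>k\<in>UNIV. \<Sum>i\<in>UNIV. \<Sum>j\<in>UNIV. \<Sum>l\<in>UNIV. f i j k l)" by (rule sum.swap)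
  also have "\<dots> = (\<Sum>k\<in>UNIV. \<Sum>i\<in>UNIV. \<Sum>l\<in>UNIV. \<Sum>j\<in>UNIV. f i j k l)" by (intro sum.cong refl sum.swap)
  also have "\<dots> = (\<Sum>k\<in>UNIV. \<Sum>l\<in>UNIV. \<Sum>i\<in>UNIV. \<Sum>j\<in>UNIV. f i j k l)" by (intro sum.cong refl sum.swap)
  finally show ?thesis .
qed

lemma sum22_product: "(\<Sum>i\<in>UNIV. \<Sum>j\<in>UNIV. p i j) * (\<Sum>k\<in>UNIV. \<Sum>l\<in>UNIV. q k l) =
    (\<Sum>i\<in>UNIV. \<Sum>j\<in>UNIV. \<Sum>k\<in>UNIV. \<Sum>l\<in>UNIV. p i j * q k l)"
  for p :: "'a::finite \<Rightarrow> 'b::finite \<Rightarrow> complex" and q :: "'c::finite \<Rightarrow> 'd::finite \<Rightarrow> complex"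
  by (simp only: sum_distrib_right) (simp only: sum_distrib_left)

lemma ricci_trace:
  assumes "m \<in> {1, 2, 3, 4::nat}"
  shows "(\<Sum>a\<in>UNIV. \<Sum>b\<in>UNIV. g_inv G z a b * chern_ricci m G z a b) =
    (if m \<le> 2 then chern_scalar G z else chern_scalar' G z)"
proof -
  consider "m = 1" | "m = 2" | "m = 3" | "m = 4" using assms by auto
  then show ?thesis
  proof cases
    case 1
    then show ?thesis by (simp add: chern_ricci_def chern_scalar_def sum_distrib_left mult.assoc)
  next
    case 2
    then show ?thesis unfolding chern_scalar_def
      by (subst sum4_rotate) (simp add: chern_ricci_def sum_distrib_left mult_ac)
  next
    case 3
    then have "(\<Sum>a\<in>UNIV. \<Sum>b\<in>UNIV. g_inv G z a b * chern_ricci m G z a b) =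
      (\<Sum>a\<in>UNIV. \<Sum>b\<in>UNIV. \<Sum>k\<in>UNIV. \<Sum>j\<in>UNIV. g_inv G z a b * g_inv G z k j * chern_R G z a j k b)"
      by (simp add: chern_ricci_def sum_distrib_left mult.assoc)
    then show ?thesis using 3 by (simp add: chern_scalar'_def)
  next
    case 4
    then have "(\<Sum>a\<in>UNIV. \<Sum>b\<in>UNIV. g_inv G z a b * chern_ricci m G z a b) =
      (\<Sum>a\<in>UNIV. \<Sum>b\<in>UNIV. \<Sum>i\<in>UNIV. \<Sum>l\<in>UNIV. g_inv G z a b * g_inv G z i l * chern_R G z i b a l)"
      by (simp add: chern_ricci_def sum_distrib_left mult.assoc)
    also have "\<dots> = chern_scalar' G z"
      unfolding chern_scalar'_def by (subst sum4_rotate) (simp add: mult_ac)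
    finally show ?thesis using 4 by simp
  qed
qed

text \<open>Tracing the polarised tensor once with each of the two index pairings gives \<open>\<alpha> (n + 1) t + \<beta> (s + s') = 0\<close>,
  where \<open>t\<close> is the trace of the given Ricci curvature. The relation between \<open>\<alpha>\<close> and \<open>\<beta>\<close> is the one for which this
  becomes \<open>s + s' = 2 t\<close>; as \<open>t\<close> is \<open>s\<close> or \<open>s'\<close>, either case gives the claim.\<close>

theorem scalars_coincide:
  fixes G :: "complex^'n::finite \<Rightarrow> complex^'n^'n"
  assumes inv: "invertible (G z)"
    and real: "\<And>x. complex_of_real (norm2_g G z x) = (\<Sum>i\<in>UNIV. \<Sum>j\<in>UNIV. G z $ i $ j * x$i * cnj (x$j))"
    and pos: "\<And>x. x \<noteq> 0 \<Longrightarrow> norm2_g G z x > 0"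
    and m: "m \<in> {1, 2, 3, 4}" and \<beta>: "\<beta> \<noteq> 0" and \<alpha>: "\<alpha> * (real CARD('n) + 1) + 2 * \<beta> = 0"
    and zero: "\<And>x. x \<noteq> 0 \<Longrightarrow> complex_of_real (\<alpha> / norm2_g G z x) * ricci_form m G z x
        + complex_of_real \<beta> * hol_sec_curv G z x = 0"
  shows "chern_scalar G z = chern_scalar' G z"
proof -
  define A where "A i j k l = complex_of_real \<alpha> * (G z $ i $ j * chern_ricci m G z k l) + complex_of_real \<beta> * chern_R G z i j k l"
    for i j k l
  let ?gi = "g_inv G z"
  define T where "T = (\<Sum>a\<in>UNIV. \<Sum>b\<in>UNIV. ?gi a b * chern_ricci m G z a b)"
  have "(\<Sum>i\<in>UNIV. \<Sum>j\<in>UNIV. \<Sum>k\<in>UNIV. \<Sum>l\<in>UNIV. A i j k l * x$i * cnj (x$j) * x$k * cnj (x$l)) = 0" for x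
  proof (cases "x = 0")
    case False
    let ?N = "norm2_g G z x" and ?R = "\<Sum>i\<in>UNIV. \<Sum>j\<in>UNIV. \<Sum>k\<in>UNIV. \<Sum>l\<in>UNIV. chern_R G z i j k l * x$i * cnj (x$j) * x$k * cnj (x$l)"
    have N: "complex_of_real ?N \<noteq> 0" using pos[OF False] by simp
    have "(\<Sum>i\<in>UNIV. \<Sum>j\<in>UNIV. \<Sum>k\<in>UNIV. \<Sum>l\<in>UNIV. A i j k l * x$i * cnj (x$j) * x$k * cnj (x$l)) =
      complex_of_real \<alpha> * ((\<Sum>i\<in>UNIV. \<Sum>j\<in>UNIV. G z $ i $ j * x$i * cnj (x$j)) * ricci_form m G z x) + complex_of_real \<beta> * ?R"
      unfolding A_def ricci_form_def sum22_product
      by (simp add: sum_distrib_left flip: sum.distrib) (simp add: algebra_simps)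
    also have "\<dots> = complex_of_real ?N ^ 2 * (complex_of_real (\<alpha> / ?N) * ricci_form m G z x
        + complex_of_real \<beta> * hol_sec_curv G z x)"
      unfolding hol_sec_curv_def real[symmetric] using N by (simp add: field_simps power2_eq_square)
    finally show ?thesis using zero[OF False] by simp
  qed simp
  note pol = polarisation_tensor[of A, OF this]
  have gl: "(\<Sum>p\<in>UNIV. ?gi p q * G z $ p $ l) = (if q = l then 1 else 0)" for q l
    by (rule g_inv_left[of G z, OF inv])
  have n: "(\<Sum>i\<in>UNIV. \<Sum>j\<in>UNIV. ?gi i j * G z $ i $ j) = of_nat CARD('n)"
    by (subst sum.swap) (simp add: gl)
  define S1 where "S1 = (\<Sum>i\<in>UNIV. \<Sum>j\<in>UNIV. \<Sum>k\<in>UNIV. \<Sum>l\<in>UNIV. ?gi i j * ?gi k l * A i j k l)"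
  define S2 where "S2 = (\<Sum>i\<in>UNIV. \<Sum>j\<in>UNIV. \<Sum>k\<in>UNIV. \<Sum>l\<in>UNIV. ?gi i j * ?gi k l * A i l k j)"
  have "(\<Sum>i\<in>UNIV. \<Sum>j\<in>UNIV. \<Sum>k\<in>UNIV. \<Sum>l\<in>UNIV. ?gi i j * ?gi k l * A k j i l) = S2"
    unfolding S2_def by (subst (2) sum4_rotate) (simp add: mult_ac)
  moreover have "(\<Sum>i\<in>UNIV. \<Sum>j\<in>UNIV. \<Sum>k\<in>UNIV. \<Sum>l\<in>UNIV. ?gi i j * ?gi k l * A k l i j) = S1"
    unfolding S1_def by (subst (2) sum4_rotate) (simp add: mult_ac)
  moreover have "(\<Sum>i\<in>UNIV. \<Sum>j\<in>UNIV. \<Sum>k\<in>UNIV. \<Sum>l\<in>UNIV. ?gi i j * ?gi k l * (A i j k l + A k j i l + A i l k j + A k l i j)) = 0"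
    unfolding pol by simp
  ultimately have "2 * (S1 + S2) = 0"
    unfolding distrib_left sum.distrib S1_def[symmetric] S2_def[symmetric] by simp
  then have "S1 + S2 = 0" by (metis mult_eq_0_iff zero_neq_numeral)
  moreover have "S1 = complex_of_real \<alpha> * (of_nat CARD('n) * T) + complex_of_real \<beta> * chern_scalar G z"
  proof -
    have "S1 = complex_of_real \<alpha> * ((\<Sum>i\<in>UNIV. \<Sum>j\<in>UNIV. ?gi i j * G z $ i $ j) * T) + complex_of_real \<beta> * chern_scalar G z"
      unfolding S1_def A_def T_def chern_scalar_def sum22_product
      by (simp add: sum_distrib_left flip: sum.distrib) (simp add: algebra_simps)
    then show ?thesis by (simp add: n)
  qed
  moreover have "S2 = complex_of_real \<alpha> * T + complex_of_real \<beta> * chern_scalar' G z"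
  proof -
    have "(\<Sum>i\<in>UNIV. \<Sum>j\<in>UNIV. \<Sum>k\<in>UNIV. \<Sum>l\<in>UNIV. ?gi i j * ?gi k l * (G z $ i $ l * chern_ricci m G z k j))
       = (\<Sum>j\<in>UNIV. \<Sum>k\<in>UNIV. \<Sum>l\<in>UNIV. (\<Sum>i\<in>UNIV. ?gi i j * G z $ i $ l) * (?gi k l * chern_ricci m G z k j))"
    proof -
      have "(\<Sum>i\<in>UNIV. \<Sum>j\<in>UNIV. \<Sum>k\<in>UNIV. \<Sum>l\<in>UNIV. ?gi i j * ?gi k l * (G z $ i $ l * chern_ricci m G z k j))
         = (\<Sum>j\<in>UNIV. \<Sum>i\<in>UNIV. \<Sum>k\<in>UNIV. \<Sum>l\<in>UNIV. ?gi i j * ?gi k l * (G z $ i $ l * chern_ricci m G z k j))"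
        by (rule sum.swap)
      also have "\<dots> = (\<Sum>j\<in>UNIV. \<Sum>k\<in>UNIV. \<Sum>i\<in>UNIV. \<Sum>l\<in>UNIV. ?gi i j * ?gi k l * (G z $ i $ l * chern_ricci m G z k j))"
        by (intro sum.cong refl sum.swap)
      also have "\<dots> = (\<Sum>j\<in>UNIV. \<Sum>k\<in>UNIV. \<Sum>l\<in>UNIV. \<Sum>i\<in>UNIV. ?gi i j * ?gi k l * (G z $ i $ l * chern_ricci m G z k j))"
        by (intro sum.cong refl sum.swap)
      finally show ?thesis by (simp add: sum_distrib_left sum_distrib_right mult_ac)
    qed
    also have "\<dots> = (\<Sum>j\<in>UNIV. \<Sum>k\<in>UNIV. ?gi k j * chern_ricci m G z k j)"
      by (simp add: gl if_distrib[of "\<lambda>c. c * _"] cong: if_cong)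
    also have "\<dots> = T" unfolding T_def by (rule sum.swap)
    finally have t: "(\<Sum>i\<in>UNIV. \<Sum>j\<in>UNIV. \<Sum>k\<in>UNIV. \<Sum>l\<in>UNIV. ?gi i j * ?gi k l * (G z $ i $ l * chern_ricci m G z k j)) = T" .
    have "S2 = complex_of_real \<alpha> * (\<Sum>i\<in>UNIV. \<Sum>j\<in>UNIV. \<Sum>k\<in>UNIV. \<Sum>l\<in>UNIV. ?gi i j * ?gi k l * (G z $ i $ l * chern_ricci m G z k j))
        + complex_of_real \<beta> * chern_scalar' G z"
      unfolding S2_def A_def chern_scalar'_def
      by (simp add: sum_distrib_left flip: sum.distrib) (simp add: algebra_simps)
    then show ?thesis unfolding t .
  qed
  ultimately have "complex_of_real (\<alpha> * (real CARD('n) + 1)) * T + complex_of_real \<beta> * (chern_scalar G z + chern_scalar' G z) = 0"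
    by (simp add: algebra_simps)
  moreover have "\<alpha> * (real CARD('n) + 1) = - 2 * \<beta>" using \<alpha> by simp
  ultimately have "complex_of_real \<beta> * (chern_scalar G z + chern_scalar' G z - 2 * T) = 0"
    by (simp only:) (simp add: algebra_simps)
  then have "chern_scalar G z + chern_scalar' G z = 2 * T" using \<beta> by simp
  moreover have "T = chern_scalar G z \<or> T = chern_scalar' G z"
    using ricci_trace[OF m, of G z] by (auto simp: T_def)
  ultimately show ?thesis by auto
qed


section \<open>Determinant and cofactors of a local metric\<close>

lemma ck_det:
  fixes F :: "'a::real_normed_vector \<Rightarrow> complex^'n^'n"
  assumes "\<And>i j. ck_on m S (\<lambda>w. F w $ i $ j)" "open S"
  shows "ck_on m S (\<lambda>w. det (F w))"
  unfolding det_def by (intro ck_sum ck_mult ck_const ck_prod assms)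

text \<open>Jacobi's formula: row \<open>i\<close> of the derivative is \<open>\<Sum>\<^sub>k c\<^sub>k\<close> times row \<open>k\<close> of the matrix with
  coefficients \<open>c\<close> read off from the product with the inverse, and by Cramer's rule only \<open>c\<^sub>i\<close> survives
  when this row replaces row \<open>i\<close> in the determinant.\<close>

lemma has_derivative_det:
  fixes F :: "complex^'n \<Rightarrow> complex^'n^'n"
  assumes D: "\<And>i j. ((\<lambda>w. F w $ i $ j) has_derivative (\<lambda>v. F' v i j)) (at z)"
    and inv: "invertible (F z)"
  shows "((\<lambda>w. det (F w)) has_derivative (\<lambda>v. det (F z) * (\<Sum>i\<in>UNIV. \<Sum>j\<in>UNIV. g_inv F z i j * F' v i j))) (at z)"
proof -
  let ?P = "{p. p permutes (UNIV :: 'n set)}"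
  have rows: "(\<Sum>p\<in>?P. of_int (sign p) * (F' v i (p i) * (\<Prod>k\<in>UNIV-{i}. F z $ k $ p k))) =
      (\<Sum>j\<in>UNIV. g_inv F z i j * F' v i j) * det (F z)" for v i
  proof -
    define c where "c = (\<chi> k. \<Sum>j\<in>UNIV. F' v i j * matrix_inv (F z) $ j $ k)"
    have "(\<Sum>k\<in>UNIV. c $ k *s row k (F z)) = (\<chi> j. F' v i j)"
    proof -
      have "(\<Sum>k\<in>UNIV. c $ k * F z $ k $ j) = F' v i j" for j
      proof -
        have "(\<Sum>k\<in>UNIV. c $ k * F z $ k $ j) = (\<Sum>l\<in>UNIV. F' v i l * (matrix_inv (F z) ** F z) $ l $ j)"
          unfolding c_def matrix_matrix_mult_def by (simp add: sum_distrib_left sum_distrib_right mult.assoc) (rule sum.swap)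
        then show ?thesis by (simp add: matrix_inv_inverse[OF inv] mat_def if_distrib[of "\<lambda>c. _ * c"] cong: if_cong)
      qed
      then show ?thesis by (simp add: vec_eq_iff row_def)
    qed
    from cramer_lemma_transpose[of i c "F z", unfolded this]
    have "det (\<chi> k. if k = i then (\<chi> j. F' v i j) else row k (F z)) = c $ i * det (F z)" .
    also have "c $ i = (\<Sum>j\<in>UNIV. g_inv F z i j * F' v i j)"
      by (simp add: c_def g_inv_def mult.commute)
    finally have d: "det (\<chi> k. if k = i then (\<chi> j. F' v i j) else row k (F z)) = (\<Sum>j\<in>UNIV. g_inv F z i j * F' v i j) * det (F z)" .
    have "(\<Sum>p\<in>?P. of_int (sign p) * (F' v i (p i) * (\<Prod>k\<in>UNIV-{i}. F z $ k $ p k))) =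
       det (\<chi> k. if k = i then (\<chi> j. F' v i j) else row k (F z))"
      unfolding det_def
    proof (intro sum.cong refl)
      fix p
      show "of_int (sign p) * (F' v i (p i) * (\<Prod>k\<in>UNIV-{i}. F z $ k $ p k)) =
        of_int (sign p) * (\<Prod>k\<in>UNIV. (\<chi> k. if k = i then (\<chi> j. F' v i j) else row k (F z)) $ k $ p k)"
        by (subst (2) prod.remove[of _ i]) (auto simp: row_def intro!: prod.cong)
    qed
    then show ?thesis using d by simp
  qed
  have "((\<lambda>w. det (F w)) has_derivative (\<lambda>v. \<Sum>p\<in>?P. of_int (sign p) *
      (\<Sum>i\<in>UNIV. F' v i (p i) * (\<Prod>k\<in>UNIV-{i}. F z $ k $ p k)))) (at z)"
    unfolding det_def by (intro has_derivative_sum has_derivative_mult_right has_derivative_prod D)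
  moreover have "(\<Sum>p\<in>?P. of_int (sign p) * (\<Sum>i\<in>UNIV. F' v i (p i) * (\<Prod>k\<in>UNIV-{i}. F z $ k $ p k)))
      = det (F z) * (\<Sum>i\<in>UNIV. \<Sum>j\<in>UNIV. g_inv F z i j * F' v i j)" for v
    unfolding sum_distrib_left[of "of_int _"] by (subst sum.swap) (simp add: rows sum_distrib_left mult.commute)
  ultimately show ?thesis by simp
qed

lemma g_inv_cramer:
  assumes "det (G z) \<noteq> 0"
  shows "g_inv G z p q = det (\<chi> a b. if b = q then axis p 1 $ a else G z $ a $ b) / det (G z)"
proof -
  have inv: "invertible (G z)" using assms by (simp add: invertible_det_nz)
  have Gx: "G z *v (\<chi> q. g_inv G z p q) = axis p 1"
    unfolding vec_eq_iff matrix_vector_mult_def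
    using g_inv_right[of G z, OF inv, of p] by (auto simp: axis_def mult.commute)
  then show ?thesis using cramer_lemma[of q "G z" "\<chi> q. g_inv G z p q"] assms unfolding Gx by (simp add: field_simps)
qed

lemma ck_g_inv:
  assumes "\<And>i j. ck_on m S (\<lambda>w. G w $ i $ j)" "open S" "\<And>w. w \<in> S \<Longrightarrow> det (G w) \<noteq> 0"
  shows "ck_on m S (\<lambda>w. g_inv G w p q)"
proof (rule ck_cong[OF \<open>open S\<close>])
  have "ck_on m S (\<lambda>w. if b = q then axis p 1 $ a else G w $ a $ b)" for a b
    by (cases "b = q") (auto simp: ck_const assms)
  then show "ck_on m S (\<lambda>w. det (\<chi> a b. if b = q then axis p 1 $ a else G w $ a $ b) / det (G w))"
    using assms by (intro ck_divide ck_det) auto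
qed (simp add: g_inv_cramer assms)

locale hermitian_field =
  fixes S :: "(complex^'n::finite) set" and G :: "complex^'n \<Rightarrow> complex^'n^'n"
  assumes open_S: "open S"
    and smooth: "\<And>m i j. ck_on m S (\<lambda>w. G w $ i $ j)"
    and hermitian: "\<And>w i j. w \<in> S \<Longrightarrow> G w $ j $ i = cnj (G w $ i $ j)"
    and positive: "\<And>w x. w \<in> S \<Longrightarrow> x \<noteq> 0 \<Longrightarrow> norm2_g G w x > 0"
begin

lemma norm2_complex:
  assumes "w \<in> S"
  shows "complex_of_real (norm2_g G w x) = (\<Sum>i\<in>UNIV. \<Sum>j\<in>UNIV. G w $ i $ j * x$i * cnj (x$j))"
proof -
  let ?N = "\<Sum>i\<in>UNIV. \<Sum>j\<in>UNIV. G w $ i $ j * x$i * cnj (x$j)"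
  have "cnj ?N = (\<Sum>i\<in>UNIV. \<Sum>j\<in>UNIV. G w $ j $ i * x$j * cnj (x$i))"
    by (simp add: hermitian[OF assms, symmetric] mult_ac)
  also have "\<dots> = ?N" by (rule sum.swap)
  finally have "cnj ?N = ?N" .
  moreover have "complex_of_real (Re c) = c" if "cnj c = c" for c using that by (simp add: complex_eq_iff)
  ultimately show ?thesis unfolding norm2_g_def by blast
qed

lemma matrix_pos_det:
  fixes B :: "complex^'n^'n"
  assumes "\<And>x. x \<noteq> 0 \<Longrightarrow> (\<Sum>i\<in>UNIV. \<Sum>j\<in>UNIV. B $ i $ j * x$i * cnj (x$j)) \<noteq> 0"
  shows "det B \<noteq> 0"
proof -
  have "x = 0" if "transpose B *v x = 0" for x
  proof (rule ccontr)
    assume "x \<noteq> 0"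
    have "(\<Sum>i\<in>UNIV. \<Sum>j\<in>UNIV. B $ i $ j * x$i * cnj (x$j)) = (\<Sum>j\<in>UNIV. (transpose B *v x) $ j * cnj (x$j))"
      by (subst sum.swap) (simp add: transpose_def matrix_vector_mult_def sum_distrib_right)
    then show False using that assms[OF \<open>x \<noteq> 0\<close>] by simp
  qed
  then have "invertible (transpose B)"
    by (simp add: invertible_left_inverse matrix_left_invertible_ker)
  then show ?thesis by (simp add: invertible_det_nz)
qed

lemma det_nonzero:
  assumes w: "w \<in> S"
  shows "det (G w) \<noteq> 0"
proof (rule matrix_pos_det)
  fix x :: "complex^'n" assume x: "x \<noteq> 0"
  show "(\<Sum>i\<in>UNIV. \<Sum>j\<in>UNIV. G w $ i $ j * x$i * cnj (x$j)) \<noteq> 0"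
    unfolding norm2_complex[OF w, symmetric] using positive[OF w x] by simp
qed

lemma invertible: "w \<in> S \<Longrightarrow> invertible (G w)"
  using det_nonzero by (simp add: invertible_det_nz)

lemma det_cnj: "cnj (det B) = det (\<chi> i j. cnj (B $ i $ j))" for B :: "complex^'n^'n"
  by (simp add: det_def)

text \<open>The segment from the identity matrix to the metric stays inside the positive definite matrices,
  so the real number \<open>det\<close> does not change sign along it.\<close>

lemma det_pos:
  assumes w: "w \<in> S"
  shows "Re (det (G w)) > 0" "Im (det (G w)) = 0"
proof -
  define B where "B t = (\<chi> i j. complex_of_real (1 - t) * (if i = j then 1 else 0) + complex_of_real t * G w $ i $ j)" for t :: real
  have im: "Im (det (B t)) = 0" for t
  proof -
    have "(\<chi> i j. cnj (B t $ i $ j)) = transpose (B t)"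
      by (auto simp: B_def transpose_def vec_eq_iff hermitian[OF w, symmetric])
    then have "cnj (det (B t)) = det (B t)" by (simp add: det_cnj det_transpose)
    then show ?thesis by (simp add: complex_eq_iff)
  qed
  have nz: "det (B t) \<noteq> 0" if t: "0 \<le> t" "t \<le> 1" for t
  proof (rule matrix_pos_det)
    fix x :: "complex^'n" assume x: "x \<noteq> 0"
    obtain a where a: "x $ a \<noteq> 0" using x by (auto simp: vec_eq_iff)
    have "(\<Sum>i\<in>UNIV. \<Sum>j\<in>UNIV. B t $ i $ j * x$i * cnj (x$j)) =
        complex_of_real (1-t) * (\<Sum>i\<in>UNIV. \<Sum>j\<in>UNIV. (if i = j then 1 else 0) * x$i * cnj (x$j))
        + complex_of_real t * (\<Sum>i\<in>UNIV. \<Sum>j\<in>UNIV. G w $ i $ j * x$i * cnj (x$j))"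
      unfolding B_def by (simp add: sum_distrib_left flip: sum.distrib) (simp add: algebra_simps)
    also have "(\<Sum>i\<in>UNIV. \<Sum>j\<in>UNIV. (if i = j then 1 else 0) * x$i * cnj (x$j)) = (\<Sum>i\<in>UNIV. complex_of_real ((cmod (x$i))^2))"
      unfolding complex_norm_square by (simp add: if_distrib[of "\<lambda>c. c * _"] cong: if_cong)
    also have "complex_of_real (1-t) * \<dots> + complex_of_real t * (\<Sum>i\<in>UNIV. \<Sum>j\<in>UNIV. G w $ i $ j * x$i * cnj (x$j))
        = complex_of_real ((1 - t) * (\<Sum>i\<in>UNIV. (cmod (x$i))^2) + t * norm2_g G w x)"
      unfolding norm2_complex[OF w, symmetric] by simp
    finally have e: "(\<Sum>i\<in>UNIV. \<Sum>j\<in>UNIV. B t $ i $ j * x$i * cnj (x$j)) =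
        complex_of_real ((1 - t) * (\<Sum>i\<in>UNIV. (cmod (x$i))^2) + t * norm2_g G w x)" .
    have p: "(\<Sum>i\<in>UNIV. (cmod (x$i))^2) > 0"
      using a by (intro sum_pos2[of _ a]) auto
    have "(1 - t) * (\<Sum>i\<in>UNIV. (cmod (x$i))^2) + t * norm2_g G w x > 0"
    proof (cases "t = 0")
      case False
      then show ?thesis using t p positive[OF w x] by (intro add_nonneg_pos mult_nonneg_nonneg) auto
    qed (use p in simp)
    then show "(\<Sum>i\<in>UNIV. \<Sum>j\<in>UNIV. B t $ i $ j * x$i * cnj (x$j)) \<noteq> 0" unfolding e of_real_eq_0_iff by linarith
  qed
  have cont: "continuous_on {0..1} (\<lambda>t. Re (det (B t)))"
    unfolding det_def B_def by (auto intro!: continuous_intros)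
  have B0: "B 0 = mat 1" and B1: "B 1 = G w" by (auto simp: B_def mat_def vec_eq_iff)
  have "Re (det (B 1)) > 0"
  proof (rule ccontr)
    assume "\<not> Re (det (B 1)) > 0"
    then obtain t where "0 \<le> t" "t \<le> 1" "Re (det (B t)) = 0"
      using IVT2'[of "\<lambda>t. Re (det (B t))" 1 0 0] cont by (auto simp: B0 det_I)
    then show False using nz[of t] im[of t] by (simp add: complex_eq_iff)
  qed
  then show "Re (det (G w)) > 0" "Im (det (G w)) = 0" using im[of 1] by (simp_all add: B1)
qed

end

section \<open>The torsion trace and the double divergence of the cofactors\<close>

context hermitian_field
begin

lemma smooth_det: "ck_on m S (\<lambda>w. det (G w))"
  by (intro ck_det smooth open_S)

lemma smooth_g_inv: "ck_on m S (\<lambda>w. g_inv G w p q)"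
  by (intro ck_g_inv smooth open_S det_nonzero)

lemma smooth_d: "ck_on m S (d_dz a (\<lambda>w. G w $ i $ j))" "ck_on m S (d_dzbar a (\<lambda>w. G w $ i $ j))"
  using ck_wirtinger[OF smooth open_S] by auto

lemma smooth_imp_diff: "(\<And>m. ck_on m S f) \<Longrightarrow> w \<in> S \<Longrightarrow> f differentiable (at w)"
  using ck_differentiable[of 1 S f w] by simp

lemma gi_left: "w \<in> S \<Longrightarrow> (\<Sum>p\<in>UNIV. g_inv G w p q * G w $ p $ l) = (if q = l then 1 else 0)"
  by (rule g_inv_left[of G w, OF invertible])

lemma gi_right: "w \<in> S \<Longrightarrow> (\<Sum>q\<in>UNIV. g_inv G w p q * G w $ k $ q) = (if p = k then 1 else 0)"
  by (rule g_inv_right[of G w, OF invertible])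

lemma delta_sum: "(\<Sum>q\<in>UNIV. f q * (if q = a then 1 else 0)) = f a" "(\<Sum>q\<in>UNIV. f q * (if a = q then 1 else 0)) = f a"
  for f :: "'n \<Rightarrow> complex"
  by (simp_all add: if_distrib cong: if_cong)

lemma g_inv_cnj:
  assumes w: "w \<in> S"
  shows "cnj (g_inv G w p q) = g_inv G w q p"
proof -
  have gl: "(\<Sum>p\<in>UNIV. cnj (g_inv G w p q) * G w $ l $ p) = (if q = l then 1 else 0)" for q l
    using arg_cong[OF gi_left[OF w, of q l], of cnj] by (simp add: hermitian[OF w, symmetric])
  have "cnj (g_inv G w p q) = (\<Sum>r\<in>UNIV. cnj (g_inv G w r q) * (\<Sum>k\<in>UNIV. g_inv G w k p * G w $ k $ r))"
    by (simp add: gi_left[OF w] delta_sum)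
  also have "\<dots> = (\<Sum>k\<in>UNIV. g_inv G w k p * (\<Sum>r\<in>UNIV. cnj (g_inv G w r q) * G w $ k $ r))"
    unfolding sum_distrib_left by (subst sum.swap) (simp add: mult_ac)
  also have "\<dots> = g_inv G w q p" by (simp add: gl delta_sum)
  finally show ?thesis .
qed

text \<open>Differentiate the identity \<open>\<Sum>\<^sub>r g\<^sup>p\<^sup>r g\<^sub>k\<^sub>r = \<delta>\<^sub>p\<^sub>k\<close>.\<close>

lemma has_derivative_g_inv:
  assumes w: "w \<in> S"
  shows "((\<lambda>w. g_inv G w p q) has_derivative (\<lambda>v. - (\<Sum>k\<in>UNIV. \<Sum>l\<in>UNIV.
      g_inv G w p l * frechet_derivative (\<lambda>w. G w $ k $ l) (at w) v * g_inv G w k q))) (at w)"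
proof -
  define \<gamma> where "\<gamma> r = frechet_derivative (\<lambda>w. g_inv G w p r) (at w)" for r
  define F where "F k l = frechet_derivative (\<lambda>w. G w $ k $ l) (at w)" for k l
  have D\<gamma>: "((\<lambda>w. g_inv G w p r) has_derivative \<gamma> r) (at w)" for r
    using smooth_imp_diff[OF smooth_g_inv w] frechet_derivative_works unfolding \<gamma>_def by blast
  have DF: "((\<lambda>w. G w $ k $ l) has_derivative F k l) (at w)" for k l
    using smooth_imp_diff[OF smooth w] frechet_derivative_works unfolding F_def by blast
  have z: "(\<Sum>r\<in>UNIV. \<gamma> r v * G w $ k $ r) = - (\<Sum>r\<in>UNIV. g_inv G w p r * F k r v)" for k v
  proof -
    have "((\<lambda>w. \<Sum>r\<in>UNIV. g_inv G w p r * G w $ k $ r) has_derivative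
        (\<lambda>v. \<Sum>r\<in>UNIV. g_inv G w p r * F k r v + \<gamma> r v * G w $ k $ r)) (at w)"
      by (intro has_derivative_sum has_derivative_mult D\<gamma> DF)
    moreover have "((\<lambda>w. \<Sum>r\<in>UNIV. g_inv G w p r * G w $ k $ r) has_derivative (\<lambda>v. 0)) (at w)"
      by (rule has_derivative_transform_within_open[OF has_derivative_const open_S w])
         (simp add: gi_right)
    ultimately have "(\<lambda>v. \<Sum>r\<in>UNIV. g_inv G w p r * F k r v + \<gamma> r v * G w $ k $ r) = (\<lambda>v. 0)"
      by (rule has_derivative_unique)
    from fun_cong[OF this, of v] show ?thesis
      by (simp add: sum.distrib eq_neg_iff_add_eq_0 add.commute)
  qed
  have "\<gamma> q v = - (\<Sum>k\<in>UNIV. \<Sum>l\<in>UNIV. g_inv G w p l * F k l v * g_inv G w k q)" for v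
  proof -
    have "\<gamma> q v = (\<Sum>r\<in>UNIV. \<gamma> r v * (\<Sum>k\<in>UNIV. g_inv G w k q * G w $ k $ r))"
      by (simp add: gi_left[OF w] delta_sum)
    also have "\<dots> = (\<Sum>k\<in>UNIV. (\<Sum>r\<in>UNIV. \<gamma> r v * G w $ k $ r) * g_inv G w k q)"
      unfolding sum_distrib_left sum_distrib_right by (subst sum.swap) (simp add: mult_ac)
    also have "\<dots> = - (\<Sum>k\<in>UNIV. \<Sum>l\<in>UNIV. g_inv G w p l * F k l v * g_inv G w k q)"
      unfolding z by (simp add: sum_distrib_right sum_negf)
    finally show ?thesis .
  qed
  then have "\<gamma> q = (\<lambda>v. - (\<Sum>k\<in>UNIV. \<Sum>l\<in>UNIV. g_inv G w p l * F k l v * g_inv G w k q))" by (rule ext)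
  with D\<gamma>[of q] show ?thesis unfolding F_def by simp
qed

lemma wirtinger_g_inv:
  assumes w: "w \<in> S"
  shows "d_dz a (\<lambda>w. g_inv G w p q) w =
      - (\<Sum>k\<in>UNIV. \<Sum>l\<in>UNIV. g_inv G w p l * d_dz a (\<lambda>w. G w $ k $ l) w * g_inv G w k q)"
    and "d_dzbar a (\<lambda>w. g_inv G w p q) w =
      - (\<Sum>k\<in>UNIV. \<Sum>l\<in>UNIV. g_inv G w p l * d_dzbar a (\<lambda>w. G w $ k $ l) w * g_inv G w k q)"
  unfolding d_dz_eqI[OF has_derivative_g_inv[OF w]] d_dzbar_eqI[OF has_derivative_g_inv[OF w]]
  unfolding d_dz_def d_dzbar_def
  by (simp_all add: sum_distrib_left sum_divide_distrib flip: sum_subtractf sum.distrib sum_negf)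
     (intro sum.cong refl, simp add: field_simps)+

lemma wirtinger_det:
  assumes w: "w \<in> S"
  shows "d_dzbar a (\<lambda>w. det (G w)) w = det (G w) * (\<Sum>k\<in>UNIV. \<Sum>l\<in>UNIV. g_inv G w k l * d_dzbar a (\<lambda>w. G w $ k $ l) w)"
proof -
  have D: "((\<lambda>w. det (G w)) has_derivative (\<lambda>v. det (G w) * (\<Sum>k\<in>UNIV. \<Sum>l\<in>UNIV.
      g_inv G w k l * frechet_derivative (\<lambda>w. G w $ k $ l) (at w) v))) (at w)"
    by (rule has_derivative_det[of G "\<lambda>v k l. frechet_derivative (\<lambda>w. G w $ k $ l) (at w) v" w])
       (use smooth_imp_diff[OF smooth w] frechet_derivative_works invertible[OF w] in blast)+
  show ?thesis
    unfolding d_dzbar_eqI[OF D] unfolding d_dzbar_def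
    by (simp add: sum_distrib_left sum_divide_distrib flip: sum.distrib) (simp add: field_simps)
qed

text \<open>The inverse metric times the volume density. Its divergence in the barred index is, up to the
  density, the trace of the torsion with one index raised.\<close>

definition cofactor :: "'n \<Rightarrow> 'n \<Rightarrow> complex^'n \<Rightarrow> complex" where
  "cofactor i j w = det (G w) * g_inv G w i j"

text \<open>The conjugate of the torsion form \<open>\<eta>\<close>. The conjugate is the convenient one because the derivatives in \<open>chern_R\<close>
  are taken in the order \<open>d_dz i (d_dzbar j _)\<close>, the order that occurs when \<open>d_dz i\<close> is applied to it.\<close>

definition torsion_trace :: "'n \<Rightarrow> complex^'n \<Rightarrow> complex" where
  "torsion_trace j w = (\<Sum>k\<in>UNIV. \<Sum>l\<in>UNIV. g_inv G w k l *
     (d_dzbar j (\<lambda>w. G w $ k $ l) w - d_dzbar l (\<lambda>w. G w $ k $ j) w))"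

definition cofactor_div :: "'n \<Rightarrow> complex^'n \<Rightarrow> complex" where
  "cofactor_div i w = (\<Sum>j\<in>UNIV. d_dzbar j (cofactor i j) w)"

lemma smooth_cofactor: "ck_on m S (cofactor i j)"
  unfolding cofactor_def [abs_def] by (intro ck_mult smooth_det smooth_g_inv open_S)

lemma smooth_torsion_trace: "ck_on m S (torsion_trace j)"
  unfolding torsion_trace_def [abs_def] by (intro ck_sum ck_mult ck_diff smooth_g_inv smooth_d open_S)

lemma smooth_cofactor_div: "ck_on m S (cofactor_div i)"
  unfolding cofactor_div_def [abs_def] by (intro ck_sum ck_wirtinger smooth_cofactor open_S)

lemma cofactor_cnj: "w \<in> S \<Longrightarrow> cnj (cofactor i j w) = cofactor j i w"
  using det_pos(2) by (simp add: cofactor_def g_inv_cnj complex_eq_iff)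

text \<open>The derivative of the determinant gives the first term of the torsion trace and the derivative of the inverse the second.\<close>

lemma cofactor_div_eq:
  assumes w: "w \<in> S"
  shows "cofactor_div i w = (\<Sum>j\<in>UNIV. cofactor i j w * torsion_trace j w)"
proof -
  let ?gi = "g_inv G w" and ?d = "\<lambda>a k l. d_dzbar a (\<lambda>w. G w $ k $ l) w"
  have "d_dzbar j (cofactor i j) w = det (G w) * (?gi i j * (\<Sum>k\<in>UNIV. \<Sum>l\<in>UNIV. ?gi k l * ?d j k l)
      - (\<Sum>k\<in>UNIV. \<Sum>l\<in>UNIV. ?gi i l * ?d j k l * ?gi k j))" for j
    unfolding cofactor_def [abs_def]
    by (subst wirtinger_mult(2)) (auto simp: smooth_imp_diff[OF smooth_det w] smooth_imp_diff[OF smooth_g_inv w]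
         wirtinger_det[OF w] wirtinger_g_inv[OF w] algebra_simps)
  then have "cofactor_div i w = det (G w) * ((\<Sum>j\<in>UNIV. ?gi i j * (\<Sum>k\<in>UNIV. \<Sum>l\<in>UNIV. ?gi k l * ?d j k l))
      - (\<Sum>j\<in>UNIV. \<Sum>k\<in>UNIV. \<Sum>l\<in>UNIV. ?gi i l * ?d j k l * ?gi k j))"
    unfolding cofactor_div_def by (simp add: sum_subtractf flip: sum_distrib_left)
  also have "(\<Sum>j\<in>UNIV. \<Sum>k\<in>UNIV. \<Sum>l\<in>UNIV. ?gi i l * ?d j k l * ?gi k j) =
      (\<Sum>l\<in>UNIV. \<Sum>k\<in>UNIV. \<Sum>j\<in>UNIV. ?gi i l * ?d j k l * ?gi k j)"
  proof -
    have "(\<Sum>j\<in>UNIV. \<Sum>k\<in>UNIV. \<Sum>l\<in>UNIV. ?gi i l * ?d j k l * ?gi k j) =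
      (\<Sum>j\<in>UNIV. \<Sum>l\<in>UNIV. \<Sum>k\<in>UNIV. ?gi i l * ?d j k l * ?gi k j)" by (intro sum.cong refl sum.swap)
    also have "\<dots> = (\<Sum>l\<in>UNIV. \<Sum>j\<in>UNIV. \<Sum>k\<in>UNIV. ?gi i l * ?d j k l * ?gi k j)" by (rule sum.swap)
    also have "\<dots> = (\<Sum>l\<in>UNIV. \<Sum>k\<in>UNIV. \<Sum>j\<in>UNIV. ?gi i l * ?d j k l * ?gi k j)" by (intro sum.cong refl sum.swap)
    finally show ?thesis .
  qed
  finally show ?thesis
    unfolding cofactor_def torsion_trace_def
    by (simp add: sum_distrib_left right_diff_distrib sum_subtractf mult_ac)
qed

lemma torsion_trace_eq:
  assumes w: "w \<in> S"
  shows "det (G w) * torsion_trace m w = (\<Sum>i\<in>UNIV. G w $ i $ m * cofactor_div i w)"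
proof -
  have "(\<Sum>i\<in>UNIV. G w $ i $ m * cofactor_div i w) =
      (\<Sum>j\<in>UNIV. det (G w) * torsion_trace j w * (\<Sum>i\<in>UNIV. g_inv G w i j * G w $ i $ m))"
    unfolding cofactor_div_eq[OF w] cofactor_def sum_distrib_left by (subst sum.swap) (simp add: mult_ac)
  then show ?thesis by (simp add: gi_left[OF w] delta_sum)
qed

text \<open>Already \<open>d_dz i\<close> of the torsion trace is, without the outer trace, a difference of contractions of \<open>R\<close>: the second
  derivatives of the metric match term by term, and the derivative of the inverse metric produces the quadratic terms.\<close>

lemma trace_derivative_torsion_trace:
  assumes w: "w \<in> S"
  shows "(\<Sum>i\<in>UNIV. \<Sum>j\<in>UNIV. g_inv G w i j * d_dz i (torsion_trace j) w) = chern_scalar' G w - chern_scalar G w"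
proof -
  let ?gi = "g_inv G w" and ?d = "\<lambda>a k l. d_dz a (\<lambda>w. G w $ k $ l) w" and ?db = "\<lambda>a k l. d_dzbar a (\<lambda>w. G w $ k $ l) w"
  let ?T = "\<lambda>j k l w. d_dzbar j (\<lambda>w. G w $ k $ l) w - d_dzbar l (\<lambda>w. G w $ k $ j) w"
  have dT: "?T j k l differentiable (at w)" for j k l
    using smooth_imp_diff[OF ck_diff[OF smooth_d(2) smooth_d(2) open_S] w] .
  have dg: "(\<lambda>w. g_inv G w k l) differentiable (at w)" for k l using smooth_imp_diff[OF smooth_g_inv w] .
  have d2: "d_dz i (?T j k l) w = d_dz i (d_dzbar j (\<lambda>w. G w $ k $ l)) w - d_dz i (d_dzbar l (\<lambda>w. G w $ k $ j)) w" for i j k l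
    by (rule wirtinger_diff) (intro smooth_imp_diff[OF smooth_d(2) w])+
  have "d_dz i (torsion_trace j) w = (\<Sum>k\<in>UNIV. \<Sum>l\<in>UNIV. ?gi k l * (chern_R G w i l k j - chern_R G w i j k l))" for i j
  proof -
    have "d_dz i (torsion_trace j) w = (\<Sum>k\<in>UNIV. \<Sum>l\<in>UNIV. d_dz i (\<lambda>w. g_inv G w k l * ?T j k l w) w)"
      unfolding torsion_trace_def [abs_def]
      by (simp add: wirtinger_sum(1) differentiable_sum differentiable_mult[OF dg dT])
    also have "\<dots> = (\<Sum>k\<in>UNIV. \<Sum>l\<in>UNIV. d_dz i (\<lambda>w. g_inv G w k l) w * ?T j k l w)
        + (\<Sum>k\<in>UNIV. \<Sum>l\<in>UNIV. ?gi k l * d_dz i (?T j k l) w)"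
      by (simp add: wirtinger_mult(1)[OF dg dT] sum.distrib)
    also have "(\<Sum>k\<in>UNIV. \<Sum>l\<in>UNIV. d_dz i (\<lambda>w. g_inv G w k l) w * ?T j k l w) =
        - (\<Sum>k\<in>UNIV. \<Sum>l\<in>UNIV. \<Sum>p\<in>UNIV. \<Sum>q\<in>UNIV. ?gi k q * ?d i p q * ?gi p l * ?T j k l w)"
      unfolding wirtinger_g_inv[OF w] by (simp add: sum_distrib_right sum_negf)
    also have "(\<Sum>k\<in>UNIV. \<Sum>l\<in>UNIV. \<Sum>p\<in>UNIV. \<Sum>q\<in>UNIV. ?gi k q * ?d i p q * ?gi p l * ?T j k l w) =
        (\<Sum>p\<in>UNIV. \<Sum>l\<in>UNIV. \<Sum>k\<in>UNIV. \<Sum>q\<in>UNIV. ?gi k q * ?d i p q * ?gi p l * ?T j k l w)"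
    proof -
      have "(\<Sum>k\<in>UNIV. \<Sum>l\<in>UNIV. \<Sum>p\<in>UNIV. \<Sum>q\<in>UNIV. ?gi k q * ?d i p q * ?gi p l * ?T j k l w) =
        (\<Sum>k\<in>UNIV. \<Sum>p\<in>UNIV. \<Sum>l\<in>UNIV. \<Sum>q\<in>UNIV. ?gi k q * ?d i p q * ?gi p l * ?T j k l w)" by (intro sum.cong refl sum.swap)
      also have "\<dots> = (\<Sum>p\<in>UNIV. \<Sum>k\<in>UNIV. \<Sum>l\<in>UNIV. \<Sum>q\<in>UNIV. ?gi k q * ?d i p q * ?gi p l * ?T j k l w)" by (rule sum.swap)
      also have "\<dots> = (\<Sum>p\<in>UNIV. \<Sum>l\<in>UNIV. \<Sum>k\<in>UNIV. \<Sum>q\<in>UNIV. ?gi k q * ?d i p q * ?gi p l * ?T j k l w)" by (intro sum.cong refl sum.swap)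
      finally show ?thesis .
    qed
    also have "- \<dots> + (\<Sum>k\<in>UNIV. \<Sum>l\<in>UNIV. ?gi k l * d_dz i (?T j k l) w) =
      (\<Sum>k\<in>UNIV. \<Sum>l\<in>UNIV. ?gi k l * (chern_R G w i l k j - chern_R G w i j k l))"
    proof -
      have "chern_R G w i l k j - chern_R G w i j k l = d_dz i (?T j k l) w
          - (\<Sum>p\<in>UNIV. \<Sum>q\<in>UNIV. ?gi p q * ?d i k q * ?T j p l w)" for k l
        unfolding chern_R_def d2 by (simp add: right_diff_distrib sum_subtractf)
      then show ?thesis
        by (simp add: right_diff_distrib sum_subtractf sum_distrib_left mult_ac)
    qed
    finally show ?thesis .
  qed
  then show ?thesis
    unfolding chern_scalar_def chern_scalar'_def
    by (simp add: sum_distrib_left right_diff_distrib sum_subtractf mult.assoc)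
qed

text \<open>If the two scalar curvatures agree then the double divergence of the cofactors is a nonnegative
  multiple of the squared norm of the torsion trace.\<close>

theorem double_divergence:
  assumes eq: "chern_scalar G w = chern_scalar' G w" and w: "w \<in> S"
  shows "(\<Sum>i\<in>UNIV. d_dz i (cofactor_div i) w) =
    complex_of_real (norm2_g G w (\<chi> i. cofactor_div i w) / Re (det (G w)))"
proof -
  have dc: "cofactor i j differentiable (at w)" and dt: "torsion_trace j differentiable (at w)" for i j
    using smooth_imp_diff[OF smooth_cofactor w] smooth_imp_diff[OF smooth_torsion_trace w] .
  have "(\<Sum>i\<in>UNIV. d_dz i (cofactor_div i) w) = (\<Sum>i\<in>UNIV. d_dz i (\<lambda>w. \<Sum>j\<in>UNIV. cofactor i j w * torsion_trace j w) w)"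
    by (intro sum.cong refl wirtinger_cong(1)[OF open_S w] cofactor_div_eq)
  also have "\<dots> = (\<Sum>i\<in>UNIV. \<Sum>j\<in>UNIV. d_dz i (cofactor i j) w * torsion_trace j w)
      + (\<Sum>i\<in>UNIV. \<Sum>j\<in>UNIV. cofactor i j w * d_dz i (torsion_trace j) w)"
    by (simp add: wirtinger_sum differentiable_mult[OF dc dt] wirtinger_mult[OF dc dt] sum.distrib)
  also have "(\<Sum>i\<in>UNIV. \<Sum>j\<in>UNIV. cofactor i j w * d_dz i (torsion_trace j) w) = 0"
    using trace_derivative_torsion_trace[OF w] eq
    by (simp add: cofactor_def mult.assoc flip: sum_distrib_left)
  also have "(\<Sum>i\<in>UNIV. \<Sum>j\<in>UNIV. d_dz i (cofactor i j) w * torsion_trace j w) = (\<Sum>j\<in>UNIV. cnj (cofactor_div j w) * torsion_trace j w)"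
  proof -
    have "d_dz i (cofactor i j) w = cnj (d_dzbar i (cofactor j i) w)" for i j
    proof -
      have "d_dz i (cofactor i j) w = d_dz i (\<lambda>w. cnj (cofactor j i w)) w"
        by (rule wirtinger_cong(1)[OF open_S w]) (simp add: cofactor_cnj)
      then show ?thesis by (simp add: wirtinger_cnj dc)
    qed
    then show ?thesis by (subst sum.swap) (simp add: cofactor_div_def sum_distrib_right)
  qed
  also have "\<dots> = (\<Sum>j\<in>UNIV. cnj (cofactor_div j w) * ((\<Sum>i\<in>UNIV. G w $ i $ j * cofactor_div i w) / det (G w)))"
    unfolding torsion_trace_eq[OF w, symmetric] using det_nonzero[OF w] by simp
  also have "\<dots> = (\<Sum>i\<in>UNIV. \<Sum>j\<in>UNIV. G w $ i $ j * cofactor_div i w * cnj (cofactor_div j w)) / det (G w)"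
    by (subst sum.swap) (simp add: sum_divide_distrib sum_distrib_left mult_ac)
  also have "\<dots> = complex_of_real (norm2_g G w (\<chi> i. cofactor_div i w)) / det (G w)"
    unfolding norm2_complex[OF w] by simp
  also have "det (G w) = complex_of_real (Re (det (G w)))"
    using det_pos(2)[OF w] by (simp add: complex_eq_iff)
  finally show ?thesis by simp
qed

lemma cofactor_div_zero_imp:
  assumes w: "w \<in> S" and z: "\<And>i. cofactor_div i w = 0"
  shows "(\<Sum>i\<in>UNIV. \<Sum>j\<in>UNIV. g_inv G w i j * (d_dzbar k (\<lambda>w. G w $ i $ j) w - d_dzbar j (\<lambda>w. G w $ i $ k) w)) = 0"
    and "(\<Sum>i\<in>UNIV. \<Sum>j\<in>UNIV. g_inv G w i j * (d_dz k (\<lambda>w. G w $ i $ j) w - d_dz i (\<lambda>w. G w $ k $ j) w)) = 0"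
proof -
  have t: "torsion_trace k w = 0"
    using torsion_trace_eq[OF w, of k] det_nonzero[OF w] z by simp
  then show "(\<Sum>i\<in>UNIV. \<Sum>j\<in>UNIV. g_inv G w i j * (d_dzbar k (\<lambda>w. G w $ i $ j) w - d_dzbar j (\<lambda>w. G w $ i $ k) w)) = 0"
    by (simp add: torsion_trace_def)
  have dG: "(\<lambda>w. G w $ i $ j) differentiable (at w)" for i j using smooth_imp_diff[OF smooth w] .
  have c: "cnj (d_dzbar a (\<lambda>w. G w $ i $ j) w) = d_dz a (\<lambda>w. G w $ j $ i) w" for a i j
  proof -
    have "d_dz a (\<lambda>w. G w $ j $ i) w = d_dz a (\<lambda>w. cnj (G w $ i $ j)) w"
      by (rule wirtinger_cong(1)[OF open_S w]) (rule hermitian)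
    then show ?thesis by (simp add: wirtinger_cnj dG)
  qed
  have "0 = cnj (torsion_trace k w)" using t by simp
  also have "\<dots> = (\<Sum>i\<in>UNIV. \<Sum>j\<in>UNIV. g_inv G w j i * (d_dz k (\<lambda>w. G w $ j $ i) w - d_dz j (\<lambda>w. G w $ k $ i) w))"
    by (simp add: torsion_trace_def c g_inv_cnj[OF w])
  finally show "(\<Sum>i\<in>UNIV. \<Sum>j\<in>UNIV. g_inv G w i j * (d_dz k (\<lambda>w. G w $ i $ j) w - d_dz i (\<lambda>w. G w $ k $ j) w)) = 0"
    by (subst sum.swap) simp
qed

end


section \<open>Complex space as a real space\<close>

text \<open>A permutation that moves an index outside the range of \<open>\<iota>\<close> meets an entry 0, so only the permutations of the range
  contribute.\<close>

lemma det_extend_by_identity: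
  fixes B :: "'a::comm_ring_1^'n^'n" and \<iota> :: "'n::finite \<Rightarrow> 'm::finite"
  assumes \<iota>: "inj \<iota>"
  shows "det (\<chi> s t. if s \<in> range \<iota> then (if t \<in> range \<iota> then B $ inv \<iota> s $ inv \<iota> t else 0) else of_bool (s = t)) = det B"
    (is "det ?M = _")
proof -
  let ?R = "range \<iota>"
  have inv: "inv \<iota> (\<iota> i) = i" for i using \<iota> by simp
  have "det ?M = (\<Sum>p | p permutes ?R. of_int (sign p) * (\<Prod>s\<in>UNIV. ?M $ s $ p s))"
    unfolding det_def
  proof (rule sum.mono_neutral_right)
    show "{p. p permutes ?R} \<subseteq> {p. p permutes UNIV}" by (auto intro: permutes_subset)
    show "\<forall>p\<in>{p. p permutes UNIV} - {p. p permutes ?R}. of_int (sign p) * (\<Prod>s\<in>UNIV. ?M $ s $ p s) = 0"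
    proof
      fix p :: "'m \<Rightarrow> 'm" assume p: "p \<in> {p. p permutes UNIV} - {p. p permutes ?R}"
      then have "\<not> (\<forall>s. s \<notin> ?R \<longrightarrow> p s = s)" unfolding permutes_def by auto
      then obtain s where "s \<notin> ?R" "p s \<noteq> s" by auto
      then have "?M $ s $ p s = 0" by simp
      then have "\<exists>s\<in>UNIV. ?M $ s $ p s = 0" by blast
      from prod_zero[OF finite this] have "(\<Prod>s\<in>UNIV. ?M $ s $ p s) = 0" .
      then show "of_int (sign p) * (\<Prod>s\<in>UNIV. ?M $ s $ p s) = 0" by simp
    qed
  qed simp
  also have "\<dots> = (\<Sum>q | q permutes (UNIV :: 'n set). of_int (sign (map_permutation UNIV \<iota> q)) *
      (\<Prod>s\<in>UNIV. ?M $ s $ map_permutation UNIV \<iota> q s))"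
  proof -
    have "bij_betw (map_permutation UNIV \<iota>) {q. q permutes (UNIV :: 'n set)} {p. p permutes ?R}"
    proof -
      have "map_permutation UNIV \<iota> = (\<lambda>\<pi> x. if x \<in> ?R then \<iota> (\<pi> (inv_into UNIV \<iota> x)) else x)"
        by (auto simp: map_permutation_def restrict_id_def fun_eq_iff)
      then show ?thesis using bij_betw_permutations[of \<iota> UNIV ?R] \<iota> by (simp add: bij_betw_def)
    qed
    from sum.reindex_bij_betw[OF this, of "\<lambda>p. of_int (sign p) * (\<Prod>s\<in>UNIV. ?M $ s $ p s)"]
    show ?thesis by simp
  qed
  also have "\<dots> = det B"
    unfolding det_def
  proof (intro sum.cong refl)
    fix q :: "'n \<Rightarrow> 'n" assume "q \<in> {q. q permutes UNIV}"
    then have q: "q permutes UNIV" by simp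
    let ?p = "map_permutation UNIV \<iota> q"
    have p: "?p (\<iota> i) = \<iota> (q i)" for i by (simp add: map_permutation_def inv)
    have out: "?p s = s" if "s \<notin> ?R" for s using that by (simp add: map_permutation_def)
    have "(\<Prod>s\<in>UNIV. ?M $ s $ ?p s) = (\<Prod>s\<in>?R. ?M $ s $ ?p s)"
      by (rule prod.mono_neutral_right) (auto simp: out)
    also have "\<dots> = (\<Prod>i\<in>UNIV. B $ i $ q i)"
      by (subst prod.reindex[OF \<iota>]) (simp add: p inv o_def)
    finally show "of_int (sign ?p) * (\<Prod>s\<in>UNIV. ?M $ s $ ?p s) = of_int (sign q) * (\<Prod>i\<in>UNIV. B $ i $ q i)"
      using sign_map_permutation[OF \<iota> q finite] by simp
  qed
  finally show ?thesis .
qed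

text \<open>The real coordinates of \<open>complex^'n\<close> are indexed by the type \<open>'n bit0\<close>, whose \<open>2 CARD('n)\<close>
  elements are well-ordered; an index stands for a complex coordinate and the choice of its real
  (\<open>True\<close>) or imaginary (\<open>False\<close>) part.\<close>

definition real_index :: "'n::finite bit0 \<Rightarrow> 'n \<times> bool" where
  "real_index = (SOME e. bij e)"

lemma bij_real_index: "bij (real_index :: 'n::finite bit0 \<Rightarrow> 'n \<times> bool)"
proof -
  have "CARD('n bit0) = CARD('n \<times> bool)" by simp
  then have "\<exists>e :: 'n bit0 \<Rightarrow> 'n \<times> bool. bij e"
    by (intro finite_same_card_bij) auto
  then show ?thesis unfolding real_index_def by (rule someI_ex)
qed

definition index_of :: "'n::finite \<times> bool \<Rightarrow> 'n bit0" where
  "index_of = inv real_index"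

lemma index_of: "real_index (index_of p) = p" "index_of (real_index s) = s"
  unfolding index_of_def
  by (rule surj_f_inv_f[OF bij_is_surj[OF bij_real_index]], rule inv_f_f[OF bij_is_inj[OF bij_real_index]])

lemma sum_real_index: "(\<Sum>s\<in>UNIV. f (real_index s)) = (\<Sum>i\<in>UNIV. f (i, True) + f (i, False))"
  for f :: "'n::finite \<times> bool \<Rightarrow> 'a::comm_monoid_add"
proof -
  have "(\<Sum>s\<in>UNIV. f (real_index s)) = (\<Sum>p\<in>UNIV. f p)"
    by (rule sum.reindex_bij_betw[OF bij_real_index])
  also have "\<dots> = (\<Sum>i\<in>UNIV. \<Sum>b\<in>UNIV. f (i, b))"
    by (simp add: sum.cartesian_product flip: UNIV_Times_UNIV)
  finally show ?thesis by (simp add: UNIV_bool add.commute)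
qed

definition realify :: "complex^'n::finite \<Rightarrow> real^('n bit0)" where
  "realify x = (\<chi> s. if snd (real_index s) then Re (x $ fst (real_index s)) else Im (x $ fst (real_index s)))"

definition complexify :: "real^('n::finite bit0) \<Rightarrow> complex^'n" where
  "complexify y = (\<chi> i. Complex (y $ index_of (i, True)) (y $ index_of (i, False)))"

lemma complexify_realify: "complexify (realify x) = x"
  by (simp add: complexify_def realify_def vec_eq_iff index_of complex_eq_iff)

lemma realify_complexify: "realify (complexify y) = y"
proof -
  have "realify (complexify y) $ s = y $ s" for s
    using index_of(2)[of s] by (cases "real_index s") (auto simp: complexify_def realify_def)
  then show ?thesis by (simp add: vec_eq_iff)
qed

lemma linear_realify: "linear realify"
  by (rule linearI) (auto simp: realify_def vec_eq_iff)

lemma linear_complexify: "linear complexify"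
  by (rule linearI) (auto simp: complexify_def vec_eq_iff complex_eq_iff)

lemma bounded_linear_realify: "bounded_linear realify"
  using linear_realify linear_conv_bounded_linear by blast

lemma bounded_linear_complexify: "bounded_linear complexify"
  using linear_complexify linear_conv_bounded_linear by blast

text \<open>A complex-linear map has real determinant \<open>|det|\<^sup>2\<close>: in the coordinates \<open>z\<close> and conjugate
  \<open>z\<close> of the complexified space it becomes the block matrix with blocks \<open>A\<close> and the conjugate of \<open>A\<close>.\<close>

lemma det_realified:
  fixes A :: "complex^'n::finite^'n"
  shows "det (matrix (\<lambda>y. realify (A *v complexify y))) = (cmod (det A))^2"
proof -
  define M where "M = matrix (\<lambda>y. realify (A *v complexify y))"
  define Mc :: "complex^('n bit0)^('n bit0)" where "Mc = (\<chi> s t. complex_of_real (M $ s $ t))"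
  define P :: "complex^('n bit0)^('n bit0)" where "P = (\<chi> s t. if fst (real_index s) = fst (real_index t)
     then (if snd (real_index t) then 1 else if snd (real_index s) then \<i> else -\<i>) else 0)"
  define Q :: "complex^('n bit0)^('n bit0)" where "Q = (\<chi> s t. if fst (real_index s) = fst (real_index t)
     then (if snd (real_index s) then 1/2 else if snd (real_index t) then -\<i>/2 else \<i>/2) else 0)"
  define B where "B b C = (\<chi> s t. if snd (real_index s) = b then
      (if snd (real_index t) = b then C $ fst (real_index s) $ fst (real_index t) else 0) else of_bool (s = t))"
    for b and C :: "complex^'n^'n"
  define m where "m p q = (if snd p then (if snd q then Re (A $ fst p $ fst q) else - Im (A $ fst p $ fst q))
      else (if snd q then Im (A $ fst p $ fst q) else Re (A $ fst p $ fst q)))" for p q :: "'n \<times> bool"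
  have Mst: "M $ s $ t = m (real_index s) (real_index t)" for s t
  proof -
    obtain i b where s: "real_index s = (i, b)" by (cases "real_index s")
    obtain j c where t: "real_index t = (j, c)" by (cases "real_index t")
    have "index_of (j', c') = t \<longleftrightarrow> (j', c') = (j, c)" for j' c'
      unfolding t[symmetric] by (metis index_of)
    then have "complexify (axis t 1) = axis j (if c then 1 else \<i>)"
      by (auto simp: complexify_def axis_def vec_eq_iff complex_eq_iff)
    then have "(A *v complexify (axis t 1)) $ i = A $ i $ j * (if c then 1 else \<i>)"
      by (simp add: matrix_vector_mult_def axis_def if_distrib[of "\<lambda>c. _ * c"] cong: if_cong)
    then show ?thesis by (simp add: M_def matrix_def realify_def s t m_def)
  qed
  have PM: "P ** Mc = (B True A ** B False (\<chi> i j. cnj (A $ i $ j))) ** P"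
  proof -
    define E where "E = (\<chi> s t. if snd (real_index s) = snd (real_index t) then
      (if snd (real_index s) then A $ fst (real_index s) $ fst (real_index t)
       else cnj (A $ fst (real_index s) $ fst (real_index t))) else 0)"
    have E: "B True A ** B False (\<chi> i j. cnj (A $ i $ j)) = E"
    proof -
      have "(B True A ** B False (\<chi> i j. cnj (A $ i $ j))) $ s $ t = E $ s $ t" for s t
      proof (cases "snd (real_index s)")
        case True
        have "B True A $ s $ u * B False (\<chi> i j. cnj (A $ i $ j)) $ u $ t =
          (if snd (real_index u) then A $ fst (real_index s) $ fst (real_index u) else 0) * of_bool (u = t)" for u
          by (simp add: B_def True)
        then have "(B True A ** B False (\<chi> i j. cnj (A $ i $ j))) $ s $ t =
          (\<Sum>u\<in>UNIV. (if snd (real_index u) then A $ fst (real_index s) $ fst (real_index u) else 0) * of_bool (u = t))"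
          by (simp add: matrix_matrix_mult_def)
        then show ?thesis by (simp add: E_def True split_beta if_distrib[of "\<lambda>c. _ * c"] of_bool_def cong: if_cong)
      next
        case False
        have "(B True A ** B False (\<chi> i j. cnj (A $ i $ j))) $ s $ t =
          (\<Sum>u\<in>UNIV. of_bool (s = u) * B False (\<chi> i j. cnj (A $ i $ j)) $ u $ t)"
          unfolding matrix_matrix_mult_def by (simp add: B_def False)
        also have "\<dots> = B False (\<chi> i j. cnj (A $ i $ j)) $ s $ t"
          by (simp add: of_bool_def if_distrib[of "\<lambda>c. c * _"] cong: if_cong)
        finally show ?thesis by (simp add: B_def E_def False split_beta)
      qed
      then show ?thesis by (simp add: vec_eq_iff)
    qed
    have "(P ** Mc) $ s $ t = (E ** P) $ s $ t" for s t
    proof -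
      obtain i b where s: "real_index s = (i, b)" by (cases "real_index s")
      obtain j c where t: "real_index t = (j, c)" by (cases "real_index t")
      define f where "f p = (if i = fst p then (if snd p then 1 else if b then \<i> else -\<i>) else 0) * complex_of_real (m p (j, c))" for p
      define g where "g p = (if b = snd p then (if b then A $ i $ fst p else cnj (A $ i $ fst p)) else 0) *
          (if fst p = j then (if c then 1 else if snd p then \<i> else -\<i>) else 0)" for p
      have "(P ** Mc) $ s $ t = (\<Sum>u\<in>UNIV. f (real_index u))"
        unfolding matrix_matrix_mult_def by (simp add: P_def Mc_def Mst s t f_def cong: if_cong)
      also have "\<dots> = (\<Sum>k\<in>UNIV. f (k, True) + f (k, False))" by (rule sum_real_index)
      also have "\<dots> = (if b then A $ i $ j else cnj (A $ i $ j)) * (if c then 1 else if b then \<i> else -\<i>)"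
      proof -
        have "f (k, True) + f (k, False) = (if i = k then (if b then A $ i $ j else cnj (A $ i $ j)) * (if c then 1 else if b then \<i> else -\<i>) else 0)" for k
          by (simp add: f_def m_def complex_eq_iff)
        then show ?thesis by simp
      qed
      also have "\<dots> = (\<Sum>k\<in>UNIV. g (k, True) + g (k, False))"
      proof -
        have "g (k, True) + g (k, False) = (if k = j then (if b then A $ i $ j else cnj (A $ i $ j)) * (if c then 1 else if b then \<i> else -\<i>) else 0)" for k
          by (simp add: g_def)
        then show ?thesis by simp
      qed
      also have "\<dots> = (\<Sum>u\<in>UNIV. g (real_index u))" by (rule sum_real_index[symmetric])
      also have "\<dots> = (E ** P) $ s $ t"
        unfolding matrix_matrix_mult_def by (simp add: P_def E_def s t g_def cong: if_cong)
      finally show ?thesis .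
    qed
    then show ?thesis unfolding E by (simp add: vec_eq_iff)
  qed
  have PQ: "P ** Q = mat 1"
  proof -
    have "(P ** Q) $ s $ t = mat 1 $ s $ t" for s t
    proof -
      obtain i b where s: "real_index s = (i, b)" by (cases "real_index s")
      obtain j c where t: "real_index t = (j, c)" by (cases "real_index t")
      define f where "f p = (if i = fst p then (if snd p then 1 else if b then \<i> else -\<i>) else 0) *
         (if fst p = j then (if snd p then 1/2 else if c then -\<i>/2 else \<i>/2) else 0)" for p
      have "(P ** Q) $ s $ t = (\<Sum>u\<in>UNIV. f (real_index u))"
        unfolding matrix_matrix_mult_def by (simp add: P_def Q_def s t f_def cong: if_cong)
      also have "\<dots> = (\<Sum>k\<in>UNIV. f (k, True) + f (k, False))" by (rule sum_real_index)
      also have "\<dots> = (if i = j \<and> b = c then 1 else 0)"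
      proof -
        have "f (k, True) + f (k, False) = (if i = k then (if i = j \<and> b = c then 1 else 0) else 0)" for k
          by (auto simp: f_def)
        then show ?thesis by simp
      qed
      also have "\<dots> = mat 1 $ s $ t"
      proof -
        have "s = t \<longleftrightarrow> (i, b) = (j, c)"
          unfolding s[symmetric] t[symmetric] using index_of(2) by metis
        then show ?thesis by (simp add: mat_def)
      qed
      finally show ?thesis .
    qed
    then show ?thesis by (simp add: vec_eq_iff)
  qed
  have detB: "det (B b C) = det C" for b C
  proof -
    define \<iota> :: "'n \<Rightarrow> 'n bit0" where "\<iota> i = index_of (i, b)" for i
    have inj: "inj \<iota>" by (rule injI) (metis \<iota>_def index_of(1) prod.inject)
    have key: "\<iota> (fst (real_index s)) = s" if "snd (real_index s) = b" for s
      using that index_of(2)[of s] by (cases "real_index s") (simp add: \<iota>_def)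
    have range: "s \<in> range \<iota> \<longleftrightarrow> snd (real_index s) = b" for s
    proof
      show "s \<in> range \<iota>" if "snd (real_index s) = b"
        using key[OF that] by (metis rangeI)
    qed (auto simp: \<iota>_def index_of)
    have inv: "inv \<iota> s = fst (real_index s)" if "snd (real_index s) = b" for s
      by (rule inv_f_eq[OF inj key[OF that]])
    have "B b C = (\<chi> s t. if s \<in> range \<iota> then (if t \<in> range \<iota> then C $ inv \<iota> s $ inv \<iota> t else 0) else of_bool (s = t))"
      unfolding B_def range by (auto simp: vec_eq_iff inv)
    then show ?thesis using det_extend_by_identity[OF inj, of C] by simp
  qed
  have "det P * det Q = 1" using arg_cong[OF PQ, of det] by (simp add: det_mul det_I)
  then have P0: "det P \<noteq> 0" by auto
  have "det P * det Mc = det A * det (\<chi> i j. cnj (A $ i $ j)) * det P"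
    using arg_cong[OF PM, of det] by (simp add: det_mul detB)
  moreover have "det (\<chi> i j. cnj (A $ i $ j)) = cnj (det A)" by (simp add: det_def)
  ultimately have "det Mc = det A * cnj (det A)" using P0 by simp
  moreover have "det Mc = complex_of_real (det M)" by (simp add: Mc_def det_def)
  ultimately have "complex_of_real (det M) = complex_of_real ((cmod (det A))^2)"
    unfolding complex_norm_square by simp
  then show ?thesis unfolding M_def of_real_eq_iff .
qed


section \<open>Integrals of compactly supported functions on open subsets of complex space\<close>

definition supported_on :: "'a::euclidean_space set \<Rightarrow> ('a \<Rightarrow> real) \<Rightarrow> bool" where
  "supported_on S f \<longleftrightarrow> continuous_on S f \<and> (\<exists>K. compact K \<and> K \<subseteq> S \<and> (\<forall>z\<in>S-K. f z = 0))"

definition zero_extension :: "'a set \<Rightarrow> ('a \<Rightarrow> 'b::zero) \<Rightarrow> 'a \<Rightarrow> 'b" where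
  "zero_extension S f z = (if z \<in> S then f z else 0)"

definition complex_integral :: "(complex^'n::finite) set \<Rightarrow> (complex^'n \<Rightarrow> real) \<Rightarrow> real" where
  "complex_integral S f = integral UNIV (\<lambda>y. zero_extension S f (complexify y))"

lemma ck_zero_extension:
  assumes "ck_on m S f" "open S" "compact K" "K \<subseteq> S" "\<And>z. z \<in> S - K \<Longrightarrow> f z = 0"
  shows "ck_on m UNIV (zero_extension S f)"
proof (rule ck_local)
  fix x
  show "\<exists>T. open T \<and> x \<in> T \<and> ck_on m T (zero_extension S f)"
  proof (cases "x \<in> S")
    case True
    have "ck_on m S (zero_extension S f)"
      by (rule ck_cong[OF \<open>open S\<close> _ assms(1)]) (simp add: zero_extension_def)
    then show ?thesis using True \<open>open S\<close> by blast
  next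
    case False
    have "open (- K)" using \<open>compact K\<close> by (simp add: compact_imp_closed open_Compl)
    moreover have "ck_on m (- K) (zero_extension S f)"
      by (rule ck_cong[OF \<open>open (- K)\<close> _ ck_const[of m _ 0]]) (auto simp: zero_extension_def assms(5))
    ultimately show ?thesis using False assms(4) by blast
  qed
qed

lemma integral_support:
  fixes f :: "'a::euclidean_space \<Rightarrow> 'b::euclidean_space"
  assumes "\<And>x. x \<notin> S \<Longrightarrow> f x = 0"
  shows "integral S f = integral UNIV f"
proof -
  have "(\<lambda>x. if x \<in> S then f x else 0) = f" using assms by (intro ext) auto
  then show ?thesis using integral_restrict_UNIV[of S f] by simp
qed

lemma absolutely_integrable_compact_support:
  fixes f :: "'a::euclidean_space \<Rightarrow> 'b::euclidean_space"
  assumes "continuous_on UNIV f" "compact K" "\<And>x. x \<notin> K \<Longrightarrow> f x = 0"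
  shows "f absolutely_integrable_on UNIV"
proof -
  obtain a where "K \<subseteq> cbox (-a) a"
    using bounded_subset_cbox_symmetric[OF compact_imp_bounded[OF \<open>compact K\<close>]] by blast
  then have "(\<lambda>x. if x \<in> cbox (-a) a then f x else 0) = f" using assms(3) by (intro ext) auto
  moreover have "f absolutely_integrable_on cbox (-a) a"
    using assms(1) by (intro absolutely_integrable_continuous) (auto intro: continuous_on_subset)
  ultimately show ?thesis using absolutely_integrable_restrict_UNIV[of "cbox (-a) a" f] by simp
qed

text \<open>Differentiate the integral of \<open>W (y + t u)\<close> with respect to \<open>t\<close>: by translation invariance of Lebesgue
  measure it is constant.\<close>

lemma integral_derivative_zero:
  fixes W :: "'a::euclidean_space \<Rightarrow> real"
  assumes W: "ck_on 1 UNIV W" and K: "compact K" "\<And>x. x \<notin> K \<Longrightarrow> W x = 0"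
  shows "integral UNIV (\<lambda>y. frechet_derivative W (at y) u) = 0"
proof -
  define B where "B = {x + y |x y. x \<in> K \<and> y \<in> (\<lambda>t. t *\<^sub>R u) ` {-1..1}}"
  have "compact B"
    unfolding B_def by (intro compact_sums K compact_continuous_image continuous_intros) auto
  then obtain a where a: "B \<subseteq> cbox (-a) a"
    using bounded_subset_cbox_symmetric[OF compact_imp_bounded] by blast
  have KB: "x \<in> B" if "x + t *\<^sub>R u \<in> K" "\<bar>t\<bar> \<le> 1" for x t
  proof -
    have "x = (x + t *\<^sub>R u) + (-t) *\<^sub>R u" by simp
    moreover have "(-t) *\<^sub>R u \<in> (\<lambda>t. t *\<^sub>R u) ` {-1..1}" by (rule imageI) (use that(2) in auto)
    ultimately show ?thesis unfolding B_def using that(1) by blast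
  qed
  have KB0: "K \<subseteq> cbox (-a) a" using KB[of _ 0] a by auto
  have cW: "continuous_on UNIV W" using ck_continuous[OF W] .
  have cD: "continuous_on UNIV (\<lambda>y. frechet_derivative W (at y) u)" using W by simp
  have dW: "(W has_derivative frechet_derivative W (at y)) (at y)" for y
    using ck_has_derivative[OF W] by simp
  have const: "integral (cbox (-a) a) (\<lambda>y. W (y + t *\<^sub>R u)) = integral UNIV W" if "\<bar>t\<bar> \<le> 1" for t
  proof -
    have "integral (cbox (-a) a) (\<lambda>y. W (y + t *\<^sub>R u)) = integral UNIV (\<lambda>y. W (y + t *\<^sub>R u))"
      by (rule integral_support) (use KB K(2) a that in blast)
    also have "\<dots> = integral (cbox (-a - t *\<^sub>R u) (a - t *\<^sub>R u)) (\<lambda>y. W (y + t *\<^sub>R u))"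
    proof (rule integral_support[symmetric])
      fix y assume "y \<notin> cbox (-a - t *\<^sub>R u) (a - t *\<^sub>R u)"
      then have "y + t *\<^sub>R u \<notin> cbox (-a) a" by (auto simp: mem_box algebra_simps)
      then show "W (y + t *\<^sub>R u) = 0" using KB0 K(2) by blast
    qed
    also have "\<dots> = integral (cbox (-a) a) W" by (rule integral_shift_cbox)
    also have "\<dots> = integral UNIV W" by (rule integral_support) (use KB0 K(2) in blast)
    finally show ?thesis .
  qed
  have "((\<lambda>t. integral (cbox (-a) a) (\<lambda>y. W (y + t *\<^sub>R u))) has_vector_derivative
      integral (cbox (-a) a) (\<lambda>y. frechet_derivative W (at (y + 0 *\<^sub>R u)) u)) (at 0 within {-1..1})"
  proof (rule leibniz_rule_vector_derivative)
    fix t and y :: 'a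
    have "((\<lambda>t. W (y + t *\<^sub>R u)) has_derivative (\<lambda>h. frechet_derivative W (at (y + t *\<^sub>R u)) (h *\<^sub>R u))) (at t)"
      by (rule has_derivative_compose[OF _ dW]) (auto intro!: derivative_eq_intros)
    then show "((\<lambda>t. W (y + t *\<^sub>R u)) has_vector_derivative frechet_derivative W (at (y + t *\<^sub>R u)) u) (at t within {-1..1})"
      unfolding has_vector_derivative_def linear_scale[OF has_derivative_linear[OF dW]]
      by (rule has_derivative_at_withinI)
  next
    show "(\<lambda>y. W (y + t *\<^sub>R u)) integrable_on cbox (-a) a" for t
      by (intro integrable_continuous continuous_on_compose2[OF cW] continuous_intros) auto
    show "continuous_on ({-1..1} \<times> cbox (-a) a) (\<lambda>(t, y). frechet_derivative W (at (y + t *\<^sub>R u)) u)"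
      unfolding split_beta by (intro continuous_on_compose2[OF cD] continuous_intros) auto
  qed auto
  moreover have "((\<lambda>t. integral (cbox (-a) a) (\<lambda>y. W (y + t *\<^sub>R u))) has_vector_derivative 0) (at 0 within {-1..1})"
    by (rule has_vector_derivative_transform[of _ _ _ "\<lambda>t. integral UNIV W"]) (auto simp: const)
  ultimately have "integral (cbox (-a) a) (\<lambda>y. frechet_derivative W (at (y + 0 *\<^sub>R u)) u) = 0"
    using at_within_Icc_at[of "-1" 0 "1::real"] vector_derivative_unique_at by auto
  then have "integral (cbox (-a) a) (\<lambda>y. frechet_derivative W (at y) u) = 0" by simp
  moreover have "frechet_derivative W (at y) u = 0" if "y \<notin> cbox (-a) a" for y
  proof -
    have "open (- K)" "y \<in> - K" using that KB0 K(1) by (auto simp: compact_imp_closed)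
    from frechet_derivative_cong_open(1)[OF this, of W "\<lambda>_. 0"] K(2)
    show ?thesis by (simp add: frechet_derivative_const)
  qed
  ultimately show ?thesis using integral_support[of "cbox (-a) a" "\<lambda>y. frechet_derivative W (at y) u"] by simp
qed

lemma complex_integral_derivative_zero:
  fixes w :: "complex^'n::finite \<Rightarrow> real"
  assumes w: "ck_on 1 S w" "open S" and K: "compact K" "K \<subseteq> S" "\<And>z. z \<in> S - K \<Longrightarrow> w z = 0"
  shows "complex_integral S (\<lambda>z. frechet_derivative w (at z) v) = 0"
proof -
  let ?W = "zero_extension S w"
  have W: "ck_on 1 UNIV ?W" by (rule ck_zero_extension[OF w K])
  have Wc: "ck_on 1 UNIV (\<lambda>y. ?W (complexify y))"
    by (rule ck_compose[OF W ck_linear[OF bounded_linear_complexify]]) auto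
  have dW: "frechet_derivative (\<lambda>y. ?W (complexify y)) (at y) u = frechet_derivative ?W (at (complexify y)) (complexify u)" for y u
    using has_derivative_compose[OF bounded_linear_imp_has_derivative[OF bounded_linear_complexify] ck_has_derivative[OF W]]
    by (intro frechet_derivative_eqI) auto
  have compl: "open (- K)" using K(1) by (simp add: compact_imp_closed open_Compl)
  have eq: "frechet_derivative ?W (at z) v = zero_extension S (\<lambda>z. frechet_derivative w (at z) v) z" for z
  proof (cases "z \<in> S")
    case True
    then show ?thesis
      using frechet_derivative_cong_open(1)[OF w(2) True, of ?W w] by (simp add: zero_extension_def)
  next
    case False
    then have "z \<in> - K" using K(2) by auto
    then show ?thesis
      using frechet_derivative_cong_open(1)[OF compl, of z ?W "\<lambda>_. 0"] K(3) False
      by (simp add: zero_extension_def frechet_derivative_const)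
  qed
  have "integral UNIV (\<lambda>y. frechet_derivative (\<lambda>y. ?W (complexify y)) (at y) (realify v)) = 0"
  proof (rule integral_derivative_zero[OF Wc])
    show "compact (realify ` K)"
      by (intro compact_continuous_image K linear_continuous_on bounded_linear_realify)
    show "?W (complexify y) = 0" if "y \<notin> realify ` K" for y
    proof -
      have "complexify y \<notin> K" using that realify_complexify by (metis imageI)
      then show ?thesis using K(3) by (auto simp: zero_extension_def)
    qed
  qed
  then show ?thesis unfolding dW complexify_realify eq complex_integral_def .
qed

lemma supported_on_integrable:
  fixes f :: "complex^'n::finite \<Rightarrow> real"
  assumes "supported_on S f" "open S"
  shows "(\<lambda>y. zero_extension S f (complexify y)) absolutely_integrable_on UNIV"
proof -
  obtain K where K: "compact K" "K \<subseteq> S" "\<forall>z\<in>S-K. f z = 0" and f: "continuous_on S f"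
    using assms(1) by (auto simp: supported_on_def)
  have "continuous_on UNIV (zero_extension S f)"
    using ck_zero_extension[of 0 S f K] f assms(2) K by simp
  then have c: "continuous_on UNIV (\<lambda>y. zero_extension S f (complexify y))"
    by (rule continuous_on_compose2) (auto intro: linear_continuous_on bounded_linear_complexify)
  show ?thesis
  proof (rule absolutely_integrable_compact_support[OF c])
    show "compact (realify ` K)"
      by (intro compact_continuous_image K linear_continuous_on bounded_linear_realify)
    show "zero_extension S f (complexify y) = 0" if "y \<notin> realify ` K" for y
    proof -
      have "complexify y \<notin> K" using that realify_complexify by (metis imageI)
      then show ?thesis using K(3) by (auto simp: zero_extension_def)
    qed
  qed
qed

lemma supported_on_add: "supported_on S f \<Longrightarrow> supported_on S g \<Longrightarrow> supported_on S (\<lambda>z. f z + g z)"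
  unfolding supported_on_def
proof (elim conjE exE, intro conjI)
  fix K L assume "compact K" "K \<subseteq> S" "\<forall>z\<in>S-K. f z = 0" "compact L" "L \<subseteq> S" "\<forall>z\<in>S-L. g z = 0"
  then show "\<exists>K. compact K \<and> K \<subseteq> S \<and> (\<forall>z\<in>S - K. f z + g z = 0)"
    by (intro exI[of _ "K \<union> L"]) (auto simp: compact_Un)
qed (rule continuous_on_add)

lemma supported_on_zero: "supported_on S (\<lambda>_. 0)"
  unfolding supported_on_def by (auto intro!: exI[of _ "{}"])

lemma supported_on_sum: "(\<And>i. i \<in> I \<Longrightarrow> supported_on S (f i)) \<Longrightarrow> supported_on S (\<lambda>z. \<Sum>i\<in>I. f i z)"
  by (induction I rule: infinite_finite_induct) (auto intro: supported_on_add supported_on_zero)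

lemma complex_integral_add:
  assumes "supported_on S f" "supported_on S g" "open S"
  shows "complex_integral S (\<lambda>z. f z + g z) = complex_integral S f + complex_integral S g"
proof -
  have "(\<lambda>y. zero_extension S (\<lambda>z. f z + g z) (complexify y)) =
      (\<lambda>y. zero_extension S f (complexify y) + zero_extension S g (complexify y))"
    by (auto simp: zero_extension_def fun_eq_iff)
  then show ?thesis
    unfolding complex_integral_def
    using supported_on_integrable[OF assms(1,3)] supported_on_integrable[OF assms(2,3)]
    by (simp add: integral_add set_lebesgue_integral_eq_integral(1))
qed

lemma complex_integral_zero: "complex_integral S (\<lambda>_. 0) = 0"
proof -
  have "zero_extension S (\<lambda>_. 0 :: real) = (\<lambda>_. 0)" by (auto simp: zero_extension_def)
  then show ?thesis by (simp add: complex_integral_def)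
qed

lemma complex_integral_sum:
  assumes "\<And>i. i \<in> I \<Longrightarrow> supported_on S (f i)" "open S"
  shows "complex_integral S (\<lambda>z. \<Sum>i\<in>I. f i z) = (\<Sum>i\<in>I. complex_integral S (f i))"
  using assms(1)
  by (induction I rule: infinite_finite_induct)
     (auto simp: complex_integral_zero complex_integral_add supported_on_sum assms(2))

lemma complex_integral_cong:
  "(\<And>z. z \<in> S \<Longrightarrow> f z = g z) \<Longrightarrow> complex_integral S f = complex_integral S g"
  unfolding complex_integral_def zero_extension_def by (simp cong: if_cong)

lemma complex_integral_nonneg_zero:
  assumes f: "supported_on S f" "open S" and pos: "\<And>z. z \<in> S \<Longrightarrow> f z \<ge> 0"
  shows "complex_integral S f \<ge> 0"
    and "complex_integral S f = 0 \<Longrightarrow> z \<in> S \<Longrightarrow> f z = 0"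
proof -
  let ?F = "\<lambda>y. zero_extension S f (complexify y)"
  have int: "?F integrable_on UNIV"
    using supported_on_integrable[OF f] set_lebesgue_integral_eq_integral(1) by blast
  have F0: "?F y \<ge> 0" for y by (simp add: zero_extension_def pos)
  show "complex_integral S f \<ge> 0"
    unfolding complex_integral_def by (rule integral_nonneg[OF int]) (rule F0)
  assume z: "complex_integral S f = 0" "z \<in> S"
  obtain K where K: "compact K" "K \<subseteq> S" "\<forall>z\<in>S-K. f z = 0" and cf: "continuous_on S f"
    using f(1) by (auto simp: supported_on_def)
  have "continuous_on UNIV (zero_extension S f)"
    using ck_zero_extension[of 0 S f K] cf f(2) K by simp
  then have c: "continuous_on UNIV ?F"
    by (rule continuous_on_compose2) (auto intro: linear_continuous_on bounded_linear_complexify)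
  obtain a where a: "insert (realify z) (realify ` K) \<subseteq> box (-a) a"
    using bounded_subset_box_symmetric[of "insert (realify z) (realify ` K)"] K(1)
    by (metis bounded_insert compact_continuous_image compact_imp_bounded linear_continuous_on bounded_linear_realify)
  have "integral (cbox (-a) a) ?F = integral UNIV ?F"
  proof (rule integral_support)
    fix y assume "y \<notin> cbox (-a) a"
    then have "y \<notin> realify ` K" using a box_subset_cbox by blast
    then have "complexify y \<notin> K" using realify_complexify by (metis imageI)
    then show "?F y = 0" using K(3) by (auto simp: zero_extension_def)
  qed
  then have "integral (cbox (-a) a) ?F = 0" using z(1) by (simp add: complex_integral_def)
  then have "\<forall>y\<in>cbox (-a) a. ?F y = 0"
    using integral_cbox_eq_0_iff[OF continuous_on_subset[OF c subset_UNIV], of "-a" a] F0 a by blast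
  then have "?F (realify z) = 0" using a box_subset_cbox by blast
  then show "f z = 0" using z(2) by (simp add: complexify_realify zero_extension_def)
qed

section \<open>Change of variables and partial integration\<close>

lemma integral_change_of_variables_real:
  fixes f :: "real^'m::{finite,wellorder} \<Rightarrow> real" and g :: "real^'m::_ \<Rightarrow> real^'m::_"
  assumes S: "S \<in> sets lebesgue" and der: "\<And>x. x \<in> S \<Longrightarrow> (g has_derivative g' x) (at x within S)"
    and inj: "inj_on g S" and f: "f absolutely_integrable_on (g ` S)"
  shows "integral (g ` S) f = integral S (\<lambda>x. \<bar>det (matrix (g' x))\<bar> * f (g x))"
proof -
  have "(\<lambda>x. vec (f x) :: real^1) absolutely_integrable_on (g ` S)"
    using f by (simp add: absolutely_integrable_on_1_iff)
  from integral_change_of_variables[OF S der inj disjI1[OF this]]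
  show ?thesis by (simp add: integral_on_1_eq)
qed

text \<open>The squared modulus is the real Jacobian of a holomorphic map. All integrals over complex space are taken in the real
  coordinates \<open>realify\<close>, because the change of variables formula is about vectors with a well-ordered index type.\<close>

lemma complex_integral_change_of_variables:
  fixes \<phi> :: "complex^'n::finite \<Rightarrow> complex^'n"
  assumes \<phi>: "holomorphic_map_on S \<phi>" "open S" "inj_on \<phi> S" "open (\<phi> ` S)"
    and f: "supported_on (\<phi> ` S) f"
  shows "complex_integral (\<phi> ` S) f = complex_integral S (\<lambda>z. (cmod (det (hol_jacobian \<phi> z)))^2 * f (\<phi> z))"
proof -
  define \<psi> where "\<psi> y = realify (\<phi> (complexify y))" for y
  define \<psi>' where "\<psi>' y = (\<lambda>v. realify (hol_jacobian \<phi> (complexify y) *v complexify v))" for y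
  have mem: "y \<in> realify ` A \<longleftrightarrow> complexify y \<in> A" for y and A :: "(complex^'n) set"
    by (metis complexify_realify realify_complexify imageE imageI)
  have im: "realify ` (\<phi> ` S) = \<psi> ` (realify ` S)"
    by (auto simp: \<psi>_def image_image complexify_realify)
  have der: "(\<psi> has_derivative \<psi>' y) (at y within realify ` S)" if "y \<in> realify ` S" for y
  proof -
    have "complexify y \<in> S" using that mem by blast
    note D = holomorphic_map_on_has_derivative(1)[OF \<phi>(1) this]
    have "((\<lambda>y. \<phi> (complexify y)) has_derivative (\<lambda>v. hol_jacobian \<phi> (complexify y) *v complexify v)) (at y)"
      using has_derivative_compose[OF bounded_linear_imp_has_derivative[OF bounded_linear_complexify] D]
      unfolding holomorphic_map_on_jacobian[OF \<phi>(1) \<open>complexify y \<in> S\<close>] .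
    from bounded_linear.has_derivative[OF bounded_linear_realify this]
    show ?thesis unfolding \<psi>_def [abs_def] \<psi>'_def by (rule has_derivative_at_withinI)
  qed
  have op: "realify ` S \<in> sets lebesgue"
  proof -
    have "realify ` S = complexify -` S" using mem by auto
    then have "open (realify ` S)"
      using \<phi>(2) by (simp add: continuous_open_vimage linear_continuous_at bounded_linear_complexify)
    then show ?thesis by (simp add: borel_open sets_completionI_sets)
  qed
  have inj: "inj_on \<psi> (realify ` S)"
    using \<phi>(3) unfolding inj_on_def \<psi>_def by (auto simp: complexify_realify) (metis complexify_realify)
  have restr: "(\<lambda>y. if y \<in> realify ` A then h (complexify y) else 0) = (\<lambda>y. zero_extension A h (complexify y))"
    for A and h :: "complex^'n \<Rightarrow> real"
    by (auto simp: mem zero_extension_def)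
  have ci: "complex_integral A h = integral (realify ` A) (\<lambda>y. h (complexify y))" for A and h :: "complex^'n \<Rightarrow> real"
    unfolding complex_integral_def restr[symmetric] by (rule integral_restrict_UNIV)
  have "(\<lambda>y. f (complexify y)) absolutely_integrable_on (\<psi> ` (realify ` S))"
    using supported_on_integrable[OF f \<phi>(4)] absolutely_integrable_restrict_UNIV[of "realify ` \<phi> ` S" "\<lambda>y. f (complexify y)"]
    unfolding restr unfolding im by blast
  from integral_change_of_variables_real[OF op der inj this]
  have "complex_integral (\<phi> ` S) f = integral (realify ` S) (\<lambda>y. \<bar>det (matrix (\<psi>' y))\<bar> * f (complexify (\<psi> y)))"
    unfolding ci im .
  also have "\<dots> = complex_integral S (\<lambda>z. (cmod (det (hol_jacobian \<phi> z)))^2 * f (\<phi> z))"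
    unfolding ci \<psi>'_def det_realified \<psi>_def complexify_realify by simp
  finally show ?thesis .
qed

lemma complex_integral_wirtinger_zero:
  fixes w :: "complex^'n::finite \<Rightarrow> complex"
  assumes w: "ck_on 1 S w" "open S" and K: "compact K" "K \<subseteq> S" "\<And>z. z \<in> S - K \<Longrightarrow> w z = 0"
  shows "complex_integral S (\<lambda>z. Re (d_dz i w z)) = 0" "supported_on S (\<lambda>z. Re (d_dz i w z))"
    and "complex_integral S (\<lambda>z. Re (d_dzbar i w z)) = 0" "supported_on S (\<lambda>z. Re (d_dzbar i w z))"
proof -
  let ?R = "\<lambda>z. Re (w z)" and ?I = "\<lambda>z. Im (w z)"
  have R: "ck_on 1 S ?R" and I: "ck_on 1 S ?I"
    by (rule ck_bounded_linear[OF bounded_linear_Re w], rule ck_bounded_linear[OF bounded_linear_Im w])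
  have d: "frechet_derivative ?R (at z) v = Re (frechet_derivative w (at z) v)"
      "frechet_derivative ?I (at z) v = Im (frechet_derivative w (at z) v)" if "z \<in> S" for z v
    using bounded_linear.has_derivative[OF bounded_linear_Re ck_has_derivative[OF w(1) _ that]]
      bounded_linear.has_derivative[OF bounded_linear_Im ck_has_derivative[OF w(1) _ that]]
    by (auto intro!: frechet_derivative_eqI)
  have z: "complex_integral S (\<lambda>z. frechet_derivative h (at z) v) = 0" "supported_on S (\<lambda>z. c * frechet_derivative h (at z) v)"
    if h: "ck_on 1 S h" "\<And>z. z \<in> S - K \<Longrightarrow> h z = 0" for h v c
  proof -
    show "complex_integral S (\<lambda>z. frechet_derivative h (at z) v) = 0"
      by (rule complex_integral_derivative_zero[OF h(1) w(2) K(1,2) h(2)])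
    have "open (S - K)" using w(2) K(1) by (simp add: open_Diff compact_imp_closed)
    then have "frechet_derivative h (at z) v = 0" if "z \<in> S - K" for z
      using frechet_derivative_cong_open(1)[OF _ that, of h "\<lambda>_. 0"] h(2) by (simp add: frechet_derivative_const)
    moreover have "continuous_on S (\<lambda>z. c * frechet_derivative h (at z) v)"
      using h(1) by (auto intro!: continuous_intros)
    ultimately show "supported_on S (\<lambda>z. c * frechet_derivative h (at z) v)"
      unfolding supported_on_def using K(1,2) by auto
  qed
  have Kz: "?R z = 0" "?I z = 0" if "z \<in> S - K" for z using K(3)[OF that] by simp_all
  have scaled: "complex_integral S (\<lambda>z. c * frechet_derivative h (at z) v) = 0"
    if h: "ck_on 1 S h" "\<And>z. z \<in> S - K \<Longrightarrow> h z = 0" for h v c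
  proof -
    have c: "ck_on 1 S (\<lambda>z. c * h z)" by (intro ck_mult ck_const h w(2))
    have "frechet_derivative (\<lambda>z. c * h z) (at z) v = c * frechet_derivative h (at z) v" if "z \<in> S" for z
      using has_derivative_mult_right[OF ck_has_derivative[OF h(1) _ that], of c] by (intro frechet_derivative_eqI) simp
    then have "complex_integral S (\<lambda>z. c * frechet_derivative h (at z) v) =
        complex_integral S (\<lambda>z. frechet_derivative (\<lambda>z. c * h z) (at z) v)"
      by (intro complex_integral_cong) simp
    also have "\<dots> = 0" by (rule z(1)) (rule c, simp add: h(2))
    finally show ?thesis .
  qed
  have comb: "complex_integral S (\<lambda>z. 1/2 * frechet_derivative ?R (at z) (axis i 1) + c * frechet_derivative ?I (at z) (axis i \<i>)) = 0 \<and>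
     supported_on S (\<lambda>z. 1/2 * frechet_derivative ?R (at z) (axis i 1) + c * frechet_derivative ?I (at z) (axis i \<i>))" for c
    using complex_integral_add[OF z(2)[OF R Kz(1), of "1/2"] z(2)[OF I Kz(2)] w(2)]
      supported_on_add[OF z(2)[OF R Kz(1), of "1/2"] z(2)[OF I Kz(2)]] scaled[OF R Kz(1), of "1/2"] scaled[OF I Kz(2)] by simp
  have e1: "1/2 * frechet_derivative ?R (at z) (axis i 1) + 1/2 * frechet_derivative ?I (at z) (axis i \<i>) = Re (d_dz i w z)"
   and e2: "1/2 * frechet_derivative ?R (at z) (axis i 1) + (-1/2) * frechet_derivative ?I (at z) (axis i \<i>) = Re (d_dzbar i w z)" if "z \<in> S" for z
    using d[OF that] by (simp_all add: d_dz_def d_dzbar_def field_simps)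
  have sc: "supported_on S f \<Longrightarrow> (\<And>z. z \<in> S \<Longrightarrow> f z = g z) \<Longrightarrow> supported_on S g" for f g
    unfolding supported_on_def using continuous_on_cong[of S S f g] by auto
  have E1: "complex_integral S (\<lambda>z. Re (d_dz i w z)) = complex_integral S (\<lambda>z. 1/2 * frechet_derivative ?R (at z) (axis i 1)
      + 1/2 * frechet_derivative ?I (at z) (axis i \<i>))"
    by (rule complex_integral_cong) (rule e1[symmetric])
  show "complex_integral S (\<lambda>z. Re (d_dz i w z)) = 0" "supported_on S (\<lambda>z. Re (d_dz i w z))"
    unfolding E1 by (rule conjunct1[OF comb], rule sc[OF conjunct2[OF comb[of "1/2"]] e1])
  have E2: "complex_integral S (\<lambda>z. Re (d_dzbar i w z)) = complex_integral S (\<lambda>z. 1/2 * frechet_derivative ?R (at z) (axis i 1)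
      + (-1/2) * frechet_derivative ?I (at z) (axis i \<i>))"
    by (rule complex_integral_cong) (rule e2[symmetric])
  show "complex_integral S (\<lambda>z. Re (d_dzbar i w z)) = 0" "supported_on S (\<lambda>z. Re (d_dzbar i w z))"
    unfolding E2 by (rule conjunct1[OF comb], rule sc[OF conjunct2[OF comb[of "(-1/2)"]] e2])
qed

context hermitian_field
begin

text \<open>The trace of the complex Hessian with respect to the metric; \<open>det G\<close> times it is the operator
  whose formal adjoint maps the constant 1 to the double divergence of the cofactors.\<close>

definition laplacian :: "(complex^'n \<Rightarrow> complex) \<Rightarrow> complex^'n \<Rightarrow> complex" where
  "laplacian u z = (\<Sum>i\<in>UNIV. \<Sum>j\<in>UNIV. g_inv G z i j * d_dzbar j (d_dz i u) z)"

lemma continuous_laplacian: "ck_on 2 S u \<Longrightarrow> continuous_on S (laplacian u)"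
proof -
  assume u: "ck_on 2 S u"
  have "ck_on 0 S (laplacian u)"
    unfolding laplacian_def [abs_def]
    by (intro ck_sum ck_mult smooth_g_inv open_S ck_wirtinger) (use u in \<open>simp add: numeral_2_eq_2\<close>)
  then show ?thesis by simp
qed

text \<open>Both integrands differ by a sum of derivatives of functions with compact support,
  \<open>\<Sum>\<^sub>i d_dz i (u V\<^sub>i) - \<Sum>\<^sub>i\<^sub>j d_dzbar j (c\<^sup>i\<^sup>j d_dz i u)\<close>, where \<open>c\<close> are the cofactors and \<open>V\<close> their divergence.\<close>

lemma integral_laplacian:
  assumes u: "ck_on 2 S u" and K: "compact K" "K \<subseteq> S" "\<And>z. z \<in> S - K \<Longrightarrow> u z = 0"
  shows "complex_integral S (\<lambda>z. Re (det (G z) * laplacian u z)) =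
    complex_integral S (\<lambda>z. Re (u z * (\<Sum>i\<in>UNIV. d_dz i (cofactor_div i) z)))"
proof -
  have u': "ck_on (Suc 1) S u" using u by (simp add: numeral_2_eq_2)
  have u1: "ck_on 1 S u" using ck_Suc_imp[OF u'] .
  have du: "ck_on 1 S (d_dz i u)" for i using ck_wirtinger(1)[OF u' open_S] .
  have opn: "open (S - K)" using open_S K(1) by (simp add: open_Diff compact_imp_closed)
  have du0: "d_dz i u z = 0" if "z \<in> S - K" for i z
    using wirtinger_cong(1)[OF opn that, of u "\<lambda>_. 0"] K(3) by (simp add: wirtinger_const)
  let ?A = "\<lambda>i z. u z * cofactor_div i z" and ?B = "\<lambda>i j z. cofactor i j z * d_dz i u z"
  have A: "ck_on 1 S (?A i)" for i by (intro ck_mult u1 smooth_cofactor_div open_S)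
  have B: "ck_on 1 S (?B i j)" for i j by (intro ck_mult du smooth_cofactor open_S)
  note zA = complex_integral_wirtinger_zero(1,2)[OF A open_S K(1,2)]
  note zB = complex_integral_wirtinger_zero(3,4)[OF B open_S K(1,2)]
  have A0: "?A i z = 0" and B0: "?B i j z = 0" if "z \<in> S - K" for i j z
    using K(3)[OF that] du0[OF that] by auto
  have pt: "Re (u z * (\<Sum>i\<in>UNIV. d_dz i (cofactor_div i) z)) + (\<Sum>i\<in>UNIV. \<Sum>j\<in>UNIV. Re (d_dzbar j (?B i j) z))
      = Re (det (G z) * laplacian u z) + (\<Sum>i\<in>UNIV. Re (d_dz i (?A i) z))" if z: "z \<in> S" for z
  proof -
    have d: "u differentiable (at z)" "cofactor_div i differentiable (at z)"
        "cofactor i j differentiable (at z)" "d_dz i u differentiable (at z)" for i j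
      using ck_differentiable[OF u1 _ z] smooth_imp_diff[OF smooth_cofactor_div z]
        smooth_imp_diff[OF smooth_cofactor z] ck_differentiable[OF du _ z] by auto
    have "det (G z) * laplacian u z = (\<Sum>i\<in>UNIV. \<Sum>j\<in>UNIV. cofactor i j z * d_dzbar j (d_dz i u) z)"
      by (simp add: laplacian_def cofactor_def sum_distrib_left mult.assoc)
    then have "(\<Sum>i\<in>UNIV. \<Sum>j\<in>UNIV. d_dzbar j (?B i j) z) =
        (\<Sum>i\<in>UNIV. cofactor_div i z * d_dz i u z) + det (G z) * laplacian u z"
      by (simp add: wirtinger_mult d sum.distrib cofactor_div_def sum_distrib_right)
    moreover have "(\<Sum>i\<in>UNIV. d_dz i (?A i) z) = (\<Sum>i\<in>UNIV. cofactor_div i z * d_dz i u z)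
        + u z * (\<Sum>i\<in>UNIV. d_dz i (cofactor_div i) z)"
      by (simp add: wirtinger_mult d sum.distrib sum_distrib_left mult.commute)
    ultimately have "u z * (\<Sum>i\<in>UNIV. d_dz i (cofactor_div i) z) + (\<Sum>i\<in>UNIV. \<Sum>j\<in>UNIV. d_dzbar j (?B i j) z)
      = det (G z) * laplacian u z + (\<Sum>i\<in>UNIV. d_dz i (?A i) z)" by simp
    from arg_cong[OF this, of Re] show ?thesis by simp
  qed
  have s1: "supported_on S (\<lambda>z. Re (u z * (\<Sum>i\<in>UNIV. d_dz i (cofactor_div i) z)))"
  proof -
    have "ck_on 0 S (\<lambda>z. u z * (\<Sum>i\<in>UNIV. d_dz i (cofactor_div i) z))"
      by (intro ck_mult ck_sum ck_wirtinger smooth_cofactor_div open_S) (use ck_le[OF u] in blast)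
    then have "continuous_on S (\<lambda>z. u z * (\<Sum>i\<in>UNIV. d_dz i (cofactor_div i) z))" by simp
    then have "continuous_on S (\<lambda>z. Re (u z * (\<Sum>i\<in>UNIV. d_dz i (cofactor_div i) z)))"
      by (rule continuous_on_Re)
    then show ?thesis unfolding supported_on_def using K by (intro conjI exI[of _ K]) auto
  qed
  have s2: "supported_on S (\<lambda>z. Re (det (G z) * laplacian u z))"
  proof -
    have "laplacian u z = 0" if "z \<in> S - K" for z
      unfolding laplacian_def using wirtinger_cong(2)[OF opn that du0] by (simp add: wirtinger_const)
    moreover have "continuous_on S (\<lambda>z. Re (det (G z) * laplacian u z))"
      by (intro continuous_intros continuous_laplacian[OF u] ck_continuous[OF smooth_det])
    ultimately show ?thesis unfolding supported_on_def using K by (intro conjI exI[of _ K]) auto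
  qed
  have sA: "supported_on S (\<lambda>z. \<Sum>i\<in>UNIV. Re (d_dz i (?A i) z))"
    by (intro supported_on_sum zA(2) A0)
  have sB: "supported_on S (\<lambda>z. \<Sum>i\<in>UNIV. \<Sum>j\<in>UNIV. Re (d_dzbar j (?B i j) z))"
    by (intro supported_on_sum zB(2) B0)
  have iA: "complex_integral S (\<lambda>z. \<Sum>i\<in>UNIV. Re (d_dz i (?A i) z)) = 0"
  proof -
    have "complex_integral S (\<lambda>z. Re (d_dz i (?A i) z)) = 0" for i by (rule zA(1)) (rule A0)
    then show ?thesis by (subst complex_integral_sum[OF zA(2)[OF A0] open_S]) simp_all
  qed
  have iB: "complex_integral S (\<lambda>z. \<Sum>i\<in>UNIV. \<Sum>j\<in>UNIV. Re (d_dzbar j (?B i j) z)) = 0"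
  proof -
    have "complex_integral S (\<lambda>z. \<Sum>j\<in>UNIV. Re (d_dzbar j (?B i j) z)) = 0" for i
    proof -
      have "complex_integral S (\<lambda>z. Re (d_dzbar j (?B i j) z)) = 0" for j by (rule zB(1)) (rule B0)
      then show ?thesis by (subst complex_integral_sum[OF zB(2)[OF B0] open_S]) simp_all
    qed
    then show ?thesis
      by (subst complex_integral_sum[OF supported_on_sum[OF zB(2)[OF B0]] open_S]) simp_all
  qed
  have "complex_integral S (\<lambda>z. Re (u z * (\<Sum>i\<in>UNIV. d_dz i (cofactor_div i) z)) + (\<Sum>i\<in>UNIV. \<Sum>j\<in>UNIV. Re (d_dzbar j (?B i j) z)))
      = complex_integral S (\<lambda>z. Re (det (G z) * laplacian u z) + (\<Sum>i\<in>UNIV. Re (d_dz i (?A i) z)))"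
    by (rule complex_integral_cong) (rule pt)
  then show ?thesis
    unfolding complex_integral_add[OF s1 sB open_S] complex_integral_add[OF s2 sA open_S] iA iB by simp
qed

end


section \<open>Charts of a complex manifold\<close>

locale complex_mfd =
  fixes M :: "'m topology" and A :: "('m, 'n::finite) chart set"
  assumes mfd: "complex_manifold M A"
begin

lemma hausdorff: "Hausdorff_space M"
  using mfd by (simp add: complex_manifold_def)

lemma chart_domain_open: "c \<in> A \<Longrightarrow> openin M (fst c)"
  and chart_image_open: "c \<in> A \<Longrightarrow> open (chart_image c)"
  and chart_homeomorphic: "c \<in> A \<Longrightarrow> homeomorphic_map (subtopology M (fst c)) (top_of_set (chart_image c)) (snd c)"
  and chart_cover: "(\<Union>c\<in>A. fst c) = topspace M"
  and transition_holomorphic: "c \<in> A \<Longrightarrow> d \<in> A \<Longrightarrow> holomorphic_map_on (snd c ` (fst c \<inter> fst d)) (transition c d)"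
  using mfd by (auto simp: complex_manifold_def)

lemma chart_sub: "c \<in> A \<Longrightarrow> fst c \<subseteq> topspace M"
  using chart_cover by blast

lemma chart_topspace: "c \<in> A \<Longrightarrow> topspace (subtopology M (fst c)) = fst c"
  using chart_sub[of c] by (simp add: Int_absorb1)

lemma chart_inj: "c \<in> A \<Longrightarrow> inj_on (snd c) (fst c)"
  using homeomorphic_imp_injective_map[OF chart_homeomorphic] chart_topspace by metis

lemma chart_inv_chart: "c \<in> A \<Longrightarrow> p \<in> fst c \<Longrightarrow> chart_inv c (snd c p) = p"
  by (simp add: chart_inv_def inv_into_f_f chart_inj)

lemma chart_chart_inv: "z \<in> chart_image c \<Longrightarrow> snd c (chart_inv c z) = z" "z \<in> chart_image c \<Longrightarrow> chart_inv c z \<in> fst c"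
  by (simp_all add: chart_inv_def chart_image_def f_inv_into_f inv_into_into)

lemma open_chart_image:
  assumes c: "c \<in> A" and U: "openin M U"
  shows "open (snd c ` (fst c \<inter> U))"
proof -
  have "openin (subtopology M (fst c)) (fst c \<inter> U)"
    using U by (rule openin_subtopology_Int2)
  then have "openin (top_of_set (chart_image c)) (snd c ` (fst c \<inter> U))"
    using homeomorphic_imp_open_map[OF chart_homeomorphic[OF c]] by (simp add: open_map_def)
  then show ?thesis using chart_image_open[OF c] openin_open_trans by blast
qed

lemma overlap_open: "c \<in> A \<Longrightarrow> d \<in> A \<Longrightarrow> open (snd c ` (fst c \<inter> fst d))"
  by (rule open_chart_image) (auto intro: chart_domain_open)

lemma transition_chart: "c \<in> A \<Longrightarrow> p \<in> fst c \<Longrightarrow> transition c d (snd c p) = snd d p"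
  by (simp add: transition_def chart_inv_chart)

lemma transition_image: "c \<in> A \<Longrightarrow> d \<in> A \<Longrightarrow> transition c d ` (snd c ` (fst c \<inter> fst d)) = snd d ` (fst d \<inter> fst c)"
  unfolding image_image Int_commute[of "fst d"] by (intro image_cong refl) (simp add: transition_chart)

lemma transition_inj: "c \<in> A \<Longrightarrow> d \<in> A \<Longrightarrow> inj_on (transition c d) (snd c ` (fst c \<inter> fst d))"
  using chart_inj[of d] by (auto simp: inj_on_def transition_chart)

lemma compact_chart_image:
  assumes c: "c \<in> A" and K: "compactin M K" "K \<subseteq> fst c"
  shows "compact (snd c ` K)"
proof -
  have "compactin (subtopology M (fst c)) K" using K by (simp add: compactin_subtopology)
  then have "compactin (top_of_set (chart_image c)) (snd c ` K)"
    using image_compactin homeomorphic_imp_continuous_map[OF chart_homeomorphic[OF c]] by blast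
  then show ?thesis by (simp add: compactin_subtopology)
qed

lemma compact_chart_preimage:
  assumes c: "c \<in> A" and K: "compact K" "K \<subseteq> chart_image c"
  shows "compactin M (chart_inv c ` K)"
proof -
  obtain h where h: "homeomorphic_maps (subtopology M (fst c)) (top_of_set (chart_image c)) (snd c) h"
    using chart_homeomorphic[OF c] homeomorphic_map_maps by blast
  have eq: "h z = chart_inv c z" if z: "z \<in> chart_image c" for z
  proof -
    obtain p where p: "p \<in> fst c" "z = snd c p" using z unfolding chart_image_def by blast
    have "h (snd c p) = p" using h p chart_topspace[OF c] by (auto simp: homeomorphic_maps_def)
    then show ?thesis using p chart_inv_chart[OF c] by simp
  qed
  have "compactin (top_of_set (chart_image c)) K" using K by (simp add: compactin_subtopology)
  then have "compactin (subtopology M (fst c)) (h ` K)"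
    using image_compactin h by (auto simp: homeomorphic_maps_def)
  moreover have "h ` K = chart_inv c ` K" using eq K(2) by (intro image_cong) auto
  ultimately show ?thesis by (simp add: compactin_subtopology)
qed

lemma chart_at: "p \<in> topspace M \<Longrightarrow> \<exists>c. c \<in> charts_at A p"
  using chart_cover unfolding charts_at_def by blast

section \<open>Holomorphic tangent vectors and the local metric\<close>

lemma transition_self_derivative:
  assumes "c \<in> A" "p \<in> fst c"
  shows "frechet_derivative (transition c c) (at (snd c p)) v = v"
proof -
  have "snd c p \<in> chart_image c" using assms by (simp add: chart_image_def)
  from frechet_derivative_cong_open(1)[OF chart_image_open[OF assms(1)] this, of "transition c c" "\<lambda>x. x"]
  show ?thesis by (simp add: transition_def chart_chart_inv frechet_derivative_ident)
qed

lemma transition_cocycle: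
  assumes cde: "c \<in> charts_at A p" "d \<in> charts_at A p" "e \<in> charts_at A p"
  shows "frechet_derivative (transition d e) (at (snd d p)) (frechet_derivative (transition c d) (at (snd c p)) v)
    = frechet_derivative (transition c e) (at (snd c p)) v"
proof -
  have m: "c \<in> A" "d \<in> A" "e \<in> A" "p \<in> fst c" "p \<in> fst d" "p \<in> fst e" using cde by (auto simp: charts_at_def)
  let ?S = "snd c ` (fst c \<inter> (fst d \<inter> fst e))"
  have S: "open ?S" "snd c p \<in> ?S"
    using m by (auto intro!: open_chart_image openin_Int chart_domain_open)
  have "(transition c d has_derivative frechet_derivative (transition c d) (at (snd c p))) (at (snd c p))"
    using holomorphic_map_on_has_derivative(1)[OF transition_holomorphic[of c d]] m by blast
  moreover have "(transition d e has_derivative frechet_derivative (transition d e) (at (snd d p))) (at (transition c d (snd c p)))"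
    using holomorphic_map_on_has_derivative(1)[OF transition_holomorphic[of d e], of "snd d p"] m
    by (auto simp: transition_chart)
  ultimately have "((\<lambda>z. transition d e (transition c d z)) has_derivative
      (\<lambda>v. frechet_derivative (transition d e) (at (snd d p)) (frechet_derivative (transition c d) (at (snd c p)) v))) (at (snd c p))"
    by (rule has_derivative_compose)
  then have "(transition c e has_derivative
      (\<lambda>v. frechet_derivative (transition d e) (at (snd d p)) (frechet_derivative (transition c d) (at (snd c p)) v))) (at (snd c p))"
    by (rule has_derivative_transform_within_open[OF _ S]) (use m in \<open>auto simp: transition_chart\<close>)
  from frechet_derivative_eqI[OF this] show ?thesis by simp
qed

text \<open>The tangent vector at \<open>p\<close> with components \<open>x\<close> in the chart \<open>c\<close>; every vector of \<open>\<complex>\<^sup>n\<close> occurs as a component vector,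
  so that a condition on all tangent vectors can be read in a single chart.\<close>

definition tangent :: "('m, 'n) chart \<Rightarrow> 'm \<Rightarrow> complex^'n \<Rightarrow> ('m, 'n) tvec" where
  "tangent c p x = (\<lambda>d. if d \<in> charts_at A p then frechet_derivative (transition c d) (at (snd c p)) x else 0)"

lemma coord_vec_tangent: "coord_vec A c p i = tangent c p (axis i 1)"
  by (simp add: coord_vec_def tangent_def)

lemma tangent_T10: "c \<in> charts_at A p \<Longrightarrow> tangent c p x \<in> T10 A p"
  unfolding T10_def tangent_def using transition_cocycle by auto

lemma tangent_self: "c \<in> charts_at A p \<Longrightarrow> tangent c p x c = x"
  using transition_self_derivative by (auto simp: tangent_def charts_at_def)

lemma tangent_change:
  "c \<in> charts_at A p \<Longrightarrow> d \<in> charts_at A p \<Longrightarrow>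
    tangent c p x = tangent d p (frechet_derivative (transition c d) (at (snd c p)) x)"
  unfolding tangent_def by (auto simp: transition_cocycle)

lemma tangent_linear:
  assumes c: "c \<in> charts_at A p"
  shows "tangent c p (x + y) = (\<lambda>d. tangent c p x d + tangent c p y d)"
    and "tangent c p (a *s x) = (\<lambda>d. a *s tangent c p x d)"
proof -
  have h: "holomorphic_map_on (snd c ` (fst c \<inter> fst d)) (transition c d)" "snd c p \<in> snd c ` (fst c \<inter> fst d)"
    if "d \<in> charts_at A p" for d
    using that c transition_holomorphic by (auto simp: charts_at_def)
  show "tangent c p (x + y) = (\<lambda>d. tangent c p x d + tangent c p y d)"
    using linear_add[OF has_derivative_linear[OF holomorphic_map_on_has_derivative(1)[OF h]]]
    by (auto simp: tangent_def fun_eq_iff)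
  show "tangent c p (a *s x) = (\<lambda>d. a *s tangent c p x d)"
    using holomorphic_map_on_has_derivative(2)[OF h] by (auto simp: tangent_def fun_eq_iff)
qed

end

locale hermitian_mfd = complex_mfd M A for M :: "'m topology" and A :: "('m, 'n::finite) chart set" +
  fixes g :: "('m, 'n) metric"
  assumes metric: "hermitian_metric M A g"
begin

lemma point_in: "c \<in> charts_at A p \<Longrightarrow> p \<in> topspace M"
  using chart_sub unfolding charts_at_def by blast

lemma metric_add: "p \<in> topspace M \<Longrightarrow> X \<in> T10 A p \<Longrightarrow> Y \<in> T10 A p \<Longrightarrow> Z \<in> T10 A p \<Longrightarrow>
    g p (\<lambda>c. X c + Y c) Z = g p X Z + g p Y Z"
  and metric_scale: "p \<in> topspace M \<Longrightarrow> X \<in> T10 A p \<Longrightarrow> Z \<in> T10 A p \<Longrightarrow> g p (\<lambda>c. a *s X c) Z = a * g p X Z"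
  and metric_cnj: "p \<in> topspace M \<Longrightarrow> X \<in> T10 A p \<Longrightarrow> Y \<in> T10 A p \<Longrightarrow> g p Y X = cnj (g p X Y)"
  and metric_pos: "p \<in> topspace M \<Longrightarrow> X \<in> T10 A p \<Longrightarrow> X \<noteq> (\<lambda>_. 0) \<Longrightarrow> Re (g p X X) > 0"
  using metric unfolding hermitian_metric_def by blast+

lemma metric_sum:
  assumes c: "c \<in> charts_at A p" and Z: "Z \<in> T10 A p"
  shows "g p (tangent c p x) Z = (\<Sum>k\<in>UNIV. x $ k * g p (coord_vec A c p k) Z)"
proof -
  note p = point_in[OF c]
  have add: "g p (tangent c p (x + y)) Z = g p (tangent c p x) Z + g p (tangent c p y) Z" for x y
    unfolding tangent_linear(1)[OF c] by (intro metric_add p tangent_T10[OF c] Z)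
  have scale: "g p (tangent c p (a *s x)) Z = a * g p (tangent c p x) Z" for a x
    unfolding tangent_linear(2)[OF c] by (intro metric_scale p tangent_T10[OF c] Z)
  have zero: "g p (tangent c p 0) Z = 0" using scale[of 0 0] by simp
  have "g p (tangent c p (\<Sum>k\<in>I. x $ k *s axis k 1)) Z = (\<Sum>k\<in>I. x $ k * g p (coord_vec A c p k) Z)" if "finite I" for I
    using that by (induction I) (auto simp: zero add scale coord_vec_tangent)
  from this[of UNIV] show ?thesis by (simp add: basis_expansion)
qed

lemma local_metric_nth:
  "c \<in> A \<Longrightarrow> p \<in> fst c \<Longrightarrow> local_metric A g c (snd c p) $ k $ l = g p (coord_vec A c p k) (coord_vec A c p l)"
  by (simp add: local_metric_def Let_def chart_inv_chart)

lemma metric_local: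
  assumes c: "c \<in> charts_at A p"
  shows "g p (tangent c p x) (tangent c p y) =
    (\<Sum>k\<in>UNIV. \<Sum>l\<in>UNIV. local_metric A g c (snd c p) $ k $ l * x $ k * cnj (y $ l))"
proof -
  have m: "c \<in> A" "p \<in> fst c" using c by (auto simp: charts_at_def)
  have T: "coord_vec A c p k \<in> T10 A p" for k unfolding coord_vec_tangent by (rule tangent_T10[OF c])
  have "g p (coord_vec A c p k) (tangent c p y) = (\<Sum>l\<in>UNIV. cnj (y $ l) * g p (coord_vec A c p k) (coord_vec A c p l))" for k
  proof -
    note p = point_in[OF c]
    have "g p (coord_vec A c p k) (tangent c p y) = cnj (\<Sum>l\<in>UNIV. y $ l * g p (coord_vec A c p l) (coord_vec A c p k))"
      unfolding metric_sum[OF c T, symmetric] by (rule metric_cnj[OF p tangent_T10[OF c] T])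
    also have "\<dots> = (\<Sum>l\<in>UNIV. cnj (y $ l) * g p (coord_vec A c p k) (coord_vec A c p l))"
      by (simp add: metric_cnj[OF p T T, symmetric])
    finally show ?thesis .
  qed
  then show ?thesis
    unfolding metric_sum[OF c tangent_T10[OF c]] local_metric_nth[OF m] by (simp add: sum_distrib_left mult_ac)
qed

lemma hermitian_field_chart:
  assumes c: "c \<in> A"
  shows "hermitian_field (chart_image c) (local_metric A g c)"
proof
  show "open (chart_image c)" by (rule chart_image_open[OF c])
  show "ck_on m (chart_image c) (\<lambda>w. local_metric A g c w $ i $ j)" for m i j
    using metric c by (simp add: hermitian_metric_def smooth_on_def)
  fix w assume "w \<in> chart_image c"
  then obtain p where p: "p \<in> fst c" "w = snd c p" by (auto simp: chart_image_def)
  then have cp: "c \<in> charts_at A p" using c by (simp add: charts_at_def)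
  show "local_metric A g c w $ j $ i = cnj (local_metric A g c w $ i $ j)" for i j
    unfolding p(2) local_metric_nth[OF c p(1)]
    unfolding coord_vec_tangent by (intro metric_cnj point_in[OF cp] tangent_T10[OF cp])
  fix x :: "complex^'n" assume x: "x \<noteq> 0"
  have "tangent c p x \<noteq> (\<lambda>_. 0)" using tangent_self[OF cp, of x] x by auto
  then have "Re (g p (tangent c p x) (tangent c p x)) > 0"
    by (rule metric_pos[OF point_in[OF cp] tangent_T10[OF cp]])
  then show "0 < norm2_g (local_metric A g c) w x"
    unfolding metric_local[OF cp] norm2_g_def p(2) .
qed

lemma metric_transformation:
  assumes c: "c \<in> A" "d \<in> A" "p \<in> fst c" "p \<in> fst d"
  defines "J \<equiv> hol_jacobian (transition c d) (snd c p)"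
  shows "local_metric A g c (snd c p) = transpose J ** local_metric A g d (snd d p) ** (\<chi> i j. cnj (J $ i $ j))"
proof -
  have cp: "c \<in> charts_at A p" "d \<in> charts_at A p" using c by (auto simp: charts_at_def)
  have Jv: "frechet_derivative (transition c d) (at (snd c p)) v = J *v v" for v
    unfolding J_def using c by (intro holomorphic_map_on_jacobian[OF transition_holomorphic]) auto
  have ax: "(J *v axis k 1) $ a = J $ a $ k" for a k
    by (simp add: matrix_vector_mult_def axis_def if_distrib[of "\<lambda>c. _ * c"] cong: if_cong)
  have "local_metric A g c (snd c p) $ k $ l =
      (\<Sum>a\<in>UNIV. \<Sum>b\<in>UNIV. local_metric A g d (snd d p) $ a $ b * J $ a $ k * cnj (J $ b $ l))" for k l
    unfolding local_metric_nth[OF c(1,3)] coord_vec_tangent tangent_change[OF cp] Jv metric_local[OF cp(2)] ax ..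
  also have "\<dots> k l = (\<Sum>b\<in>UNIV. \<Sum>a\<in>UNIV. local_metric A g d (snd d p) $ a $ b * J $ a $ k * cnj (J $ b $ l))" for k l
    by (rule sum.swap)
  finally show ?thesis
    by (simp add: vec_eq_iff matrix_matrix_mult_def transpose_def sum_distrib_left sum_distrib_right mult_ac)
qed

lemma det_transformation:
  assumes c: "c \<in> A" "d \<in> A" "p \<in> fst c" "p \<in> fst d"
  shows "Re (det (local_metric A g c (snd c p))) =
    (cmod (det (hol_jacobian (transition c d) (snd c p))))^2 * Re (det (local_metric A g d (snd d p)))"
proof -
  let ?J = "hol_jacobian (transition c d) (snd c p)"
  have "det (local_metric A g c (snd c p)) = det ?J * det (local_metric A g d (snd d p)) * cnj (det ?J)"
    unfolding metric_transformation[OF c] by (simp add: det_mul det_transpose det_def[of "\<chi> i j. cnj (?J $ i $ j)"] det_def[of ?J])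
  also have "\<dots> = complex_of_real ((cmod (det ?J))^2) * det (local_metric A g d (snd d p))"
    unfolding complex_norm_square by simp
  finally show ?thesis by simp
qed

text \<open>Multiplying the transformation law of the metric out shows that the matrix on the left inverts the metric in the
  chart \<open>d\<close>.\<close>

lemma g_inv_transformation:
  assumes c: "c \<in> A" "d \<in> A" "p \<in> fst c" "p \<in> fst d"
  defines "J \<equiv> hol_jacobian (transition c d) (snd c p)"
  shows "(\<Sum>i\<in>UNIV. \<Sum>j\<in>UNIV. g_inv (local_metric A g c) (snd c p) i j * J $ k $ i * cnj (J $ l $ j)) =
    g_inv (local_metric A g d) (snd d p) k l"
proof -
  interpret c: hermitian_field "chart_image c" "local_metric A g c" by (rule hermitian_field_chart[OF c(1)])
  interpret d: hermitian_field "chart_image d" "local_metric A g d" by (rule hermitian_field_chart[OF c(2)])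
  define Gc Gd where "Gc = local_metric A g c (snd c p)" and "Gd = local_metric A g d (snd d p)"
  define Jb where "Jb = (\<chi> i j. cnj (J $ i $ j))"
  have inv: "invertible Gc" "invertible Gd"
    using c.invertible[of "snd c p"] d.invertible[of "snd d p"] c by (auto simp: Gc_def Gd_def chart_image_def)
  have G: "Gc = transpose J ** Gd ** Jb"
    unfolding Gc_def Gd_def Jb_def J_def by (rule metric_transformation[OF c(1-4)])
  have "transpose J ** (Gd ** Jb ** matrix_inv Gc) = mat 1"
    using matrix_inv_inverse(1)[OF inv(1)] unfolding G by (simp add: matrix_mul_assoc)
  then have "(Gd ** Jb ** matrix_inv Gc) ** transpose J = mat 1"
    using matrix_left_right_inverse by blast
  then have 1: "Gd ** (Jb ** matrix_inv Gc ** transpose J) = mat 1" by (simp add: matrix_mul_assoc)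
  have "matrix_inv Gd = matrix_inv Gd ** (Gd ** (Jb ** matrix_inv Gc ** transpose J))"
    unfolding 1 by (simp add: matrix_mul_rid)
  also have "\<dots> = Jb ** matrix_inv Gc ** transpose J"
    by (simp only: matrix_mul_assoc[of "matrix_inv Gd"] matrix_inv_inverse(2)[OF inv(2)] matrix_mul_lid)
  finally have "matrix_inv Gd $ l $ k = (Jb ** matrix_inv Gc ** transpose J) $ l $ k" by simp
  also have "\<dots> = (\<Sum>i\<in>UNIV. \<Sum>j\<in>UNIV. matrix_inv Gc $ j $ i * J $ k $ i * cnj (J $ l $ j))"
    by (simp add: matrix_matrix_mult_def transpose_def Jb_def sum_distrib_left sum_distrib_right mult_ac)
  finally show ?thesis by (simp add: g_inv_def Gc_def Gd_def)
qed

end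


section \<open>Twice differentiable functions and the Laplacian on the manifold\<close>

context hermitian_mfd
begin

lemmas field_chart = hermitian_field_chart

definition C2 :: "('m \<Rightarrow> complex) \<Rightarrow> bool" where
  "C2 u \<longleftrightarrow> (\<forall>d\<in>A. ck_on 2 (chart_image d) (\<lambda>z. u (chart_inv d z)))"

definition Lap :: "('m, 'n) chart \<Rightarrow> ('m \<Rightarrow> complex) \<Rightarrow> 'm \<Rightarrow> complex" where
  "Lap c u p = hermitian_field.laplacian (local_metric A g c) (\<lambda>z. u (chart_inv c z)) (snd c p)"

lemma Lap_eq:
  assumes c: "c \<in> A"
  shows "Lap c u p = (\<Sum>i\<in>UNIV. \<Sum>j\<in>UNIV. g_inv (local_metric A g c) (snd c p) i j *
    d_dzbar j (d_dz i (\<lambda>z. u (chart_inv c z))) (snd c p))"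
  unfolding Lap_def hermitian_field.laplacian_def[OF field_chart[OF c]] ..

lemma chart_inv_transition:
  assumes "c \<in> A" "d \<in> A" "z \<in> snd c ` (fst c \<inter> fst d)"
  shows "chart_inv d (transition c d z) = chart_inv c z"
  using assms by (auto simp: transition_chart chart_inv_chart)

text \<open>The Jacobians from the mixed second derivative combine with the inverse metric of the chart \<open>c\<close> into that of \<open>d\<close>.\<close>

lemma Lap_change:
  assumes c: "c \<in> A" "d \<in> A" "p \<in> fst c" "p \<in> fst d" and u: "C2 u"
  shows "Lap c u p = Lap d u p"
proof -
  let ?S = "snd c ` (fst c \<inter> fst d)" and ?\<phi> = "transition c d"
  let ?uc = "\<lambda>z. u (chart_inv c z)" and ?ud = "\<lambda>z. u (chart_inv d z)"
  let ?J = "hol_jacobian ?\<phi> (snd c p)"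
  have S: "open ?S" "snd c p \<in> ?S" using c overlap_open by auto
  have hol: "holomorphic_map_on ?S ?\<phi>" using transition_holomorphic c by blast
  have sub: "?\<phi> ` ?S \<subseteq> chart_image d"
    unfolding transition_image[OF c(1,2)] chart_image_def by blast
  have eq: "?uc z = ?ud (?\<phi> z)" if "z \<in> ?S" for z
    by (simp add: chart_inv_transition[OF c(1,2) that])
  have ud: "ck_on 2 (chart_image d) ?ud" using u c(2) unfolding C2_def by blast
  have D: "d_dzbar j (d_dz i ?uc) (snd c p) = (\<Sum>k\<in>UNIV. \<Sum>l\<in>UNIV. d_dzbar l (d_dz k ?ud) (snd d p) * ?J $ k $ i * cnj (?J $ l $ j))" for i j
  proof -
    have "d_dzbar j (d_dz i ?uc) (snd c p) = d_dzbar j (d_dz i (\<lambda>z. ?ud (?\<phi> z))) (snd c p)"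
      by (rule wirtinger_cong(2)[OF S]) (rule wirtinger_cong(1)[OF S(1) _ eq])
    then show ?thesis
      unfolding mixed_derivative_compose[OF hol S ud chart_image_open[OF c(2)] sub] transition_chart[OF c(1,3)] .
  qed
  have "Lap c u p = (\<Sum>i\<in>UNIV. \<Sum>j\<in>UNIV. \<Sum>k\<in>UNIV. \<Sum>l\<in>UNIV. d_dzbar l (d_dz k ?ud) (snd d p) *
      (g_inv (local_metric A g c) (snd c p) i j * ?J $ k $ i * cnj (?J $ l $ j)))"
    unfolding Lap_eq[OF c(1)] D by (simp add: sum_distrib_left mult_ac)
  also have "\<dots> = (\<Sum>k\<in>UNIV. \<Sum>l\<in>UNIV. d_dzbar l (d_dz k ?ud) (snd d p) *
      (\<Sum>i\<in>UNIV. \<Sum>j\<in>UNIV. g_inv (local_metric A g c) (snd c p) i j * ?J $ k $ i * cnj (?J $ l $ j)))"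
    by (subst sum4_rotate) (simp only: sum_distrib_left)
  also have "\<dots> = Lap d u p"
    unfolding g_inv_transformation[OF c(1-4)] Lap_eq[OF c(2)] by (simp add: mult.commute)
  finally show ?thesis .
qed

lemma C2_d:
  assumes "C2 u" "c \<in> A" "z \<in> chart_image c"
  shows "(\<lambda>z. u (chart_inv c z)) differentiable (at z)" "d_dz i (\<lambda>z. u (chart_inv c z)) differentiable (at z)"
proof -
  have u: "ck_on (Suc 1) (chart_image c) (\<lambda>z. u (chart_inv c z))" using assms by (simp add: C2_def numeral_2_eq_2)
  show "(\<lambda>z. u (chart_inv c z)) differentiable (at z)" by (rule ck_differentiable[OF u _ assms(3)]) simp
  show "d_dz i (\<lambda>z. u (chart_inv c z)) differentiable (at z)"
    by (rule ck_differentiable[OF ck_wirtinger(1)[OF u chart_image_open[OF assms(2)]] _ assms(3)]) simp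
qed

lemma Lap_sum:
  assumes u: "\<And>i. i \<in> I \<Longrightarrow> C2 (u i)" and c: "c \<in> A" "p \<in> fst c"
  shows "Lap c (\<lambda>q. \<Sum>i\<in>I. u i q) p = (\<Sum>i\<in>I. Lap c (u i) p)"
proof -
  have z: "snd c p \<in> chart_image c" using c by (simp add: chart_image_def)
  have "d_dzbar j (d_dz i (\<lambda>z. \<Sum>a\<in>I. u a (chart_inv c z))) (snd c p) =
      d_dzbar j (\<lambda>z. \<Sum>a\<in>I. d_dz i (\<lambda>z. u a (chart_inv c z)) z) (snd c p)" for i j
    by (rule wirtinger_cong(2)[OF chart_image_open[OF c(1)] z]) (rule wirtinger_sum(1), rule C2_d(1)[OF u c(1)])
  also have "\<dots> i j = (\<Sum>a\<in>I. d_dzbar j (d_dz i (\<lambda>z. u a (chart_inv c z))) (snd c p))" for i j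
    by (rule wirtinger_sum(2)) (rule C2_d(2)[OF u c(1) z])
  finally have D: "d_dzbar j (d_dz i (\<lambda>z. \<Sum>a\<in>I. u a (chart_inv c z))) (snd c p) =
      (\<Sum>a\<in>I. d_dzbar j (d_dz i (\<lambda>z. u a (chart_inv c z))) (snd c p))" for i j .
  have "Lap c (\<lambda>q. \<Sum>i\<in>I. u i q) p = (\<Sum>i\<in>UNIV. \<Sum>j\<in>UNIV. \<Sum>a\<in>I. g_inv (local_metric A g c) (snd c p) i j *
      d_dzbar j (d_dz i (\<lambda>z. u a (chart_inv c z))) (snd c p))"
    unfolding Lap_eq[OF c(1)] D sum_distrib_left ..
  also have "\<dots> = (\<Sum>i\<in>UNIV. \<Sum>a\<in>I. \<Sum>j\<in>UNIV. g_inv (local_metric A g c) (snd c p) i j *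
      d_dzbar j (d_dz i (\<lambda>z. u a (chart_inv c z))) (snd c p))"
    by (intro sum.cong refl sum.swap)
  also have "\<dots> = (\<Sum>a\<in>I. Lap c (u a) p)" unfolding Lap_eq[OF c(1)] by (rule sum.swap)
  finally show ?thesis .
qed

lemma Lap_local_const:
  assumes c: "c \<in> A" "p \<in> fst c" and U: "openin M U" "p \<in> U" "\<And>q. q \<in> U \<Longrightarrow> u q = k"
  shows "Lap c u p = 0"
proof -
  let ?S = "snd c ` (fst c \<inter> U)"
  have S: "open ?S" "snd c p \<in> ?S" using c U open_chart_image by auto
  have eq: "u (chart_inv c z) = k" if "z \<in> ?S" for z
    using that U(3) chart_inv_chart[OF c(1)] by auto
  have "d_dzbar j (d_dz i (\<lambda>z. u (chart_inv c z))) (snd c p) = d_dzbar j (\<lambda>_. 0) (snd c p)" for i j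
  proof (rule wirtinger_cong(2)[OF S])
    fix z assume "z \<in> ?S"
    from wirtinger_cong(1)[OF S(1) this eq] show "d_dz i (\<lambda>z. u (chart_inv c z)) z = 0"
      by (simp add: wirtinger_const)
  qed
  then show ?thesis unfolding Lap_eq[OF c(1)] by (simp add: wirtinger_const)
qed

section \<open>Integration with respect to the Riemannian volume\<close>

text \<open>The integral of \<open>f\<close> over the domain of \<open>c\<close>, with respect to the Riemannian volume up to a constant factor.\<close>

definition chart_int :: "('m, 'n) chart \<Rightarrow> ('m \<Rightarrow> real) \<Rightarrow> real" where
  "chart_int c f = complex_integral (chart_image c) (\<lambda>z. Re (det (local_metric A g c z)) * f (chart_inv c z))"

definition supported_in :: "'m set \<Rightarrow> ('m \<Rightarrow> real) \<Rightarrow> bool" where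
  "supported_in K f \<longleftrightarrow> compactin M K \<and> (\<forall>q\<in>topspace M - K. f q = 0) \<and>
     (\<forall>d\<in>A. continuous_on (chart_image d) (\<lambda>z. f (chart_inv d z)))"

lemma continuous_density: "c \<in> A \<Longrightarrow> continuous_on (chart_image c) (\<lambda>z. Re (det (local_metric A g c z)))"
  by (intro continuous_on_Re ck_continuous hermitian_field.smooth_det field_chart)

lemma supported_in_chart:
  assumes f: "supported_in K f" and c: "c \<in> A" and S: "snd c ` K \<subseteq> S" "S \<subseteq> chart_image c" and K: "K \<subseteq> fst c"
  shows "supported_on S (\<lambda>z. Re (det (local_metric A g c z)) * f (chart_inv c z))"
  unfolding supported_on_def
proof (intro conjI exI[of _ "snd c ` K"] ballI)
  show "continuous_on S (\<lambda>z. Re (det (local_metric A g c z)) * f (chart_inv c z))"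
    using f c continuous_density[OF c] unfolding supported_in_def
    by (intro continuous_on_subset[OF _ S(2)] continuous_on_mult) auto
  show "compact (snd c ` K)" using f compact_chart_image[OF c _ K] unfolding supported_in_def by blast
  fix z assume z: "z \<in> S - snd c ` K"
  then have zc: "z \<in> chart_image c" using S by blast
  have "chart_inv c z \<notin> K" using z chart_chart_inv(1)[OF zc] by (metis DiffE imageI)
  moreover have "chart_inv c z \<in> topspace M" using chart_chart_inv(2)[OF zc] chart_sub[OF c] by blast
  ultimately show "Re (det (local_metric A g c z)) * f (chart_inv c z) = 0"
    using f unfolding supported_in_def by simp
qed (rule S)

lemma complex_integral_restrict:
  assumes "S \<subseteq> T" "\<And>z. z \<in> T - S \<Longrightarrow> h z = 0"
  shows "complex_integral T h = complex_integral S h"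
proof -
  have "zero_extension T h = zero_extension S h"
    using assms by (intro ext) (auto simp: zero_extension_def)
  then show ?thesis by (simp add: complex_integral_def)
qed

text \<open>The density \<open>det g\<close> changes by \<open>|det J|\<^sup>2\<close>, which is the real Jacobian of the transition map.\<close>

lemma chart_int_change:
  assumes f: "supported_in K f" and c: "c \<in> A" "d \<in> A" and K: "K \<subseteq> fst c \<inter> fst d"
  shows "chart_int c f = chart_int d f"
proof -
  let ?S = "snd c ` (fst c \<inter> fst d)" and ?T = "snd d ` (fst d \<inter> fst c)" and ?\<phi> = "transition c d"
  define h where "h e z = Re (det (local_metric A g e z)) * f (chart_inv e z)" for e z
  have restr: "complex_integral (chart_image a) (h a) = complex_integral (snd a ` (fst a \<inter> fst b)) (h a)"
    if a: "a \<in> A" and ab: "K \<subseteq> fst a \<inter> fst b" for a b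
  proof (rule complex_integral_restrict)
    show "snd a ` (fst a \<inter> fst b) \<subseteq> chart_image a" unfolding chart_image_def by blast
    fix z assume z: "z \<in> chart_image a - snd a ` (fst a \<inter> fst b)"
    then have "chart_inv a z \<notin> K" using ab chart_chart_inv[of z a] by (metis DiffE image_eqI subsetD)
    moreover have "chart_inv a z \<in> topspace M" using chart_chart_inv(2)[of z a] chart_sub[OF a] z by blast
    ultimately show "h a z = 0" using f unfolding supported_in_def h_def by simp
  qed
  have sup: "supported_on (?\<phi> ` ?S) (h d)"
    unfolding transition_image[OF c] h_def
    by (rule supported_in_chart[OF f c(2)]) (use K in \<open>auto simp: chart_image_def\<close>)
  have op: "open (?\<phi> ` ?S)" unfolding transition_image[OF c] by (rule overlap_open[OF c(2,1)])
  have "chart_int d f = complex_integral (?\<phi> ` ?S) (h d)"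
    unfolding chart_int_def h_def[symmetric] transition_image[OF c] by (rule restr) (use c K in auto)
  also have "\<dots> = complex_integral ?S (\<lambda>z. (cmod (det (hol_jacobian ?\<phi> z)))^2 * h d (?\<phi> z))"
    by (rule complex_integral_change_of_variables[OF transition_holomorphic[OF c] overlap_open[OF c] transition_inj[OF c] op sup])
  also have "\<dots> = complex_integral ?S (h c)"
  proof (rule complex_integral_cong)
    fix z assume "z \<in> ?S"
    then obtain q where q: "q \<in> fst c" "q \<in> fst d" "z = snd c q" by auto
    show "(cmod (det (hol_jacobian ?\<phi> z)))^2 * h d (?\<phi> z) = h c z"
      unfolding h_def q(3) det_transformation[OF c q(1,2)] transition_chart[OF c(1) q(1)]
        chart_inv_chart[OF c(1) q(1)] chart_inv_chart[OF c(2) q(2)] by simp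
  qed
  also have "\<dots> = chart_int c f"
    unfolding chart_int_def h_def[symmetric] by (rule restr[symmetric]) (use c K in auto)
  finally show ?thesis ..
qed

lemma chart_int_sum:
  assumes "\<And>i. i \<in> I \<Longrightarrow> supported_in (K i) (f i)" "\<And>i. i \<in> I \<Longrightarrow> K i \<subseteq> fst c" and c: "c \<in> A"
  shows "chart_int c (\<lambda>q. \<Sum>i\<in>I. f i q) = (\<Sum>i\<in>I. chart_int c (f i))"
  unfolding chart_int_def sum_distrib_left
  by (rule complex_integral_sum[OF supported_in_chart chart_image_open])
     (use assms in \<open>auto simp: chart_image_def\<close>)

lemma chart_int_cong: "(\<And>q. q \<in> fst c \<Longrightarrow> f q = f' q) \<Longrightarrow> chart_int c f = chart_int c f'"
  unfolding chart_int_def by (rule complex_integral_cong) (simp add: chart_chart_inv(2))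

lemma chart_int_zero: "chart_int c (\<lambda>_. 0) = 0"
  unfolding chart_int_def by (simp add: complex_integral_zero)

end

section \<open>Bump functions\<close>

lemma ck_positive_part_power: "ck_on m UNIV (\<lambda>s::real. (max 0 s) ^ (m + 1))"
proof (induction m)
  case 0
  then show ?case by (auto intro!: continuous_intros)
next
  case (Suc m)
  have D: "((\<lambda>s::real. (max 0 s) ^ (m + 2)) has_real_derivative (real (m + 2) * (max 0 s) ^ (m + 1))) (at s)" for s
  proof -
    consider "s > 0" | "s < 0" | "s = 0" by linarith
    then show ?thesis
    proof cases
      case 1
      have "((\<lambda>s::real. s ^ (m + 2)) has_real_derivative (real (m + 2) * s ^ (m + 1))) (at s)"
        using DERIV_pow[of "m + 2" s] by simp
      then have "((\<lambda>s::real. (max 0 s) ^ (m + 2)) has_real_derivative (real (m + 2) * s ^ (m + 1))) (at s)"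
        by (rule has_field_derivative_transform_within_open[of _ _ _ "{0<..}"]) (use 1 in auto)
      then show ?thesis using 1 by simp
    next
      case 2
      have "((\<lambda>s::real. (max 0 s) ^ (m + 2)) has_real_derivative 0) (at s)"
        by (rule has_field_derivative_transform_within_open[of "\<lambda>_. 0" _ _ "{..<0}"]) (use 2 in auto)
      then show ?thesis using 2 by simp
    next
      case 3
      have "((\<lambda>h::real. (max 0 h) ^ (m + 2) / h) \<longlongrightarrow> 0) (at 0)"
      proof (rule Lim_null_comparison)
        show "\<forall>\<^sub>F h::real in at 0. norm ((max 0 h) ^ (m + 2) / h) \<le> \<bar>h\<bar> ^ (m + 1)"
        proof (intro always_eventually allI)
          fix h :: real
          show "norm ((max 0 h) ^ (m + 2) / h) \<le> \<bar>h\<bar> ^ (m + 1)"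
          proof (cases "h > 0")
            case False
            then have "(max 0 h) ^ (m + 2) = 0" by simp
            then show ?thesis by (simp only: div_0 norm_zero zero_le_power_abs)
          qed (auto simp: max_def)
        qed
        have "((\<lambda>h::real. \<bar>h\<bar> ^ (m + 1)) \<longlongrightarrow> \<bar>0\<bar> ^ (m + 1)) (at 0)" by (intro tendsto_intros)
        then show "((\<lambda>h::real. \<bar>h\<bar> ^ (m + 1)) \<longlongrightarrow> 0) (at 0)" by simp
      qed
      then show ?thesis using 3 by (simp add: has_field_derivative_iff)
    qed
  qed
  have D': "((\<lambda>s::real. (max 0 s) ^ (Suc m + 1)) has_derivative (\<lambda>v. real (m + 2) * (max 0 s) ^ (m + 1) * v)) (at s)" for s
    using D[of s] by (simp add: has_field_derivative_def)
  have "ck_on m UNIV (\<lambda>s::real. real (m + 2) * (max 0 s) ^ (m + 1) * v)" for v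
    by (intro ck_mult ck_const Suc open_UNIV)
  then show ?case
    unfolding ck_on.simps frechet_derivative_eqI[OF D'] using D' by (auto simp: differentiable_def simp del: power_Suc)
qed

text \<open>The third power makes the function twice continuously differentiable, which suffices for partial integration against
  second derivatives.\<close>

definition ball_bump :: "complex^'n::finite \<Rightarrow> real \<Rightarrow> complex^'n \<Rightarrow> real" where
  "ball_bump z0 r z = (max 0 (r^2 - (z - z0) \<bullet> (z - z0))) ^ 3"

lemma ck_ball_bump: "ck_on 2 UNIV (ball_bump z0 r)"
proof -
  have "ck_on 2 UNIV (\<lambda>z. r^2 - (z - z0) \<bullet> (z - z0))"
    by (intro ck_diff ck_const ck_inner ck_id open_UNIV)
  from ck_compose[OF ck_positive_part_power[of 2] this] show ?thesis
    by (simp add: ball_bump_def [abs_def])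
qed

lemma ball_bump_nonneg: "ball_bump z0 r z \<ge> 0"
  by (simp add: ball_bump_def)

lemma ball_bump_pos: "dist z0 z < r \<Longrightarrow> ball_bump z0 r z > 0"
proof -
  assume d: "dist z0 z < r"
  have "(z - z0) \<bullet> (z - z0) = (dist z0 z)^2" by (simp add: dot_square_norm dist_norm norm_minus_commute)
  moreover have "(dist z0 z)^2 < r^2" using d by (intro power_strict_mono) auto
  ultimately show ?thesis by (simp add: ball_bump_def)
qed

lemma ball_bump_zero: "r > 0 \<Longrightarrow> z \<notin> cball z0 r \<Longrightarrow> ball_bump z0 r z = 0"
proof -
  assume r: "r > 0" "z \<notin> cball z0 r"
  have "(z - z0) \<bullet> (z - z0) = (dist z0 z)^2" by (simp add: dot_square_norm dist_norm norm_minus_commute)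
  moreover have "r^2 < (dist z0 z)^2" using r by (intro power_strict_mono) auto
  ultimately show ?thesis by (simp add: ball_bump_def)
qed

context hermitian_mfd
begin

definition bump :: "('m, 'n) chart \<Rightarrow> 'm \<Rightarrow> real \<Rightarrow> 'm \<Rightarrow> real" where
  "bump c p r q = (if q \<in> fst c then ball_bump (snd c p) r (snd c q) else 0)"

definition bump_support :: "('m, 'n) chart \<Rightarrow> 'm \<Rightarrow> real \<Rightarrow> 'm set" where
  "bump_support c p r = chart_inv c ` cball (snd c p) r"

lemma bump_zero:
  assumes "c \<in> A" "r > 0" "q \<notin> bump_support c p r"
  shows "bump c p r q = 0"
proof (cases "q \<in> fst c")
  case True
  have "snd c q \<notin> cball (snd c p) r"
    using assms(3) chart_inv_chart[OF assms(1) True] unfolding bump_support_def by (metis imageI)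
  from ball_bump_zero[OF assms(2) this] show ?thesis by (simp add: bump_def)
qed (simp add: bump_def)

lemma bump_support_compact:
  assumes "c \<in> A" "cball (snd c p) r \<subseteq> chart_image c"
  shows "compactin M (bump_support c p r)" "bump_support c p r \<subseteq> fst c" "openin M (topspace M - bump_support c p r)"
proof -
  show 1: "compactin M (bump_support c p r)"
    unfolding bump_support_def by (rule compact_chart_preimage) (use assms in auto)
  show "bump_support c p r \<subseteq> fst c"
    unfolding bump_support_def using assms(2) chart_chart_inv(2) by blast
  show "openin M (topspace M - bump_support c p r)"
    using compactin_imp_closedin[OF hausdorff 1] by (simp add: openin_diff)
qed

text \<open>In another chart the bump function is locally either a composition with a transition map or zero; the two cases overlap
  because it vanishes outside a compact subset of the chart domain, which is closed in the Hausdorff space \<open>M\<close>.\<close>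

lemma bump_C2:
  assumes c: "c \<in> A" "r > 0" "cball (snd c p) r \<subseteq> chart_image c"
  shows "C2 (\<lambda>q. complex_of_real (bump c p r q))"
  unfolding C2_def
proof (intro ballI ck_local)
  fix d z assume d: "d \<in> A" and z: "z \<in> chart_image d"
  let ?q = "chart_inv d z" and ?b = "\<lambda>z. complex_of_real (bump c p r (chart_inv d z))"
  have q: "?q \<in> fst d" "snd d ?q = z" using chart_chart_inv[OF z] by auto
  show "\<exists>T. open T \<and> z \<in> T \<and> ck_on 2 T ?b"
  proof (cases "?q \<in> fst c")
    case True
    let ?T = "snd d ` (fst d \<inter> fst c)"
    have T: "open ?T" by (rule overlap_open[OF d c(1)])
    have "ck_on 2 ?T (\<lambda>z. complex_of_real (ball_bump (snd c p) r (transition d c z)))"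
      by (intro ck_of_real ck_compose[OF ck_ball_bump] holomorphic_map_on_ck transition_holomorphic d c T) auto
    then have "ck_on 2 ?T ?b"
      by (rule ck_cong[OF T, rotated]) (auto simp: transition_chart[OF d] chart_inv_chart[OF d] bump_def)
    moreover have "z \<in> ?T" using True q by (metis IntI imageI)
    ultimately show ?thesis using T by blast
  next
    case False
    let ?T = "snd d ` (fst d \<inter> (topspace M - bump_support c p r))"
    have T: "open ?T" by (rule open_chart_image[OF d bump_support_compact(3)[OF c(1,3)]])
    have "ck_on 2 ?T ?b"
      by (rule ck_cong[OF T _ ck_const[of 2 _ 0]]) (auto simp: chart_inv_chart[OF d] bump_zero[OF c(1,2)])
    moreover have "z \<in> ?T"
      using False q bump_support_compact(2)[OF c(1,3)] chart_sub[OF d] by (metis DiffI IntI imageI subsetD)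
    ultimately show ?thesis using T by blast
  qed
qed

end


section \<open>Vanishing of the torsion trace\<close>

context hermitian_mfd
begin

lemma chart_ball:
  assumes c: "c \<in> A" "p \<in> fst c"
  obtains r where "r > 0" "cball (snd c p) r \<subseteq> chart_image c"
  using chart_image_open[OF c(1)] c(2) open_contains_cball[of "chart_image c"] unfolding chart_image_def by blast

lemma openin_chart_ball:
  assumes c: "c \<in> A"
  shows "openin M {q \<in> fst c. dist z (snd c q) < r}"
proof -
  have "openin (top_of_set (chart_image c)) (chart_image c \<inter> ball z r)"
    by (simp add: openin_open_Int)
  from openin_continuous_map_preimage[OF homeomorphic_imp_continuous_map[OF chart_homeomorphic[OF c]] this]
  have "openin (subtopology M (fst c)) {q \<in> fst c. snd c q \<in> chart_image c \<inter> ball z r}"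
    unfolding chart_topspace[OF c] .
  then have "openin M {q \<in> fst c. snd c q \<in> chart_image c \<inter> ball z r}"
    using openin_trans_full chart_domain_open[OF c] by blast
  moreover have "{q \<in> fst c. snd c q \<in> chart_image c \<inter> ball z r} = {q \<in> fst c. dist z (snd c q) < r}"
    by (auto simp: chart_image_def)
  ultimately show ?thesis by simp
qed

text \<open>Normalising finitely many bump functions whose positivity sets cover the compact manifold. The chart at
  \<open>p0\<close> can be prescribed, so that the vanishing of an integrand that contains \<open>\<rho> p0\<close> gives information at
  \<open>p0\<close> in the chart \<open>c0\<close>, whatever other charts the cover uses.\<close>

lemma partition_of_unity:
  assumes compact: "compact_space M" and c0: "c0 \<in> A" "p0 \<in> fst c0"
  obtains I :: "'m set" and C K and \<rho> :: "'m \<Rightarrow> 'm \<Rightarrow> real" where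
    "finite I" "p0 \<in> I" "C p0 = c0" "\<rho> p0 p0 > 0"
    "\<And>i. i \<in> I \<Longrightarrow> C i \<in> A" "\<And>i. i \<in> I \<Longrightarrow> K i \<subseteq> fst (C i)"
    "\<And>i. i \<in> I \<Longrightarrow> compactin M (K i)" "\<And>i q. i \<in> I \<Longrightarrow> q \<in> topspace M - K i \<Longrightarrow> \<rho> i q = 0"
    "\<And>i q. i \<in> I \<Longrightarrow> q \<in> topspace M \<Longrightarrow> \<rho> i q \<ge> 0"
    "\<And>i. i \<in> I \<Longrightarrow> C2 (\<lambda>q. complex_of_real (\<rho> i q))"
    "\<And>q. q \<in> topspace M \<Longrightarrow> (\<Sum>i\<in>I. \<rho> i q) = 1"
proof -
  have p0: "p0 \<in> topspace M" using c0 chart_sub by blast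
  have "\<exists>c r. c \<in> A \<and> p \<in> fst c \<and> r > 0 \<and> cball (snd c p) r \<subseteq> chart_image c \<and> (p = p0 \<longrightarrow> c = c0)"
    if p: "p \<in> topspace M" for p
  proof -
    obtain c where c: "c \<in> A" "p \<in> fst c" "p = p0 \<longrightarrow> c = c0"
      using chart_at[OF p] c0 by (cases "p = p0") (auto simp: charts_at_def)
    then show ?thesis using chart_ball[OF c(1,2)] by metis
  qed
  then obtain C r where C: "\<And>p. p \<in> topspace M \<Longrightarrow> C p \<in> A \<and> p \<in> fst (C p) \<and> r p > 0 \<and>
      cball (snd (C p) p) (r p) \<subseteq> chart_image (C p) \<and> (p = p0 \<longrightarrow> C p = c0)"
    by metis
  define U where "U p = {q \<in> fst (C p). dist (snd (C p) p) (snd (C p) q) < r p}" for p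
  have U: "openin M (U p)" "p \<in> U p" if "p \<in> topspace M" for p
    using C[OF that] openin_chart_ball by (auto simp: U_def)
  have "\<exists>F. finite F \<and> F \<subseteq> U ` topspace M \<and> topspace M \<subseteq> \<Union>F"
  proof -
    have "compactin M (topspace M)" using compact by (simp add: compact_space_def)
    moreover have "Ball (U ` topspace M) (openin M)" "topspace M \<subseteq> \<Union> (U ` topspace M)" using U by blast+
    ultimately show ?thesis unfolding compactin_def by blast
  qed
  then obtain I0 where I0: "finite I0" "I0 \<subseteq> topspace M" "topspace M \<subseteq> \<Union> (U ` I0)"
    by (metis finite_subset_image)
  define I where "I = insert p0 I0"
  have I: "finite I" "p0 \<in> I" "\<And>i. i \<in> I \<Longrightarrow> i \<in> topspace M" using I0 p0 by (auto simp: I_def)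
  define b where "b i = bump (C i) i (r i)" for i
  define h where "h q = (\<Sum>i\<in>I. b i q)" for q
  have b0: "b i q \<ge> 0" for i q by (simp add: b_def bump_def ball_bump_nonneg)
  have bU: "b i q > 0" if "q \<in> U i" for i q using that by (simp add: b_def bump_def U_def ball_bump_pos)
  have bC2: "C2 (\<lambda>q. complex_of_real (b i q))" if "i \<in> I" for i
    unfolding b_def using C[OF I(3)[OF that]] by (intro bump_C2) auto
  have h: "h q > 0" if "q \<in> topspace M" for q
  proof -
    obtain i where "i \<in> I" "q \<in> U i" using I0(3) \<open>q \<in> topspace M\<close> by (auto simp: I_def)
    then show ?thesis unfolding h_def using bU b0 I(1) by (intro sum_pos2[of I i]) auto
  qed
  show thesis
  proof (rule that[of I C "\<lambda>i q. b i q / h q" "\<lambda>i. bump_support (C i) i (r i)"])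
    show "C p0 = c0" using C[OF p0] by simp
    show "b p0 p0 / h p0 > 0" using bU[OF U(2)[OF p0]] h[OF p0] by simp
    fix i assume i: "i \<in> I"
    note Ci = C[OF I(3)[OF i]]
    show "C i \<in> A" using Ci by simp
    show "bump_support (C i) i (r i) \<subseteq> fst (C i)" "compactin M (bump_support (C i) i (r i))"
      using bump_support_compact[of "C i" i "r i"] Ci by auto
    show "b i q / h q = 0" if "q \<in> topspace M - bump_support (C i) i (r i)" for q
      using bump_zero[of "C i" "r i" q i] Ci that by (simp add: b_def)
    show "b i q / h q \<ge> 0" if "q \<in> topspace M" for q using h[OF that] b0 by simp
    show "C2 (\<lambda>q. complex_of_real (b i q / h q))"
      unfolding C2_def
    proof
      fix d assume d: "d \<in> A"
      have ck: "ck_on 2 (chart_image d) (\<lambda>z. complex_of_real (b j (chart_inv d z)))" if "j \<in> I" for j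
        using bC2[OF that] d by (simp add: C2_def)
      have "h (chart_inv d z) \<noteq> 0" if "z \<in> chart_image d" for z
        using h[of "chart_inv d z"] chart_chart_inv(2)[OF that] chart_sub[OF d] by force
      then have "ck_on 2 (chart_image d) (\<lambda>z. complex_of_real (b i (chart_inv d z)) / (\<Sum>j\<in>I. complex_of_real (b j (chart_inv d z))))"
        by (intro ck_divide ck_sum ck i chart_image_open[OF d]) (auto simp: h_def simp flip: of_real_sum)
      then show "ck_on 2 (chart_image d) (\<lambda>z. complex_of_real (b i (chart_inv d z) / h (chart_inv d z)))"
        by (simp add: h_def)
    qed
  next
    fix q assume q: "q \<in> topspace M"
    show "(\<Sum>i\<in>I. b i q / h q) = 1"
      using h[OF q] by (simp add: h_def flip: sum_divide_distrib)
  qed (use I in auto)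
qed

text \<open>Summed over the partition of unity, the integrals of the Laplacians of its members vanish: each
  may be computed in any chart, and the Laplacian of the constant 1 is 0. By partial integration these
  integrals are those of the members against the double divergence of the cofactors, which is
  nonnegative.\<close>

theorem cofactor_div_vanishes:
  assumes compact: "compact_space M" and c0: "c0 \<in> A" "p0 \<in> fst c0"
    and sc: "\<And>c z. c \<in> A \<Longrightarrow> z \<in> chart_image c \<Longrightarrow>
      chern_scalar (local_metric A g c) z = chern_scalar' (local_metric A g c) z"
  shows "hermitian_field.cofactor_div (local_metric A g c0) a (snd c0 p0) = 0"
proof -
  obtain I :: "'m set" and C K and \<rho> :: "'m \<Rightarrow> 'm \<Rightarrow> real" where I: "finite I" "p0 \<in> I" "C p0 = c0" "\<rho> p0 p0 > 0"
    and CA: "\<And>i. i \<in> I \<Longrightarrow> C i \<in> A" and KC: "\<And>i. i \<in> I \<Longrightarrow> K i \<subseteq> fst (C i)"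
    and Kc: "\<And>i. i \<in> I \<Longrightarrow> compactin M (K i)" and \<rho>K: "\<And>i q. i \<in> I \<Longrightarrow> q \<in> topspace M - K i \<Longrightarrow> \<rho> i q = 0"
    and \<rho>0: "\<And>i q. i \<in> I \<Longrightarrow> q \<in> topspace M \<Longrightarrow> \<rho> i q \<ge> 0"
    and \<rho>2: "\<And>i. i \<in> I \<Longrightarrow> C2 (\<lambda>q. complex_of_real (\<rho> i q))"
    and \<rho>1: "\<And>q. q \<in> topspace M \<Longrightarrow> (\<Sum>i\<in>I. \<rho> i q) = 1"
    by (rule partition_of_unity[OF compact c0]) blast
  let ?u = "\<lambda>i q. complex_of_real (\<rho> i q)"
  \<comment> \<open>The Laplacian of a member of the partition of unity as a function on the manifold, well
    defined by \<open>Lap_change\<close>.\<close>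
  define \<Lambda> where "\<Lambda> i q = Re (Lap (SOME c. c \<in> charts_at A q) (?u i) q)" for i q
  have \<Lambda>: "\<Lambda> i q = Re (Lap c (?u i) q)" if i: "i \<in> I" and c: "c \<in> A" "q \<in> fst c" for i c q
  proof -
    have "(SOME c. c \<in> charts_at A q) \<in> charts_at A q"
      using chart_at[of q] chart_sub[OF c(1)] c(2) by (metis someI_ex subsetD)
    then have "(SOME c. c \<in> charts_at A q) \<in> A" "q \<in> fst (SOME c. c \<in> charts_at A q)" by (simp_all add: charts_at_def)
    then show ?thesis unfolding \<Lambda>_def using Lap_change[OF _ c(1) _ c(2) \<rho>2[OF i]] by simp
  qed
  have Kopen: "openin M (topspace M - K i)" if "i \<in> I" for i
    using compactin_imp_closedin[OF hausdorff Kc[OF that]] by (simp add: openin_diff)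
  have \<Lambda>K: "\<Lambda> i q = 0" if i: "i \<in> I" and q: "q \<in> topspace M - K i" for i q
  proof -
    obtain c where c: "c \<in> A" "q \<in> fst c" using chart_at[of q] q by (auto simp: charts_at_def)
    have "Lap c (?u i) q = 0"
      by (rule Lap_local_const[OF c Kopen[OF i] q, of _ 0]) (simp add: \<rho>K[OF i])
    then show ?thesis using \<Lambda>[OF i c] by simp
  qed
  have cont_\<rho>: "continuous_on (chart_image d) (\<lambda>z. \<rho> i (chart_inv d z))" if "i \<in> I" "d \<in> A" for i d
  proof -
    have "continuous_on (chart_image d) (\<lambda>z. Re (?u i (chart_inv d z)))"
      using \<rho>2[OF that(1)] that(2) unfolding C2_def by (intro continuous_on_Re ck_continuous) blast
    then show ?thesis by simp
  qed
  have cont_\<Lambda>: "continuous_on (chart_image d) (\<lambda>z. \<Lambda> i (chart_inv d z))" if i: "i \<in> I" and d: "d \<in> A" for i d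
  proof -
    have "continuous_on (chart_image d) (\<lambda>z. Re (hermitian_field.laplacian (local_metric A g d) (\<lambda>z. ?u i (chart_inv d z)) z))"
      using \<rho>2[OF i] d unfolding C2_def
      by (intro continuous_on_Re hermitian_field.continuous_laplacian[OF field_chart[OF d]]) blast
    then show ?thesis
      by (rule continuous_on_eq) (simp add: \<Lambda>[OF i d chart_chart_inv(2)] Lap_def chart_chart_inv(1))
  qed
  have sup: "supported_in (K j \<inter> K i) (\<lambda>q. \<rho> j q * \<Lambda> i q)" if ij: "i \<in> I" "j \<in> I" for i j
    unfolding supported_in_def
  proof (intro conjI ballI)
    show "compactin M (K j \<inter> K i)"
      by (rule closed_Int_compactin[OF compactin_imp_closedin[OF hausdorff Kc[OF ij(2)]] Kc[OF ij(1)]])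
    show "\<rho> j q * \<Lambda> i q = 0" if "q \<in> topspace M - K j \<inter> K i" for q
      using \<rho>K[OF ij(2), of q] \<Lambda>K[OF ij(1), of q] that by auto
    show "continuous_on (chart_image d) (\<lambda>z. \<rho> j (chart_inv d z) * \<Lambda> i (chart_inv d z))" if "d \<in> A" for d
      by (intro continuous_on_mult cont_\<rho> cont_\<Lambda> ij that)
  qed
  have zero: "(\<Sum>i\<in>I. chart_int (C i) (\<Lambda> i)) = 0"
  proof -
    have "chart_int (C i) (\<Lambda> i) = (\<Sum>j\<in>I. chart_int (C j) (\<lambda>q. \<rho> j q * \<Lambda> i q))" if i: "i \<in> I" for i
    proof -
      have "chart_int (C i) (\<Lambda> i) = chart_int (C i) (\<lambda>q. \<Sum>j\<in>I. \<rho> j q * \<Lambda> i q)"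
      proof (rule chart_int_cong)
        fix q assume "q \<in> fst (C i)"
        then have "q \<in> topspace M" using chart_sub[OF CA[OF i]] by blast
        from \<rho>1[OF this] show "\<Lambda> i q = (\<Sum>j\<in>I. \<rho> j q * \<Lambda> i q)" by (simp flip: sum_distrib_right)
      qed
      also have "\<dots> = (\<Sum>j\<in>I. chart_int (C i) (\<lambda>q. \<rho> j q * \<Lambda> i q))"
        by (rule chart_int_sum[of I "\<lambda>j. K j \<inter> K i"]) (use sup i KC CA in blast)+
      also have "\<dots> = (\<Sum>j\<in>I. chart_int (C j) (\<lambda>q. \<rho> j q * \<Lambda> i q))"
      proof (rule sum.cong[OF refl])
        fix j assume j: "j \<in> I"
        show "chart_int (C i) (\<lambda>q. \<rho> j q * \<Lambda> i q) = chart_int (C j) (\<lambda>q. \<rho> j q * \<Lambda> i q)"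
          by (rule chart_int_change[OF sup[OF i j] CA[OF i] CA[OF j]]) (use KC i j in blast)
      qed
      finally show ?thesis .
    qed
    then have "(\<Sum>i\<in>I. chart_int (C i) (\<Lambda> i)) = (\<Sum>i\<in>I. \<Sum>j\<in>I. chart_int (C j) (\<lambda>q. \<rho> j q * \<Lambda> i q))"
      by (rule sum.cong[OF refl])
    also have "\<dots> = (\<Sum>j\<in>I. \<Sum>i\<in>I. chart_int (C j) (\<lambda>q. \<rho> j q * \<Lambda> i q))" by (rule sum.swap)
    also have "\<dots> = (\<Sum>j\<in>I. chart_int (C j) (\<lambda>q. \<Sum>i\<in>I. \<rho> j q * \<Lambda> i q))"
    proof (rule sum.cong[OF refl])
      fix j assume j: "j \<in> I"
      show "(\<Sum>i\<in>I. chart_int (C j) (\<lambda>q. \<rho> j q * \<Lambda> i q)) = chart_int (C j) (\<lambda>q. \<Sum>i\<in>I. \<rho> j q * \<Lambda> i q)"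
        by (rule chart_int_sum[of I "\<lambda>i. K j \<inter> K i", symmetric]) (use sup j KC CA in blast)+
    qed
    also have "\<dots> = (\<Sum>j\<in>I. chart_int (C j) (\<lambda>_. 0))"
    proof (intro sum.cong refl chart_int_cong)
      fix j q assume j: "j \<in> I" and q: "q \<in> fst (C j)"
      have qM: "q \<in> topspace M" using chart_sub[OF CA[OF j]] q by blast
      have "(\<Sum>i\<in>I. \<Lambda> i q) = Re (\<Sum>i\<in>I. Lap (C j) (?u i) q)"
        using \<Lambda>[OF _ CA[OF j] q] by simp
      also have "(\<Sum>i\<in>I. Lap (C j) (?u i) q) = Lap (C j) (\<lambda>q. \<Sum>i\<in>I. ?u i q) q"
        by (rule Lap_sum[OF \<rho>2 CA[OF j] q, symmetric])
      also have "\<dots> = 0"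
      proof (rule Lap_local_const[OF CA[OF j] q openin_topspace qM])
        fix q assume "q \<in> topspace M"
        from \<rho>1[OF this] show "(\<Sum>i\<in>I. ?u i q) = 1" by (metis of_real_1 of_real_sum)
      qed
      finally show "(\<Sum>i\<in>I. \<rho> j q * \<Lambda> i q) = 0" by (simp flip: sum_distrib_left)
    qed
    finally show ?thesis by (simp add: chart_int_zero)
  qed
  \<comment> \<open>The double divergence of the cofactors in the chart \<open>c\<close>.\<close>
  define N where "N c z = norm2_g (local_metric A g c) z (\<chi> i. hermitian_field.cofactor_div (local_metric A g c) i z)
      / Re (det (local_metric A g c z))" for c z
  have N0: "N c z \<ge> 0" if c: "c \<in> A" and z: "z \<in> chart_image c" for c z
  proof -
    interpret hermitian_field "chart_image c" "local_metric A g c" by (rule field_chart[OF c])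
    have "norm2_g (local_metric A g c) z x \<ge> 0" for x
      using positive[OF z, of x] by (cases "x = 0") (auto simp: norm2_g_def[of _ _ 0] less_imp_le)
    then show ?thesis
      unfolding N_def using det_pos(1)[OF z] by (intro divide_nonneg_pos)
  qed
  have part: "chart_int (C i) (\<Lambda> i) = complex_integral (chart_image (C i)) (\<lambda>z. \<rho> i (chart_inv (C i) z) * N (C i) z)" if i: "i \<in> I" for i
  proof -
    let ?c = "C i"
    interpret hermitian_field "chart_image ?c" "local_metric A g ?c" by (rule field_chart[OF CA[OF i]])
    let ?v = "\<lambda>z. ?u i (chart_inv ?c z)"
    have v: "ck_on 2 (chart_image ?c) ?v" using \<rho>2[OF i] CA[OF i] by (simp add: C2_def)
    have K0: "?v z = 0" if z: "z \<in> chart_image ?c - snd ?c ` K i" for z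
    proof -
      have zc: "z \<in> chart_image ?c" using z by blast
      have "chart_inv ?c z \<notin> K i" using z chart_chart_inv(1)[OF zc] by (metis DiffE imageI)
      then show ?thesis using \<rho>K[OF i, of "chart_inv ?c z"] chart_chart_inv(2)[OF zc] chart_sub[OF CA[OF i]] by auto
    qed
    have sub: "snd ?c ` K i \<subseteq> chart_image ?c" using KC[OF i] unfolding chart_image_def by blast
    have "chart_int ?c (\<Lambda> i) = complex_integral (chart_image ?c) (\<lambda>z. Re (det (local_metric A g ?c z) * laplacian ?v z))"
      unfolding chart_int_def
    proof (rule complex_integral_cong)
      fix z assume z: "z \<in> chart_image ?c"
      show "Re (det (local_metric A g ?c z)) * \<Lambda> i (chart_inv ?c z) = Re (det (local_metric A g ?c z) * laplacian ?v z)"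
        using \<Lambda>[OF i CA[OF i] chart_chart_inv(2)[OF z]] det_pos(2)[OF z] by (simp add: Lap_def chart_chart_inv(1)[OF z])
    qed
    also have "\<dots> = complex_integral (chart_image ?c) (\<lambda>z. Re (?v z * (\<Sum>i\<in>UNIV. d_dz i (cofactor_div i) z)))"
      by (rule integral_laplacian[OF v compact_chart_image[OF CA[OF i] Kc[OF i] KC[OF i]] sub K0])
    also have "\<dots> = complex_integral (chart_image ?c) (\<lambda>z. \<rho> i (chart_inv ?c z) * N ?c z)"
    proof (rule complex_integral_cong)
      fix z assume z: "z \<in> chart_image ?c"
      show "Re (?v z * (\<Sum>i\<in>UNIV. d_dz i (cofactor_div i) z)) = \<rho> i (chart_inv ?c z) * N ?c z"
        unfolding double_divergence[OF sc[OF CA[OF i] z] z] N_def by simp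
    qed
    finally show ?thesis .
  qed
  have supN: "supported_on (chart_image (C i)) (\<lambda>z. \<rho> i (chart_inv (C i) z) * N (C i) z)" if i: "i \<in> I" for i
    unfolding supported_on_def
  proof (intro conjI exI[of _ "snd (C i) ` K i"] ballI)
    interpret hermitian_field "chart_image (C i)" "local_metric A g (C i)" by (rule field_chart[OF CA[OF i]])
    have "continuous_on (chart_image (C i)) (\<lambda>z. Re (\<Sum>a\<in>UNIV. d_dz a (cofactor_div a) z))"
      by (intro continuous_on_Re continuous_on_sum ck_continuous[OF ck_wirtinger(1)[OF smooth_cofactor_div open_S]])
    then have "continuous_on (chart_image (C i)) (N (C i))"
      by (rule continuous_on_eq) (simp add: double_divergence[OF sc[OF CA[OF i]]] N_def)
    then show "continuous_on (chart_image (C i)) (\<lambda>z. \<rho> i (chart_inv (C i) z) * N (C i) z)"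
      by (intro continuous_on_mult cont_\<rho> i CA)
    show "compact (snd (C i) ` K i)" by (rule compact_chart_image[OF CA[OF i] Kc[OF i] KC[OF i]])
    show "snd (C i) ` K i \<subseteq> chart_image (C i)" using KC[OF i] unfolding chart_image_def by blast
    fix z assume z: "z \<in> chart_image (C i) - snd (C i) ` K i"
    then have zc: "z \<in> chart_image (C i)" by blast
    have "chart_inv (C i) z \<notin> K i" using z chart_chart_inv(1)[OF zc] by (metis DiffE imageI)
    then show "\<rho> i (chart_inv (C i) z) * N (C i) z = 0"
      using \<rho>K[OF i, of "chart_inv (C i) z"] chart_chart_inv(2)[OF zc] chart_sub[OF CA[OF i]] by auto
  qed
  have nonneg: "\<rho> i (chart_inv (C i) z) * N (C i) z \<ge> 0" if "i \<in> I" "z \<in> chart_image (C i)" for i z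
    using N0[OF CA[OF that(1)] that(2)] \<rho>0[OF that(1)] chart_chart_inv(2)[OF that(2)] chart_sub[OF CA[OF that(1)]]
    by (metis mult_nonneg_nonneg subsetD)
  have "chart_int (C i) (\<Lambda> i) \<ge> 0" if i: "i \<in> I" for i
    unfolding part[OF i] by (rule complex_integral_nonneg_zero(1)[OF supN[OF i] chart_image_open[OF CA[OF i]] nonneg[OF i]])
  then have zero0: "chart_int (C p0) (\<Lambda> p0) = 0"
    using zero sum_nonneg_eq_0_iff[OF I(1), of "\<lambda>i. chart_int (C i) (\<Lambda> i)"] I(2) by blast
  have int0: "complex_integral (chart_image c0) (\<lambda>z. \<rho> p0 (chart_inv c0 z) * N c0 z) = 0"
    using part[OF I(2)] zero0 unfolding I(3) by simp
  have z0: "snd c0 p0 \<in> chart_image c0" using c0 by (simp add: chart_image_def)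
  have "\<rho> p0 (chart_inv c0 (snd c0 p0)) * N c0 (snd c0 p0) = 0"
    by (rule complex_integral_nonneg_zero(2)[OF supN[OF I(2), unfolded I(3)] chart_image_open[OF c0(1)] nonneg[OF I(2), unfolded I(3)] int0 z0])
  then have N00: "N c0 (snd c0 p0) = 0" using I(4) chart_inv_chart[OF c0] by simp
  interpret hermitian_field "chart_image c0" "local_metric A g c0" by (rule field_chart[OF c0(1)])
  have "norm2_g (local_metric A g c0) (snd c0 p0) (\<chi> i. cofactor_div i (snd c0 p0)) = 0"
    using N00 det_pos(1)[OF z0] by (simp add: N_def)
  then have "(\<chi> i. cofactor_div i (snd c0 p0)) = 0"
    using positive[OF z0, of "\<chi> i. cofactor_div i (snd c0 p0)"] by force
  then show ?thesis by (simp add: vec_eq_iff)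
qed

end

theorem theorem1p3:
  fixes M :: "'m topology"
    and A :: "('m, 'n::finite) chart set"
    and g :: "('m, 'n) metric"
    and k :: nat
    and \<alpha> \<beta> :: real
  assumes "complex_manifold M A"
    and "compact_space M"
    and "hermitian_metric M A g"
    and "k \<in> {1, 2, 3, 4}"
    and "\<beta> \<noteq> 0"
    and "\<forall>p\<in>topspace M. \<forall>X\<in>T10 A p. X \<noteq> (\<lambda>_. 0) \<longrightarrow>
           (\<forall>c\<in>charts_at A p. mixed_curvature A g k \<alpha> \<beta> c p X = 0)"
    and "\<alpha> * (real CARD('n) + 1) + 2 * \<beta> = 0"
  shows "balanced A g"
proof -
  interpret hermitian_mfd M A g
    by unfold_locales (rule assms(1), rule assms(3))
  have sc: "chern_scalar (local_metric A g c) z = chern_scalar' (local_metric A g c) z"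
    if c: "c \<in> A" and z: "z \<in> chart_image c" for c z
  proof -
    interpret hermitian_field "chart_image c" "local_metric A g c" by (rule field_chart[OF c])
    show ?thesis
    proof (rule scalars_coincide[OF invertible[OF z] norm2_complex[OF z] positive[OF z] assms(4,5,7)])
      fix x :: "complex^'n" assume x: "x \<noteq> 0"
      let ?p = "chart_inv c z"
      have p: "c \<in> charts_at A ?p" "snd c ?p = z" using chart_chart_inv[OF z] c by (auto simp: charts_at_def)
      have "tangent c ?p x \<noteq> (\<lambda>_. 0)" using tangent_self[OF p(1), of x] x by auto
      then have "mixed_curvature A g k \<alpha> \<beta> c ?p (tangent c ?p x) = 0"
        using assms(6) point_in[OF p(1)] tangent_T10[OF p(1)] p(1) by blast
      then show "complex_of_real (\<alpha> / norm2_g (local_metric A g c) z x) * ricci_form k (local_metric A g c) z x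
        + complex_of_real \<beta> * hol_sec_curv (local_metric A g c) z x = 0"
        unfolding mixed_curvature_def Let_def tangent_self[OF p(1)] p(2) .
    qed
  qed
  show ?thesis
    unfolding balanced_def
  proof (intro ballI allI)
    fix c z v assume c: "c \<in> A" and z: "z \<in> chart_image c"
    interpret hermitian_field "chart_image c" "local_metric A g c" by (rule field_chart[OF c])
    have "cofactor_div a z = 0" for a
      using cofactor_div_vanishes[OF assms(2) c chart_chart_inv(2)[OF z] sc, of a] chart_chart_inv(1)[OF z] by simp
    note tr = cofactor_div_zero_imp[OF z this]
    show "ext_deriv (2 * (CARD('n) - 1))
        (\<lambda>w. wedge_power2 (CARD('n) - 1) (fundamental_form (local_metric A g c) w)) z v = 0"
      by (rule ext_deriv_fundamental_power[OF smooth_imp_diff[OF smooth z] invertible[OF z] tr(2) tr(1)])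
  qed
qed

end
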